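(* Every accessible, locally finite, quasi-transitive graph is tangle-accessible.
   Context: A graph is quasi-transitive if its automorphism group has only finitely many orbits on its vertex set. A separation of a graph $G$ is an unordered pair $\{A,B\}$ with $A\cup B=V(G)$ and no edge between $A\setminus B$ and $B\setminus A$; its order is $|A\cap B|$; its orientations are $(A,B)$ and $(B,A)$. Ends: an end is an equivalence class of rays, two rays being equivalent if for every finite vertex set $X$ they have tails in the same component of $G-X$. A finite-order separation $\{A,B\}$ distinguishes two ends if rays of one have tails in $G[A]$ and rays of the other have tails in $G[B]$. $G$ is accessible if there is $K\in\mathbb{N}$ such that every two ends of $G$ are distinguished by a separation of order at most $K$. Tangles: for $k\in\mathbb{N}\cup\{\aleph_0\}$ let $S_k$ be the set of separations of order $<k$. A $k$-tangle is a set containing exactly one orientation of each element of $S_k$ such that for any three (not necessarily distinct) members $(A_1,B_1),(A_2,B_2),(A_3,B_3)$ we have $G[A_1]\cup G[A_2]\cup G[A_3]\ne G$; a tangle is a $k$-tangle for some $k$. A separation distinguishes two tangles if they contain different orientations of it; two tangles are distinguishable if some separation distinguishes them. $G$ is tangle-accessible if there is $K\in\mathbb{N}$ such that every two distinguishable tangles of $G$ are distinguished by a separation of order at most $K$. *)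

theory Defs
  imports Main "HOL-Library.Extended_Nat"
begin

definition graph :: "'a set \<Rightarrow> ('a \<Rightarrow> 'a \<Rightarrow> bool) \<Rightarrow> bool" where
  "graph V E \<longleftrightarrow> (\<forall>x y. E x y \<longrightarrow> x \<in> V \<and> y \<in> V \<and> x \<noteq> y \<and> E y x)"

definition locally_finite :: "'a set \<Rightarrow> ('a \<Rightarrow> 'a \<Rightarrow> bool) \<Rightarrow> bool" where
  "locally_finite V E \<longleftrightarrow> (\<forall>v\<in>V. finite {u. E v u})"

definition automorphism :: "'a set \<Rightarrow> ('a \<Rightarrow> 'a \<Rightarrow> bool) \<Rightarrow> ('a \<Rightarrow> 'a) \<Rightarrow> bool" where
  "automorphism V E f \<longleftrightarrow> bij_betw f V V \<and> (\<forall>x\<in>V. \<forall>y\<in>V. E x y \<longleftrightarrow> E (f x) (f y))"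

definition orbit :: "'a set \<Rightarrow> ('a \<Rightarrow> 'a \<Rightarrow> bool) \<Rightarrow> 'a \<Rightarrow> 'a set" where
  "orbit V E v = {f v | f. automorphism V E f}"

definition quasi_transitive :: "'a set \<Rightarrow> ('a \<Rightarrow> 'a \<Rightarrow> bool) \<Rightarrow> bool" where
  "quasi_transitive V E \<longleftrightarrow> finite (orbit V E ` V)"

definition ray :: "'a set \<Rightarrow> ('a \<Rightarrow> 'a \<Rightarrow> bool) \<Rightarrow> (nat \<Rightarrow> 'a) \<Rightarrow> bool" where
  "ray V E r \<longleftrightarrow> inj r \<and> (\<forall>n. r n \<in> V \<and> E (r n) (r (Suc n)))"

definition conn_avoiding :: "('a \<Rightarrow> 'a \<Rightarrow> bool) \<Rightarrow> 'a set \<Rightarrow> 'a \<Rightarrow> 'a \<Rightarrow> bool" where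
  "conn_avoiding E X u v \<longleftrightarrow> u \<notin> X \<and> v \<notin> X \<and>
     (u, v) \<in> {(x, y). E x y \<and> x \<notin> X \<and> y \<notin> X}\<^sup>*"

definition equiv_rays :: "'a set \<Rightarrow> ('a \<Rightarrow> 'a \<Rightarrow> bool) \<Rightarrow> (nat \<Rightarrow> 'a) \<Rightarrow> (nat \<Rightarrow> 'a) \<Rightarrow> bool" where
  "equiv_rays V E r s \<longleftrightarrow> (\<forall>X. finite X \<longrightarrow>
     (\<exists>N. \<forall>n\<ge>N. \<forall>m\<ge>N. conn_avoiding E X (r n) (s m)))"

definition is_end :: "'a set \<Rightarrow> ('a \<Rightarrow> 'a \<Rightarrow> bool) \<Rightarrow> (nat \<Rightarrow> 'a) set \<Rightarrow> bool" where
  "is_end V E \<omega> \<longleftrightarrow> (\<exists>r. ray V E r \<and> \<omega> = {s. ray V E s \<and> equiv_rays V E r s})"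

text \<open>Separations, given by one of their orientations (A,B).\<close>
definition is_sep :: "'a set \<Rightarrow> ('a \<Rightarrow> 'a \<Rightarrow> bool) \<Rightarrow> 'a set \<Rightarrow> 'a set \<Rightarrow> bool" where
  "is_sep V E A B \<longleftrightarrow> A \<union> B = V \<and> (\<forall>x y. x \<in> A - B \<longrightarrow> y \<in> B - A \<longrightarrow> \<not> E x y)"

definition sep_order :: "'a set \<Rightarrow> 'a set \<Rightarrow> enat" where
  "sep_order A B = (if finite (A \<inter> B) then enat (card (A \<inter> B)) else \<infinity>)"

definition tail_in :: "(nat \<Rightarrow> 'a) \<Rightarrow> 'a set \<Rightarrow> bool" where
  "tail_in r A \<longleftrightarrow> (\<exists>N. \<forall>n\<ge>N. r n \<in> A)"

definition sep_distinguishes_ends ::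
  "'a set \<Rightarrow> 'a set \<Rightarrow> (nat \<Rightarrow> 'a) set \<Rightarrow> (nat \<Rightarrow> 'a) set \<Rightarrow> bool" where
  "sep_distinguishes_ends A B \<omega>1 \<omega>2 \<longleftrightarrow>
     ((\<forall>r\<in>\<omega>1. tail_in r A) \<and> (\<forall>r\<in>\<omega>2. tail_in r B)) \<or>
     ((\<forall>r\<in>\<omega>1. tail_in r B) \<and> (\<forall>r\<in>\<omega>2. tail_in r A))"

definition accessible :: "'a set \<Rightarrow> ('a \<Rightarrow> 'a \<Rightarrow> bool) \<Rightarrow> bool" where
  "accessible V E \<longleftrightarrow> (\<exists>K::nat. \<forall>\<omega>1 \<omega>2. is_end V E \<omega>1 \<longrightarrow> is_end V E \<omega>2 \<longrightarrow> \<omega>1 \<noteq> \<omega>2 \<longrightarrow>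
     (\<exists>A B. is_sep V E A B \<and> sep_order A B \<le> enat K \<and> sep_distinguishes_ends A B \<omega>1 \<omega>2))"

definition covers3 :: "'a set \<Rightarrow> ('a \<Rightarrow> 'a \<Rightarrow> bool) \<Rightarrow> 'a set \<Rightarrow> 'a set \<Rightarrow> 'a set \<Rightarrow> bool" where
  "covers3 V E A1 A2 A3 \<longleftrightarrow> A1 \<union> A2 \<union> A3 = V \<and>
     (\<forall>x y. E x y \<longrightarrow> (x \<in> A1 \<and> y \<in> A1) \<or> (x \<in> A2 \<and> y \<in> A2) \<or> (x \<in> A3 \<and> y \<in> A3))"

text \<open>k-tangles, k \<in> \<nat> \<union> {aleph_0} (the latter rendered as \<infinity>): sets of oriented
separations of order < k.\<close>
definition is_k_tangle :: "'a set \<Rightarrow> ('a \<Rightarrow> 'a \<Rightarrow> bool) \<Rightarrow> enat \<Rightarrow> ('a set \<times> 'a set) set \<Rightarrow> bool" where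
  "is_k_tangle V E k \<tau> \<longleftrightarrow>
     (\<forall>(A, B)\<in>\<tau>. is_sep V E A B \<and> sep_order A B < k) \<and>
     (\<forall>A B. is_sep V E A B \<and> sep_order A B < k \<longrightarrow> card (\<tau> \<inter> {(A, B), (B, A)}) = 1) \<and>
     (\<forall>A1 B1 A2 B2 A3 B3. (A1, B1) \<in> \<tau> \<longrightarrow> (A2, B2) \<in> \<tau> \<longrightarrow> (A3, B3) \<in> \<tau> \<longrightarrow>
        \<not> covers3 V E A1 A2 A3)"

definition is_tangle :: "'a set \<Rightarrow> ('a \<Rightarrow> 'a \<Rightarrow> bool) \<Rightarrow> ('a set \<times> 'a set) set \<Rightarrow> bool" where
  "is_tangle V E \<tau> \<longleftrightarrow> (\<exists>k. is_k_tangle V E k \<tau>)"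

definition sep_distinguishes_tangles ::
  "'a set \<Rightarrow> ('a \<Rightarrow> 'a \<Rightarrow> bool) \<Rightarrow> 'a set \<Rightarrow> 'a set \<Rightarrow> ('a set \<times> 'a set) set \<Rightarrow> ('a set \<times> 'a set) set \<Rightarrow> bool" where
  "sep_distinguishes_tangles V E A B \<tau>1 \<tau>2 \<longleftrightarrow> is_sep V E A B \<and> A \<noteq> B \<and>
     (((A, B) \<in> \<tau>1 \<and> (B, A) \<in> \<tau>2) \<or> ((B, A) \<in> \<tau>1 \<and> (A, B) \<in> \<tau>2))"

definition tangle_accessible :: "'a set \<Rightarrow> ('a \<Rightarrow> 'a \<Rightarrow> bool) \<Rightarrow> bool" where
  "tangle_accessible V E \<longleftrightarrow> (\<exists>K::nat. \<forall>\<tau>1 \<tau>2. is_tangle V E \<tau>1 \<longrightarrow> is_tangle V E \<tau>2 \<longrightarrow>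
     (\<exists>A B. sep_distinguishes_tangles V E A B \<tau>1 \<tau>2) \<longrightarrow>
     (\<exists>A B. sep_distinguishes_tangles V E A B \<tau>1 \<tau>2 \<and> sep_order A B \<le> enat K))"

end

theory Submission
  imports Defs
begin

text \<open>
  Efficient distinguishers of tangles in a connected locally finite graph are tight, so only finitely
  many of given order meet a given vertex. Choosing those that lexicographically minimise the numbers
  of crossings with efficient separations of order 0, 1, 2, ... yields a canonical nested set \<open>N\<close>
  distinguishing all distinguishable tangles efficiently.

  Suppose that arbitrarily large orders occur. Translating the separators to a common vertex, an
  ultrafilter limit of the tangles is an end tangle \<open>\<omega>\<close> (a tangle of order \<open>\<aleph>\<^sub>0\<close>), and nestedness
  with \<open>N\<close> forces the tangles to agree with \<open>\<omega>\<close> up to unbounded orders. So some \<open>\<omega>\<close> is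
  distinguished in \<open>N\<close> from other tangles by separations \<open>(A, B)\<close> of unbounded order. Call a vertex
  recurrent if it lies in such separators of unbounded order. By accessibility, end tangles that agree
  up to order \<open>K\<close> coincide; applied to translates of \<open>\<omega>\<close> and to limits of vertices this shows
  that the separators of large order consist of recurrent vertices while \<open>A - B\<close> contains none. Hence
  \<open>A \<inter> B\<close> is the neighbourhood of a component of the graph minus the recurrent vertices. Up to the
  stabiliser of \<open>\<omega>\<close> infinitely many of these components coincide, which bounds the orders after all.
\<close>

section \<open>Ultrafilters\<close>

definition ultra :: "'b set set \<Rightarrow> bool" where
  "ultra U \<longleftrightarrow> (\<forall>A. A \<in> U \<or> - A \<in> U) \<and> (\<forall>A\<in>U. \<forall>B\<in>U. A \<inter> B \<in> U) \<and> (\<forall>A\<in>U. infinite A)"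

lemma ultra_Int: "ultra U \<Longrightarrow> A \<in> U \<Longrightarrow> B \<in> U \<Longrightarrow> A \<inter> B \<in> U"
  unfolding ultra_def by blast

lemma ultra_infinite: "ultra U \<Longrightarrow> A \<in> U \<Longrightarrow> infinite A"
  unfolding ultra_def by blast

lemma ultra_cases: "ultra U \<Longrightarrow> A \<in> U \<or> - A \<in> U"
  unfolding ultra_def by blast

lemma ultra_mono: "ultra U \<Longrightarrow> A \<in> U \<Longrightarrow> A \<subseteq> B \<Longrightarrow> B \<in> U"
proof -
  assume U: "ultra U" "A \<in> U" "A \<subseteq> B"
  then have "A \<inter> - B = {}" by blast
  then show "B \<in> U" using ultra_cases[of U B] ultra_Int[of U A "- B"] ultra_infinite[of U "{}"] U by auto
qed

lemma ultra_Compl: "ultra U \<Longrightarrow> A \<notin> U \<longleftrightarrow> - A \<in> U"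
  using ultra_cases[of U A] ultra_Int[of U A "- A"] ultra_infinite[of U "A \<inter> - A"] by auto

lemma ultra_finite: "ultra U \<Longrightarrow> finite A \<Longrightarrow> A \<notin> U"
  using ultra_infinite by blast

lemma ultra_cofinite: "ultra U \<Longrightarrow> finite (- A) \<Longrightarrow> A \<in> U"
  using ultra_cases ultra_infinite by blast

lemma ultra_ge: "ultra U \<Longrightarrow> {n::nat. k < n} \<in> U"
  by (rule ultra_cofinite) (auto simp: Compl_eq not_less)

lemma ultra_Un: "ultra U \<Longrightarrow> A \<union> B \<in> U \<Longrightarrow> A \<in> U \<or> B \<in> U"
  using ultra_Compl[of U A] ultra_Compl[of U B] ultra_Int[of U "- A" "- B"]
    ultra_Compl[of U "A \<union> B"] by auto

lemma ultra_UNION: "finite I \<Longrightarrow> ultra U \<Longrightarrow> (\<Union>i\<in>I. A i) \<in> U \<Longrightarrow> \<exists>i\<in>I. A i \<in> U"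
proof (induction I rule: finite_induct)
  case empty
  then show ?case using ultra_finite[of U "{}"] by simp
next
  case (insert i I)
  then show ?case using ultra_Un[of U "A i" "\<Union>i\<in>I. A i"] by auto
qed

lemma ex_ultra:
  assumes "infinite (Y :: 'b set)"
  shows "\<exists>U. ultra U \<and> Y \<in> U"
proof -
  define P where "P F \<longleftrightarrow> Y \<in> F \<and> (\<forall>A\<in>F. \<forall>B\<in>F. A \<inter> B \<in> F) \<and> (\<forall>A\<in>F. infinite A) \<and>
    (\<forall>A\<in>F. \<forall>B. A \<subseteq> B \<longrightarrow> B \<in> F)" for F :: "'b set set"
  have P0: "P {A. Y \<subseteq> A}"
    using assms infinite_super by (auto simp: P_def)
  have "\<exists>M\<in>{F. P F}. \<forall>X\<in>{F. P F}. M \<subseteq> X \<longrightarrow> X = M"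
  proof (rule subset_Zorn_nonempty)
    show "{F. P F} \<noteq> {}" using P0 by blast
  next
    fix \<C> assume ne: "\<C> \<noteq> {}" and ch: "subset.chain {F. P F} \<C>"
    have sub: "P F" if "F \<in> \<C>" for F using ch that by (auto simp: subset.chain_def)
    have tot: "F \<subseteq> G \<or> G \<subseteq> F" if "F \<in> \<C>" "G \<in> \<C>" for F G
      using ch that by (auto simp: subset.chain_def)
    have "A \<inter> B \<in> \<Union>\<C>" if AB: "A \<in> \<Union>\<C>" "B \<in> \<Union>\<C>" for A B
    proof -
      obtain F G where FG: "F \<in> \<C>" "G \<in> \<C>" "A \<in> F" "B \<in> G" using AB by blast
      then have "(A \<in> F \<and> B \<in> F) \<or> (A \<in> G \<and> B \<in> G)" using tot[of F G] by blast
      moreover have "P F" "P G" using FG sub by auto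
      ultimately have "A \<inter> B \<in> F \<or> A \<inter> B \<in> G" by (auto simp: P_def)
      then show ?thesis using FG by blast
    qed
    moreover have "Y \<in> \<Union>\<C>" using ne sub by (auto simp: P_def)
    moreover have "\<forall>A\<in>\<Union>\<C>. infinite A" using sub by (auto simp: P_def)
    moreover have "\<forall>A\<in>\<Union>\<C>. \<forall>B. A \<subseteq> B \<longrightarrow> B \<in> \<Union>\<C>"
    proof (intro ballI allI impI)
      fix A B assume "A \<in> \<Union>\<C>" "A \<subseteq> B"
      then obtain F where "F \<in> \<C>" "A \<in> F" by blast
      moreover then have "B \<in> F" using sub[of F] \<open>A \<subseteq> B\<close> by (auto simp: P_def)
      ultimately show "B \<in> \<Union>\<C>" by blast
    qed
    ultimately show "\<Union>\<C> \<in> {F. P F}" by (simp add: P_def)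
  qed
  then obtain M where M: "P M" and mx: "\<And>X. P X \<Longrightarrow> M \<subseteq> X \<Longrightarrow> X = M" by blast
  have ext: "A \<in> M" if inf: "\<And>B. B \<in> M \<Longrightarrow> infinite (B \<inter> A)" for A
  proof -
    let ?F = "{C. \<exists>B\<in>M. B \<inter> A \<subseteq> C}"
    have "P ?F" unfolding P_def
    proof (intro conjI ballI allI impI)
      show "Y \<in> ?F" using M by (auto simp: P_def)
      fix C assume C: "C \<in> ?F"
      then obtain B where B: "B \<in> M" "B \<inter> A \<subseteq> C" by blast
      show "infinite C" using inf[OF B(1)] B(2) infinite_super by blast
      show "D \<in> ?F" if "C \<subseteq> D" for D using B that by blast
      fix D assume "D \<in> ?F"
      then obtain B' where B': "B' \<in> M" "B' \<inter> A \<subseteq> D" by blast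
      then have "B \<inter> B' \<in> M" using M B by (auto simp: P_def)
      moreover have "(B \<inter> B') \<inter> A \<subseteq> C \<inter> D" using B(2) B'(2) by auto
      ultimately show "C \<inter> D \<in> ?F" by auto
    qed
    moreover have "M \<subseteq> ?F" by blast
    ultimately have "?F = M" by (rule mx)
    moreover have "A \<in> ?F" using M by (auto simp: P_def)
    ultimately show ?thesis by blast
  qed
  have "A \<in> M \<or> - A \<in> M" for A
  proof (rule ccontr)
    assume "\<not> ?thesis"
    then obtain B B' where BB: "B \<in> M" "finite (B \<inter> A)" "B' \<in> M" "finite (B' \<inter> - A)"
      using ext[of A] ext[of "- A"] by blast
    then have "B \<inter> B' \<in> M" using M by (simp add: P_def)
    moreover have "finite (B \<inter> B')"
      by (rule finite_subset[of _ "(B \<inter> A) \<union> (B' \<inter> - A)"]) (use BB in auto)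
    ultimately show False using M by (auto simp: P_def)
  qed
  then have "ultra M" using M by (auto simp: P_def ultra_def)
  then show ?thesis using M by (auto simp: P_def)
qed

section \<open>Separations and tangles\<close>

lemma is_sep_swap: "is_sep V E A B \<Longrightarrow> graph V E \<Longrightarrow> is_sep V E B A"
  unfolding is_sep_def graph_def by blast

lemma is_sep_edge: "is_sep V E A B \<Longrightarrow> graph V E \<Longrightarrow> E x y \<Longrightarrow> x \<in> A \<and> y \<in> A \<or> x \<in> B \<and> y \<in> B"
  unfolding is_sep_def graph_def by blast

lemma is_sepI:
  assumes "graph V E" "A \<union> B = V" "\<And>x y. E x y \<Longrightarrow> x \<in> A \<and> y \<in> A \<or> x \<in> B \<and> y \<in> B"
  shows "is_sep V E A B"
  using assms unfolding is_sep_def by blast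

lemma card_corners:
  assumes "A \<union> B = C \<union> D" "finite (A \<inter> B)" "finite (C \<inter> D)"
  shows "card ((A \<inter> C) \<inter> (B \<union> D)) + card ((A \<union> C) \<inter> (B \<inter> D)) = card (A \<inter> B) + card (C \<inter> D)"
    and "finite ((A \<inter> C) \<inter> (B \<union> D))" and "finite ((A \<union> C) \<inter> (B \<inter> D))"
proof -
  let ?P = "(A \<inter> C) \<inter> (B \<union> D)" and ?Q = "(A \<union> C) \<inter> (B \<inter> D)"
  have eq: "?P \<union> ?Q = (A \<inter> B) \<union> (C \<inter> D)" "?P \<inter> ?Q = (A \<inter> B) \<inter> (C \<inter> D)"
    using assms(1) by blast+
  have fin: "finite (?P \<union> ?Q)" unfolding eq using assms by simp
  then show *: "finite ?P" "finite ?Q" by simp_all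
  show "card ?P + card ?Q = card (A \<inter> B) + card (C \<inter> D)"
    using card_Un_Int[OF *] card_Un_Int[OF assms(2,3)] eq by simp
qed

definition nested :: "'a set \<Rightarrow> 'a set \<Rightarrow> 'a set \<Rightarrow> 'a set \<Rightarrow> bool" where
  "nested A B C D \<longleftrightarrow> A \<subseteq> C \<and> D \<subseteq> B \<or> A \<subseteq> D \<and> C \<subseteq> B \<or> B \<subseteq> C \<and> D \<subseteq> A \<or> B \<subseteq> D \<and> C \<subseteq> A"

lemma nested_sym: "nested A B C D \<longleftrightarrow> nested C D A B"
  unfolding nested_def by argo

lemma nested_swap1: "nested A B C D \<longleftrightarrow> nested B A C D"
  unfolding nested_def by argo

lemma nested_swap2: "nested A B C D \<longleftrightarrow> nested A B D C"
  unfolding nested_def by argo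

lemma nested_corners:
  assumes "\<not> nested A B C D" "nested A B X Y" "nested C D X Y"
  shows "nested (A \<inter> C) (B \<union> D) X Y" "nested (A \<union> C) (B \<inter> D) X Y"
proof -
  have 1: "\<not> (B \<subseteq> X \<and> Y \<subseteq> A \<and> D \<subseteq> Y \<and> X \<subseteq> C)" "\<not> (B \<subseteq> Y \<and> X \<subseteq> A \<and> D \<subseteq> X \<and> Y \<subseteq> C)"
    using assms(1) unfolding nested_def by (meson subset_trans)+
  show "nested (A \<inter> C) (B \<union> D) X Y"
    using assms(2,3) 1 unfolding nested_def
    by (elim disjE conjE) (simp_all add: le_supI1 le_supI2 le_infI1 le_infI2)
  have 2: "\<not> (A \<subseteq> X \<and> Y \<subseteq> B \<and> C \<subseteq> Y \<and> X \<subseteq> D)" "\<not> (A \<subseteq> Y \<and> X \<subseteq> B \<and> C \<subseteq> X \<and> Y \<subseteq> D)"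
    using assms(1) unfolding nested_def by (meson subset_trans)+
  show "nested (A \<union> C) (B \<inter> D) X Y"
    using assms(2,3) 2 unfolding nested_def
    by (elim disjE conjE) (simp_all add: le_supI1 le_supI2 le_infI1 le_infI2)
qed

lemma nested_corner:
  assumes "nested A B X Y \<or> nested C D X Y"
  shows "nested (A \<inter> C) (B \<union> D) X Y \<or> nested (A \<union> C) (B \<inter> D) X Y"
  using assms unfolding nested_def
  by (elim disjE conjE; simp add: le_supI1 le_supI2 le_infI1 le_infI2)

locale gr =
  fixes V :: "'a set" and E :: "'a \<Rightarrow> 'a \<Rightarrow> bool"
  assumes graph: "graph V E"
begin

abbreviation "sep \<equiv> is_sep V E"
abbreviation "tangle \<equiv> is_tangle V E"
abbreviation "inf_tangle \<equiv> is_k_tangle V E \<infinity>"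

lemma E_sym: "E x y \<Longrightarrow> E y x" and E_V: "E x y \<Longrightarrow> x \<in> V" "E x y \<Longrightarrow> y \<in> V"
  using graph unfolding graph_def by blast+

lemma sep_swap: "sep A B \<Longrightarrow> sep B A"
  using is_sep_swap graph by blast

lemma sep_edge: "sep A B \<Longrightarrow> E x y \<Longrightarrow> x \<in> A \<and> y \<in> A \<or> x \<in> B \<and> y \<in> B"
  by (rule is_sep_edge[OF _ graph])

lemma sep_V: "sep A B \<Longrightarrow> A \<union> B = V"
  unfolding is_sep_def by blast

lemma sepI: "A \<union> B = V \<Longrightarrow> (\<And>x y. E x y \<Longrightarrow> x \<in> A \<and> y \<in> A \<or> x \<in> B \<and> y \<in> B) \<Longrightarrow> sep A B"
  using is_sepI graph by blast

lemma sep_corners: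
  assumes "sep A B" "sep C D"
  shows "sep (A \<inter> C) (B \<union> D)" "sep (A \<union> C) (B \<inter> D)"
proof -
  have V: "A \<union> B = V" "C \<union> D = V" using assms sep_V by blast+
  show "sep (A \<inter> C) (B \<union> D)"
    by (rule sepI) (use V sep_edge[OF assms(1)] sep_edge[OF assms(2)] in blast)+
  show "sep (A \<union> C) (B \<inter> D)"
    by (rule sepI) (use V sep_edge[OF assms(1)] sep_edge[OF assms(2)] in blast)+
qed

lemma is_k_tangle_sep: "is_k_tangle V E k \<tau> \<Longrightarrow> (A, B) \<in> \<tau> \<Longrightarrow> sep A B \<and> finite (A \<inter> B) \<and> enat (card (A \<inter> B)) < k"
  unfolding is_k_tangle_def sep_order_def by (fastforce split: if_splits)

lemma is_k_tangle_orient: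
  assumes "is_k_tangle V E k \<tau>" "sep A B" "finite (A \<inter> B)" "enat (card (A \<inter> B)) < k"
  shows "(A, B) \<in> \<tau> \<or> (B, A) \<in> \<tau>"
proof -
  have "card (\<tau> \<inter> {(A, B), (B, A)}) = 1"
    using assms unfolding is_k_tangle_def sep_order_def by simp
  then have "\<tau> \<inter> {(A, B), (B, A)} \<noteq> {}" by (metis card.empty zero_neq_one)
  then show ?thesis by blast
qed

lemma covers3_sep: "sep A B \<Longrightarrow> covers3 V E A B B"
  using sep_V sep_edge unfolding covers3_def by blast

lemma is_k_tangleI:
  assumes 1: "\<And>A B. (A, B) \<in> \<tau> \<Longrightarrow> sep A B \<and> finite (A \<inter> B) \<and> enat (card (A \<inter> B)) < k"
    and 2: "\<And>A B. sep A B \<Longrightarrow> finite (A \<inter> B) \<Longrightarrow> enat (card (A \<inter> B)) < k \<Longrightarrow> (A, B) \<in> \<tau> \<or> (B, A) \<in> \<tau>"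
    and 3: "\<And>A1 B1 A2 B2 A3 B3. (A1, B1) \<in> \<tau> \<Longrightarrow> (A2, B2) \<in> \<tau> \<Longrightarrow> (A3, B3) \<in> \<tau> \<Longrightarrow>
      \<not> covers3 V E A1 A2 A3"
  shows "is_k_tangle V E k \<tau>"
proof -
  have "card (\<tau> \<inter> {(A, B), (B, A)}) = 1" if AB: "sep A B" "sep_order A B < k" for A B
  proof -
    have "finite (A \<inter> B)" "enat (card (A \<inter> B)) < k"
      using AB(2) by (auto simp: sep_order_def split: if_splits)
    then have or: "(A, B) \<in> \<tau> \<or> (B, A) \<in> \<tau>" using 2 AB by blast
    have nb: "\<not> ((A, B) \<in> \<tau> \<and> (B, A) \<in> \<tau>)"
      using 3 covers3_sep[OF AB(1)] by blast
    have "\<tau> \<inter> {(A, B), (B, A)} = {(A, B)} \<or> \<tau> \<inter> {(A, B), (B, A)} = {(B, A)}"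
      using or nb by auto
    then show ?thesis by (auto simp del: Int_insert_right)
  qed
  then show ?thesis
    unfolding is_k_tangle_def using 1 3 by (fastforce simp: sep_order_def)
qed

lemma inf_is_tangle: "inf_tangle \<omega> \<Longrightarrow> tangle \<omega>"
  unfolding is_tangle_def by blast

lemma tangle_sep: "tangle \<tau> \<Longrightarrow> (A, B) \<in> \<tau> \<Longrightarrow> sep A B"
  and tangle_fin: "tangle \<tau> \<Longrightarrow> (A, B) \<in> \<tau> \<Longrightarrow> finite (A \<inter> B)"
  unfolding is_tangle_def using is_k_tangle_sep by blast+

lemma tangle_orient:
  assumes "tangle \<tau>" "(A, B) \<in> \<tau>" "sep C D" "finite (C \<inter> D)" "card (C \<inter> D) \<le> card (A \<inter> B)"
  shows "(C, D) \<in> \<tau> \<or> (D, C) \<in> \<tau>"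
proof -
  obtain k where k: "is_k_tangle V E k \<tau>" using assms(1) unfolding is_tangle_def by blast
  have "enat (card (A \<inter> B)) < k" using is_k_tangle_sep[OF k assms(2)] by blast
  then have "enat (card (C \<inter> D)) < k" using assms(5) by (meson enat_ord_simps(1) le_less_trans)
  then show ?thesis using is_k_tangle_orient[OF k] assms by blast
qed

lemma inf_tangle_orient:
  "inf_tangle \<tau> \<Longrightarrow> sep C D \<Longrightarrow> finite (C \<inter> D) \<Longrightarrow> (C, D) \<in> \<tau> \<or> (D, C) \<in> \<tau>"
  using is_k_tangle_orient by (metis enat_ord_code(4))

lemma tangle_covers:
  "tangle \<tau> \<Longrightarrow> (A1, B1) \<in> \<tau> \<Longrightarrow> (A2, B2) \<in> \<tau> \<Longrightarrow> (A3, B3) \<in> \<tau> \<Longrightarrow> \<not> covers3 V E A1 A2 A3"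
  unfolding is_tangle_def is_k_tangle_def by blast

lemma tangle_anti: "tangle \<tau> \<Longrightarrow> (A, B) \<in> \<tau> \<Longrightarrow> (B, A) \<notin> \<tau>"
  using tangle_covers covers3_sep tangle_sep by blast

lemma tangle_covers2:
  assumes "tangle \<tau>" "(A1, B1) \<in> \<tau>" "(A2, B2) \<in> \<tau>" "B1 \<subseteq> A2"
  shows False
proof -
  have "sep A1 B1" "sep A2 B2" using assms tangle_sep by blast+
  then have "covers3 V E A1 A2 A2"
    using sep_V[of A1 B1] sep_V[of A2 B2] sep_edge[of A1 B1] assms(4) unfolding covers3_def by blast
  then show False using tangle_covers assms by blast
qed

lemma tangle_join:
  assumes "tangle \<tau>" "(A, B) \<in> \<tau>" "(C, D) \<in> \<tau>" "(X, Y) \<in> \<tau> \<or> (Y, X) \<in> \<tau>" "covers3 V E A C Y"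
  shows "(X, Y) \<in> \<tau>"
  using assms tangle_covers by blast

lemma tangle_Un:
  assumes "tangle \<tau>" "(A, B) \<in> \<tau>" "(C, D) \<in> \<tau>"
    "(A \<union> C, B \<inter> D) \<in> \<tau> \<or> (B \<inter> D, A \<union> C) \<in> \<tau>"
  shows "(A \<union> C, B \<inter> D) \<in> \<tau>"
proof -
  have "sep A B" "sep C D" using assms tangle_sep by blast+
  then have "covers3 V E A C (B \<inter> D)"
    using sep_V[of A B] sep_V[of C D] sep_edge[of A B] sep_edge[of C D] unfolding covers3_def by blast
  then show ?thesis using tangle_join assms by blast
qed

lemma tangle_mono:
  assumes "tangle \<tau>" "(A, B) \<in> \<tau>" "X \<subseteq> A" "B \<subseteq> Y" "(X, Y) \<in> \<tau> \<or> (Y, X) \<in> \<tau>"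
  shows "(X, Y) \<in> \<tau>"
  using tangle_covers2 assms by blast

definition eff :: "('a set \<times> 'a set) set \<Rightarrow> ('a set \<times> 'a set) set \<Rightarrow> 'a set \<Rightarrow> 'a set \<Rightarrow> bool" where
  "eff \<tau> \<tau>' A B \<longleftrightarrow> tangle \<tau> \<and> tangle \<tau>' \<and> (A, B) \<in> \<tau> \<and> (B, A) \<in> \<tau>' \<and>
     (\<forall>C D. (C, D) \<in> \<tau> \<longrightarrow> (D, C) \<in> \<tau>' \<longrightarrow> card (A \<inter> B) \<le> card (C \<inter> D))"

lemma eff_swap: "eff \<tau> \<tau>' A B \<Longrightarrow> eff \<tau>' \<tau> B A"
  unfolding eff_def by (metis Int_commute)

lemma ex_eff:
  assumes "tangle \<tau>" "tangle \<tau>'" "(A, B) \<in> \<tau>" "(B, A) \<in> \<tau>'"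
  shows "\<exists>C D. eff \<tau> \<tau>' C D"
proof -
  let ?P = "\<lambda>s. s \<in> \<tau> \<and> prod.swap s \<in> \<tau>'"
  have "?P (A, B)" using assms by simp
  then obtain s where "?P s" "\<And>t. ?P t \<Longrightarrow> card (fst s \<inter> snd s) \<le> card (fst t \<inter> snd t)"
    using ex_has_least_nat[of ?P "(A, B)" "\<lambda>s. card (fst s \<inter> snd s)"] by blast
  then have "eff \<tau> \<tau>' (fst s) (snd s)" using assms unfolding eff_def by (auto simp: prod.swap_def)
  then show ?thesis by blast
qed

lemma eff_tangle: "eff \<tau> \<tau>' A B \<Longrightarrow> tangle \<tau>" "eff \<tau> \<tau>' A B \<Longrightarrow> tangle \<tau>'"
  and eff_mem: "eff \<tau> \<tau>' A B \<Longrightarrow> (A, B) \<in> \<tau>" "eff \<tau> \<tau>' A B \<Longrightarrow> (B, A) \<in> \<tau>'"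
  and eff_le: "eff \<tau> \<tau>' A B \<Longrightarrow> (C, D) \<in> \<tau> \<Longrightarrow> (D, C) \<in> \<tau>' \<Longrightarrow> card (A \<inter> B) \<le> card (C \<inter> D)"
  unfolding eff_def by blast+

lemma eff_sep: "eff \<tau> \<tau>' A B \<Longrightarrow> sep A B"
  and eff_fin: "eff \<tau> \<tau>' A B \<Longrightarrow> finite (A \<inter> B)"
  using tangle_sep tangle_fin eff_tangle eff_mem by blast+

lemma eff_same:
  assumes "eff \<tau> \<tau>' A B" "(C, D) \<in> \<tau>" "(D, C) \<in> \<tau>'" "card (C \<inter> D) \<le> card (A \<inter> B)"
  shows "eff \<tau> \<tau>' C D" "card (C \<inter> D) = card (A \<inter> B)"
proof -
  show eq: "card (C \<inter> D) = card (A \<inter> B)" using eff_le assms by (meson le_antisym)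
  show "eff \<tau> \<tau>' C D" using assms unfolding eff_def eq by blast
qed

lemma eff_agree:
  assumes "eff \<tau> \<tau>' A B" "(C, D) \<in> \<tau>" "card (C \<inter> D) < card (A \<inter> B)"
  shows "(C, D) \<in> \<tau>'"
proof -
  have "sep C D" "finite (C \<inter> D)" using assms(1,2) tangle_sep tangle_fin eff_tangle by blast+
  then have "(C, D) \<in> \<tau>' \<or> (D, C) \<in> \<tau>'"
    using tangle_orient[of \<tau>' B A C D] assms eff_tangle eff_mem by (simp add: Int_commute)
  then show ?thesis using eff_le[OF assms(1,2)] assms(3) by auto
qed

lemma eff_corners_agree:
  assumes e: "eff \<tau>1 \<tau>2 A B" and e': "eff \<sigma>1 \<sigma>2 C D" and le: "card (A \<inter> B) \<le> card (C \<inter> D)"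
    and AB: "(A, B) \<in> \<sigma>1" "(A, B) \<in> \<sigma>2"
  shows "eff \<tau>1 \<tau>2 (A \<inter> C) (B \<union> D) \<and> eff \<sigma>1 \<sigma>2 (A \<union> C) (B \<inter> D) \<or>
         eff \<tau>1 \<tau>2 (A \<inter> D) (B \<union> C) \<and> eff \<sigma>2 \<sigma>1 (A \<union> D) (B \<inter> C)"
proof -
  have s: "sep A B" "sep C D" "sep D C" "finite (A \<inter> B)" "finite (C \<inter> D)" "finite (D \<inter> C)"
    using e e' eff_sep eff_fin sep_swap by (auto simp: Int_commute)
  have V: "A \<union> B = C \<union> D" "A \<union> B = D \<union> C" using s sep_V by blast+
  have upper: "eff \<rho>1 \<rho>2 (A \<union> X) (B \<inter> Y) \<and> card ((A \<inter> X) \<inter> (B \<union> Y)) = card (A \<inter> B)"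
    if r: "eff \<rho>1 \<rho>2 X Y" "(A, B) \<in> \<rho>1" "card (X \<inter> Y) = card (C \<inter> D)"
      "A \<union> B = X \<union> Y" "card ((A \<inter> X) \<inter> (B \<union> Y)) \<ge> card (A \<inter> B)" for \<rho>1 \<rho>2 X Y
  proof -
    have f: "sep X Y" "finite (X \<inter> Y)" using r eff_sep eff_fin by blast+
    note c = card_corners[OF r(4) s(4) f(2)]
    have le': "card ((A \<union> X) \<inter> (B \<inter> Y)) \<le> card (X \<inter> Y)" using c(1) r(5) by linarith
    note sc = sep_corners[OF s(1) f(1)]
    have 1: "(A \<union> X, B \<inter> Y) \<in> \<rho>1"
      using tangle_Un[of \<rho>1 A B X Y] tangle_orient[of \<rho>1 X Y "A \<union> X" "B \<inter> Y"] sc c le' r eff_tangle eff_mem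
      by blast
    have le2: "card ((B \<inter> Y) \<inter> (A \<union> X)) \<le> card (Y \<inter> X)" using le' by (simp only: Int_commute)
    have 2: "(B \<inter> Y, A \<union> X) \<in> \<rho>2"
      by (rule tangle_mono[of \<rho>2 Y X])
        (use tangle_orient[of \<rho>2 Y X "B \<inter> Y" "A \<union> X"] sep_swap[OF sc(2)] c(3) le2
             eff_tangle[OF r(1)] eff_mem[OF r(1)] in \<open>auto simp: Int_commute\<close>)
    show ?thesis using eff_same[OF r(1) 1 2 le'] c(1) by auto
  qed
  note u1 = upper[OF e' AB(1) refl V(1)]
  have e'': "eff \<sigma>2 \<sigma>1 D C" using e' by (rule eff_swap)
  note u2 = upper[OF e'' AB(2) _ V(2)]
  let ?a1 = "card ((A \<inter> C) \<inter> (B \<union> D))" and ?a2 = "card ((A \<inter> D) \<inter> (B \<union> C))"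
  have a1: "?a1 \<le> card (A \<inter> B)" using u1 by linarith
  have a2: "?a2 \<le> card (A \<inter> B)" using u2 by (simp add: Int_commute[of D C]) linarith
  have t1: "(A \<inter> C, B \<union> D) \<in> \<tau>1"
    using tangle_mono[of \<tau>1 A B "A \<inter> C" "B \<union> D"] tangle_orient[of \<tau>1 A B "A \<inter> C" "B \<union> D"]
      sep_corners[OF s(1,2)] card_corners[OF V(1) s(4,5)] a1 eff_tangle[OF e] eff_mem[OF e] by blast
  have t2: "(A \<inter> D, B \<union> C) \<in> \<tau>1"
    using tangle_mono[of \<tau>1 A B "A \<inter> D" "B \<union> C"] tangle_orient[of \<tau>1 A B "A \<inter> D" "B \<union> C"]
      sep_corners[OF s(1,3)] card_corners[OF V(2) s(4,6)] a2 eff_tangle[OF e] eff_mem[OF e] by blast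
  have o1: "(A \<inter> C, B \<union> D) \<in> \<tau>2 \<or> (B \<union> D, A \<inter> C) \<in> \<tau>2"
    using tangle_orient[of \<tau>2 B A "A \<inter> C" "B \<union> D"]
      sep_corners[OF s(1,2)] card_corners[OF V(1) s(4,5)] a1 eff_tangle[OF e] eff_mem[OF e]
    by (simp add: Int_commute[of B A])
  have o2: "(A \<inter> D, B \<union> C) \<in> \<tau>2 \<or> (B \<union> C, A \<inter> D) \<in> \<tau>2"
    using tangle_orient[of \<tau>2 B A "A \<inter> D" "B \<union> C"]
      sep_corners[OF s(1,3)] card_corners[OF V(2) s(4,6)] a2 eff_tangle[OF e] eff_mem[OF e]
    by (simp add: Int_commute[of B A])
  have "covers3 V E (A \<inter> C) (A \<inter> D) B"
    using sep_V[OF s(1)] V sep_edge[OF s(1)] sep_edge[OF s(2)] unfolding covers3_def by blast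
  then have "\<not> ((A \<inter> C, B \<union> D) \<in> \<tau>2 \<and> (A \<inter> D, B \<union> C) \<in> \<tau>2)"
    using tangle_covers eff_tangle[OF e] eff_mem[OF e] by blast
  then consider "(B \<union> D, A \<inter> C) \<in> \<tau>2" | "(B \<union> C, A \<inter> D) \<in> \<tau>2" using o1 o2 by blast
  then show ?thesis
  proof cases
    case 1
    then show ?thesis using eff_same[OF e t1 1 a1] u1 by simp
  next
    case 2
    then show ?thesis using eff_same[OF e t2 2 a2] u2 by (simp add: Int_commute[of D C])
  qed
qed

lemma eff_corners_both:
  assumes e: "eff \<tau>1 \<tau>2 A B" and e': "eff \<tau>1 \<tau>2 C D"
  shows "eff \<tau>1 \<tau>2 (A \<inter> C) (B \<union> D) \<and> eff \<tau>1 \<tau>2 (A \<union> C) (B \<inter> D)"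
proof -
  have s: "sep A B" "sep C D" "finite (A \<inter> B)" "finite (C \<inter> D)"
    using e e' eff_sep eff_fin by auto
  have V: "A \<union> B = C \<union> D" using s sep_V by blast
  have T: "tangle \<tau>1" "tangle \<tau>2" "(A, B) \<in> \<tau>1" "(B, A) \<in> \<tau>2" "(C, D) \<in> \<tau>1" "(D, C) \<in> \<tau>2"
    using e e' eff_tangle eff_mem by blast+
  have eq: "card (C \<inter> D) = card (A \<inter> B)" using eff_le[OF e] eff_le[OF e'] T by (meson le_antisym)
  note c = card_corners[OF V s(3,4)] and sc = sep_corners[OF s(1,2)]
  have or: "(X, Y) \<in> \<tau>1 \<or> (Y, X) \<in> \<tau>1" "(X, Y) \<in> \<tau>2 \<or> (Y, X) \<in> \<tau>2"
    if "sep X Y" "finite (X \<inter> Y)" "card (X \<inter> Y) \<le> card (A \<inter> B)" for X Y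
    using that tangle_orient[OF T(1,3)] tangle_orient[OF T(2,4)] by (auto simp: Int_commute[of B A])
  have lo: "card ((A \<inter> C) \<inter> (B \<union> D)) \<ge> card (A \<inter> B) \<and> ((A \<inter> C, B \<union> D) \<in> \<tau>1 \<and> (B \<union> D, A \<inter> C) \<in> \<tau>2)"
    if le: "card ((A \<inter> C) \<inter> (B \<union> D)) \<le> card (A \<inter> B)"
  proof -
    note o = or[OF sc(1) c(2) le]
    have 1: "(A \<inter> C, B \<union> D) \<in> \<tau>1" using tangle_mono[OF T(1,3)] o by blast
    have 2: "(B \<union> D, A \<inter> C) \<in> \<tau>2" using tangle_Un[OF T(2,4,6)] o by blast
    show ?thesis using eff_le[OF e 1 2] 1 2 by blast
  qed
  have hi: "card ((A \<union> C) \<inter> (B \<inter> D)) \<ge> card (A \<inter> B) \<and> ((A \<union> C, B \<inter> D) \<in> \<tau>1 \<and> (B \<inter> D, A \<union> C) \<in> \<tau>2)"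
    if le: "card ((A \<union> C) \<inter> (B \<inter> D)) \<le> card (A \<inter> B)"
  proof -
    note o = or[OF sc(2) c(3) le]
    have 1: "(A \<union> C, B \<inter> D) \<in> \<tau>1" using tangle_Un[OF T(1,3,5)] o by blast
    have 2: "(B \<inter> D, A \<union> C) \<in> \<tau>2" using tangle_mono[OF T(2,4)] o by blast
    show ?thesis using eff_le[OF e 1 2] 1 2 by blast
  qed
  have "card ((A \<inter> C) \<inter> (B \<union> D)) = card (A \<inter> B)" "card ((A \<union> C) \<inter> (B \<inter> D)) = card (A \<inter> B)"
    using lo hi c(1) eq by linarith+
  then show ?thesis using eff_same(1)[OF e] lo hi by simp
qed

end

section \<open>Tight separations\<close>

lemma rtrancl_finite_support:
  assumes "(x, y) \<in> {(u, v). R u v}\<^sup>*"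
  shows "\<exists>P. finite P \<and> x \<in> P \<and> y \<in> P \<and> (x, y) \<in> {(u, v). R u v \<and> u \<in> P \<and> v \<in> P}\<^sup>*"
  using assms
proof (induction rule: rtrancl_induct)
  case base
  then show ?case by (intro exI[of _ "{x}"]) simp
next
  case (step y z)
  then obtain P where P: "finite P" "x \<in> P" "(x, y) \<in> {(u, v). R u v \<and> u \<in> P \<and> v \<in> P}\<^sup>*" by blast
  let ?Q = "insert y (insert z P)"
  have "(x, y) \<in> {(u, v). R u v \<and> u \<in> ?Q \<and> v \<in> ?Q}\<^sup>*"
    using P(3) rtrancl_mono[of "{(u, v). R u v \<and> u \<in> P \<and> v \<in> P}" "{(u, v). R u v \<and> u \<in> ?Q \<and> v \<in> ?Q}"]
    by auto
  moreover have "(y, z) \<in> {(u, v). R u v \<and> u \<in> ?Q \<and> v \<in> ?Q}" using step by auto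
  ultimately have "(x, z) \<in> {(u, v). R u v \<and> u \<in> ?Q \<and> v \<in> ?Q}\<^sup>*" by (rule rtrancl_into_rtrancl)
  then show ?case using P by (intro exI[of _ ?Q]) auto
qed

lemma conn_refl: "u \<notin> X \<Longrightarrow> conn_avoiding E X u u"
  unfolding conn_avoiding_def by simp

lemma conn_trans: "conn_avoiding E X u v \<Longrightarrow> conn_avoiding E X v w \<Longrightarrow> conn_avoiding E X u w"
  unfolding conn_avoiding_def by (meson rtrancl_trans)

lemma conn_edge: "E u v \<Longrightarrow> u \<notin> X \<Longrightarrow> v \<notin> X \<Longrightarrow> conn_avoiding E X u v"
  unfolding conn_avoiding_def by auto

lemma conn_notin: "conn_avoiding E X u v \<Longrightarrow> u \<notin> X \<and> v \<notin> X"
  unfolding conn_avoiding_def by blast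

lemma conn_step: "conn_avoiding E X u v \<Longrightarrow> E v w \<Longrightarrow> w \<notin> X \<Longrightarrow> conn_avoiding E X u w"
  by (rule conn_trans[where v = v], assumption, rule conn_edge) (simp_all add: conn_notin[of E X u v])

lemma conn_mono: "conn_avoiding E X u v \<Longrightarrow> Y \<subseteq> X \<Longrightarrow> conn_avoiding E Y u v"
  unfolding conn_avoiding_def
  using rtrancl_mono[of "{(x, y). E x y \<and> x \<notin> X \<and> y \<notin> X}" "{(x, y). E x y \<and> x \<notin> Y \<and> y \<notin> Y}"] by auto

lemma conn_induct [consumes 1, case_names refl step]:
  assumes "conn_avoiding E X u v" "u \<notin> X \<Longrightarrow> P u"
    "\<And>v w. conn_avoiding E X u v \<Longrightarrow> P v \<Longrightarrow> E v w \<Longrightarrow> v \<notin> X \<Longrightarrow> w \<notin> X \<Longrightarrow> P w"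
  shows "P v"
proof -
  have uX: "u \<notin> X" using assms(1) by (rule conn_notin[THEN conjunct1])
  have "(u, v) \<in> {(x, y). E x y \<and> x \<notin> X \<and> y \<notin> X}\<^sup>*" using assms(1) unfolding conn_avoiding_def by blast
  then have "P v \<and> conn_avoiding E X u v"
  proof (induction rule: rtrancl_induct)
    case base
    then show ?case using assms(2) conn_refl[OF uX] uX by blast
  next
    case (step v w)
    then have e: "E v w" "v \<notin> X" "w \<notin> X" by auto
    show ?case using assms(3)[of v w] conn_step[of E X u v w] step(3) e by blast
  qed
  then show ?thesis by blast
qed

context gr
begin

lemma conn_sym: "conn_avoiding E X u v \<Longrightarrow> conn_avoiding E X v u"
proof (induction rule: conn_induct)
  case refl
  then show ?case by (rule conn_refl)
next
  case (step v w)
  then show ?case using conn_trans[of E X w v u] conn_edge[of E w v X] E_sym by blast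
qed

lemma sep_conn:
  assumes "sep A B" "conn_avoiding E (A \<inter> B) u v" "u \<in> A - B" "X \<inter> (A - B) = {}"
  shows "v \<in> A - B \<and> conn_avoiding E X u v"
  using assms(2)
proof (induction rule: conn_induct)
  case refl
  then show ?case using assms(3,4) by (auto intro: conn_refl)
next
  case (step v w)
  then have "w \<in> A - B" using sep_edge[OF assms(1)] by blast
  moreover then have "w \<notin> X" using assms(4) by blast
  ultimately show ?case using conn_step step by fast
qed

definition minseps :: "'a set \<Rightarrow> nat \<Rightarrow> 'a \<Rightarrow> 'a \<Rightarrow> 'a set set" where
  "minseps F n x y = {S. S \<inter> F = {} \<and> finite S \<and> card S = n \<and> \<not> conn_avoiding E (S \<union> F) x y \<and>
     (\<forall>s\<in>S. \<exists>z. conn_avoiding E (S \<union> F) x z \<and> E z s) \<and>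
     (\<forall>s\<in>S. \<exists>z. conn_avoiding E (S \<union> F) y z \<and> E z s)}"

lemma finite_minseps: "finite (minseps F n x y)"
proof (induction n arbitrary: F)
  case 0
  have "minseps F 0 x y \<subseteq> {{}}" by (auto simp: minseps_def)
  then show ?case using finite_subset by blast
next
  case (Suc n)
  show ?case
  proof (cases "minseps F (Suc n) x y = {}")
    case False
    then obtain S0 where S0: "S0 \<in> minseps F (Suc n) x y" by blast
    then have "S0 \<noteq> {}" by (auto simp: minseps_def)
    then obtain s where s: "s \<in> S0" by blast
    then obtain z z' where z: "conn_avoiding E (S0 \<union> F) x z" "E z s" "conn_avoiding E (S0 \<union> F) y z'" "E z' s"
      using S0 unfolding minseps_def by blast
    have sF: "s \<notin> F" using S0 s unfolding minseps_def by blast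
    have "conn_avoiding E F x s" "conn_avoiding E F y s"
      using conn_step[OF conn_mono[OF z(1)] z(2) sF] conn_step[OF conn_mono[OF z(3)] z(4) sF] by auto
    then have "conn_avoiding E F x y" using conn_sym conn_trans by metis
    then have "(x, y) \<in> {(u, v). E u v \<and> u \<notin> F \<and> v \<notin> F}\<^sup>*" unfolding conn_avoiding_def by blast
    from rtrancl_finite_support[OF this] obtain P where P: "finite P" "x \<in> P" "y \<in> P"
      "(x, y) \<in> {(u, v). (E u v \<and> u \<notin> F \<and> v \<notin> F) \<and> u \<in> P \<and> v \<in> P}\<^sup>*" by blast
    have "minseps F (Suc n) x y \<subseteq> (\<Union>p\<in>P. insert p ` minseps (insert p F) n x y)"
    proof
      fix S assume S: "S \<in> minseps F (Suc n) x y"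
      have "S \<inter> P \<noteq> {}"
      proof
        assume e: "S \<inter> P = {}"
        have "S \<noteq> {}" using S by (auto simp: minseps_def)
        then have "x \<notin> S \<union> F" "y \<notin> S \<union> F" using S conn_notin unfolding minseps_def by fast+
        moreover have "{(u, v). (E u v \<and> u \<notin> F \<and> v \<notin> F) \<and> u \<in> P \<and> v \<in> P} \<subseteq>
            {(u, v). E u v \<and> u \<notin> S \<union> F \<and> v \<notin> S \<union> F}" using e by auto
        ultimately have "conn_avoiding E (S \<union> F) x y"
          using P(4) rtrancl_mono unfolding conn_avoiding_def by blast
        then show False using S unfolding minseps_def by blast
      qed
      then obtain p where p: "p \<in> S" "p \<in> P" by blast
      have "(S - {p}) \<union> insert p F = S \<union> F" using p by blast
      then have "S - {p} \<in> minseps (insert p F) n x y"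
        using S p unfolding minseps_def by auto
      moreover have "S = insert p (S - {p})" using p by blast
      ultimately show "S \<in> (\<Union>p\<in>P. insert p ` minseps (insert p F) n x y)" using p by blast
    qed
    then show ?thesis using P(1) Suc.IH by (auto intro: finite_subset)
  qed simp
qed

definition full :: "'a set \<Rightarrow> 'a \<Rightarrow> bool" where
  "full S x \<longleftrightarrow> (\<forall>s\<in>S. \<exists>y. conn_avoiding E S x y \<and> E y s)"

definition tight :: "'a set \<Rightarrow> 'a set \<Rightarrow> bool" where
  "tight A B \<longleftrightarrow> sep A B \<and> finite (A \<inter> B) \<and> A \<inter> B \<noteq> {} \<and>
     (\<exists>x\<in>A - B. full (A \<inter> B) x) \<and> (\<exists>x\<in>B - A. full (A \<inter> B) x)"

lemma tight_swap: "tight A B \<Longrightarrow> tight B A"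
  using sep_swap by (auto simp: tight_def Int_commute)

end

locale cgraph = gr +
  assumes lf: "locally_finite V E"
    and connected: "x \<in> V \<Longrightarrow> y \<in> V \<Longrightarrow> conn_avoiding E {} x y"
begin

lemma finite_nbrs: "finite {u. E v u}"
proof (cases "v \<in> V")
  case False
  then have "{u. E v u} = {}" using E_V by blast
  then show ?thesis by simp
qed (use lf in \<open>auto simp: locally_finite_def\<close>)

lemma conn_exit:
  assumes "S \<noteq> {}" "S \<subseteq> V" "d \<in> V - S"
  shows "\<exists>y s. conn_avoiding E S d y \<and> E y s \<and> s \<in> S"
proof (rule ccontr)
  assume no: "\<not> ?thesis"
  obtain s0 where s0: "s0 \<in> S" using assms by blast
  then have "conn_avoiding E {} d s0" using connected assms by blast
  then have "conn_avoiding E S d s0"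
  proof (induction rule: conn_induct)
    case refl
    then show ?case using assms conn_refl by fast
  next
    case (step v w)
    then show ?case using no conn_step[of E S d v w] by blast
  qed
  then show False using conn_notin s0 by metis
qed

lemma finite_tight_through: "finite {(A, B). tight A B \<and> card (A \<inter> B) = n \<and> v \<in> A \<inter> B}"
proof -
  let ?N = "{u. E v u}"
  define SS where "SS = (\<Union>x\<in>?N. \<Union>y\<in>?N. minseps {} n x y)"
  define nb where "nb S = (\<Union>s\<in>S. {u. E s u})" for S
  define g where "g S T = (let A = S \<union> {z. \<exists>t\<in>T. conn_avoiding E S t z} in (A, S \<union> (V - A)))" for S T
  have finSS: "finite SS" unfolding SS_def using finite_nbrs finite_minseps by blast
  have SSfin: "finite S" if "S \<in> SS" for S using that unfolding SS_def minseps_def by blast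
  have nbfin: "finite (nb S)" if "finite S" for S unfolding nb_def using that finite_nbrs by blast
  have "{(A, B). tight A B \<and> card (A \<inter> B) = n \<and> v \<in> A \<inter> B} \<subseteq> (\<Union>S\<in>SS. \<Union>T\<in>Pow (nb S). {g S T})"
  proof safe
    fix A B assume AB: "tight A B" "n = card (A \<inter> B)" "v \<in> A" "v \<in> B"
    define S where "S = A \<inter> B"
    have s: "sep A B" "finite S" "S \<noteq> {}" "v \<in> S" using AB unfolding tight_def S_def by auto
    obtain x y where xy: "x \<in> A - B" "y \<in> B - A" "full S x" "full S y"
      using AB unfolding tight_def S_def by blast
    obtain x' where x': "conn_avoiding E S x x'" "E x' v" using xy s unfolding full_def by blast
    obtain y' where y': "conn_avoiding E S y y'" "E y' v" using xy s unfolding full_def by blast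
    have inA: "x' \<in> A - B" using sep_conn[OF s(1) x'(1)[unfolded S_def] xy(1), of "{}"] by simp
    have inB: "y' \<in> B - A" using sep_conn[OF sep_swap[OF s(1)], of y y' "{}"] y'(1) xy(2)
      unfolding S_def by (simp add: Int_commute)
    have nc: "\<not> conn_avoiding E S x' y'"
      using sep_conn[OF s(1), of x' y' "{}"] inA inB unfolding S_def by auto
    have f1: "\<exists>z. conn_avoiding E S x' z \<and> E z s" if "s \<in> S" for s
      using xy(3) that conn_trans[OF conn_sym[OF x'(1)]] unfolding full_def by blast
    have f2: "\<exists>z. conn_avoiding E S y' z \<and> E z s" if "s \<in> S" for s
      using xy(4) that conn_trans[OF conn_sym[OF y'(1)]] unfolding full_def by blast
    have "S \<in> minseps {} n x' y'"
      unfolding minseps_def using s(2) AB(2) nc f1 f2 by (auto simp: S_def)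
    then have "S \<in> SS" unfolding SS_def using x'(2) y'(2) E_sym by blast
    moreover define T where "T = {t \<in> A - B. \<exists>s\<in>S. E t s}"
    have "T \<subseteq> nb S" unfolding T_def nb_def using E_sym by blast
    moreover have "(A, B) = g S T"
    proof -
      have "A \<subseteq> S \<union> {z. \<exists>t\<in>T. conn_avoiding E S t z}"
      proof
        fix z assume z: "z \<in> A"
        show "z \<in> S \<union> {z. \<exists>t\<in>T. conn_avoiding E S t z}"
        proof (cases "z \<in> S")
          case False
          then have zA: "z \<in> A - B" using z unfolding S_def by blast
          moreover have "z \<in> V - S" "S \<subseteq> V" using sep_V[OF s(1)] z False unfolding S_def by auto
          ultimately obtain t s' where t: "conn_avoiding E S z t" "E t s'" "s' \<in> S"
            using conn_exit[OF s(3)] by blast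
          then have "t \<in> T" using sep_conn[OF s(1) t(1)[unfolded S_def] zA, of "{}"]
            unfolding T_def by blast
          then show ?thesis using conn_sym[OF t(1)] by blast
        qed simp
      qed
      moreover have "S \<union> {z. \<exists>t\<in>T. conn_avoiding E S t z} \<subseteq> A"
        using sep_conn[OF s(1), of _ _ "{}"] unfolding S_def T_def by auto
      ultimately have "A = S \<union> {z. \<exists>t\<in>T. conn_avoiding E S t z}" by (rule subset_antisym)
      moreover have "B = S \<union> (V - A)" using sep_V[OF s(1)] unfolding S_def by blast
      ultimately show ?thesis unfolding g_def Let_def by simp
    qed
    ultimately show "(A, B) \<in> (\<Union>S\<in>SS. \<Union>T\<in>Pow (nb S). {g S T})" by blast
  qed
  moreover have "finite (\<Union>S\<in>SS. \<Union>T\<in>Pow (nb S). {g S T})"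
    using finSS SSfin nbfin by simp
  ultimately show ?thesis by (rule finite_subset)
qed

lemma tangle_V: "tangle \<tau> \<Longrightarrow> (V, B) \<notin> \<tau>"
proof
  assume t: "tangle \<tau>" "(V, B) \<in> \<tau>"
  then have "B \<subseteq> V" using tangle_sep sep_V by blast
  then show False using tangle_covers2 t by blast
qed

lemma eff_nonempty: assumes "eff \<tau> \<tau>' A B" shows "A \<inter> B \<noteq> {}"
proof
  assume e: "A \<inter> B = {}"
  have s: "sep A B" using assms eff_sep by blast
  have "A = {} \<or> B = {}"
  proof (rule ccontr)
    assume "\<not> ?thesis"
    then obtain x y where xy: "x \<in> A" "y \<in> B" by blast
    then have "conn_avoiding E (A \<inter> B) x y" using connected sep_V[OF s] e by auto
    then show False using sep_conn[OF s, of x y "{}"] xy e by blast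
  qed
  then have "A = V \<or> B = V" using sep_V[OF s] by auto
  then show False using tangle_V eff_mem[OF assms] eff_tangle[OF assms] by blast
qed

lemma eff_full:
  assumes e: "eff \<tau> \<tau>' A B"
  shows "\<exists>x\<in>A - B. full (A \<inter> B) x"
proof (rule ccontr)
  assume no: "\<not> ?thesis"
  define S where "S = A \<inter> B"
  define C where "C x = {q. conn_avoiding E S x q}" for x
  define nb where "nb Q = {s \<in> S. \<exists>q\<in>Q. E q s}" for Q
  have s: "sep A B" "finite S" "S \<noteq> {}" "S \<subseteq> V"
    using eff_sep[OF e] eff_fin[OF e] eff_nonempty[OF e] sep_V[of A B] unfolding S_def by auto
  have T: "tangle \<tau>" "tangle \<tau>'" "(A, B) \<in> \<tau>" "(B, A) \<in> \<tau>'" using e eff_tangle eff_mem by blast+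
  have CAB: "C x \<subseteq> A - B" if "x \<in> A - B" for x
    using sep_conn[OF s(1), of x _ "{}"] that unfolding C_def S_def by auto
  have sepQ: "sep (Q \<union> nb Q) (V - Q)" "(Q \<union> nb Q) \<inter> (V - Q) = nb Q" "finite (nb Q)" "card (nb Q) \<le> card S"
    if Q: "Q = (\<Union>x\<in>F. C x)" "F \<subseteq> A - B" for Q F
  proof -
    have QAB: "Q \<subseteq> A - B" using CAB Q by blast
    show "sep (Q \<union> nb Q) (V - Q)"
    proof (rule sepI)
      show "Q \<union> nb Q \<union> (V - Q) = V" using QAB s sep_V[OF s(1)] unfolding nb_def by blast
      have cl: "w \<in> Q \<union> nb Q" if "E u w" "u \<in> Q" for u w
      proof (cases "w \<in> S")
        case True
        then show ?thesis using that unfolding nb_def by blast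
      next
        case False
        obtain x where x: "x \<in> F" "conn_avoiding E S x u" using \<open>u \<in> Q\<close> Q unfolding C_def by blast
        then show ?thesis using conn_step[of E S x u w, OF x(2) that(1) False] Q unfolding C_def by blast
      qed
      fix x y assume "E x y"
      then show "x \<in> Q \<union> nb Q \<and> y \<in> Q \<union> nb Q \<or> x \<in> V - Q \<and> y \<in> V - Q"
        using cl[of x y] cl[of y x] E_sym E_V[of x y] by blast
    qed
    show "(Q \<union> nb Q) \<inter> (V - Q) = nb Q" using QAB s(4) unfolding nb_def S_def by blast
    show "finite (nb Q)" "card (nb Q) \<le> card S" using s(2) card_mono[OF s(2), of "nb Q"] unfolding nb_def by auto
  qed
  have or': "(X, Y) \<in> \<tau>' \<or> (Y, X) \<in> \<tau>'" if "sep X Y" "finite (X \<inter> Y)" "card (X \<inter> Y) \<le> card S" for X Y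
    using tangle_orient[OF T(2,4)] that unfolding S_def by (simp add: Int_commute[of B A])
  have comp: "(C x \<union> nb (C x), V - C x) \<in> \<tau>'" if x: "x \<in> A - B" for x
  proof -
    note sx = sepQ[of "C x" "{x}"]
    have "nb (C x) \<noteq> S" using no x unfolding nb_def C_def full_def S_def by blast
    then have lt: "card (nb (C x)) < card S" using s(2) unfolding nb_def by (intro psubset_card_mono) auto
    have "(C x \<union> nb (C x), V - C x) \<in> \<tau>"
    proof (rule tangle_mono[OF T(1,3)])
      show "C x \<union> nb (C x) \<subseteq> A" using CAB[OF x] unfolding nb_def S_def by blast
      show "B \<subseteq> V - C x" using CAB[OF x] sep_V[OF s(1)] by blast
      show "(C x \<union> nb (C x), V - C x) \<in> \<tau> \<or> (V - C x, C x \<union> nb (C x)) \<in> \<tau>"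
        using tangle_orient[OF T(1,3)] sx x unfolding S_def by simp
    qed
    then show ?thesis using eff_agree[OF e] lt sx x unfolding S_def by auto
  qed
  have union: "((\<Union>x\<in>F. C x) \<union> nb (\<Union>x\<in>F. C x), V - (\<Union>x\<in>F. C x)) \<in> \<tau>'" if "finite F" "F \<subseteq> A - B" for F
    using that
  proof (induction F rule: finite_induct)
    case empty
    have "({}, V) \<in> \<tau>'"
      by (rule tangle_mono[OF T(2,4)])
        (use or'[of "{}" V] sepQ(1)[of "{}" "{}"] sep_V[OF s(1)] in \<open>auto simp: nb_def\<close>)
    then show ?case by (simp add: nb_def)
  next
    case (insert x F)
    let ?Q = "\<Union>x\<in>F. C x"
    have IH: "(?Q \<union> nb ?Q, V - ?Q) \<in> \<tau>'" using insert by blast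
    have x: "x \<in> A - B" using insert by blast
    have eq: "(?Q \<union> nb ?Q) \<union> (C x \<union> nb (C x)) = (\<Union>x\<in>insert x F. C x) \<union> nb (\<Union>x\<in>insert x F. C x)"
      "(V - ?Q) \<inter> (V - C x) = V - (\<Union>x\<in>insert x F. C x)" unfolding nb_def by auto
    note sx = sepQ[of "\<Union>x\<in>insert x F. C x", OF refl insert(4)]
    have "((?Q \<union> nb ?Q) \<union> (C x \<union> nb (C x)), (V - ?Q) \<inter> (V - C x)) \<in> \<tau>'"
      by (rule tangle_Un[OF T(2) IH comp[OF x]]) (unfold eq, use or' sx in auto)
    then show ?case unfolding eq .
  qed
  let ?F = "{x \<in> A - B. \<exists>s\<in>S. E s x}"
  have "finite ?F" by (rule finite_subset[of _ "\<Union>s\<in>S. {x. E s x}"]) (use s(2) finite_nbrs in auto)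
  note uF = union[OF this]
  have "(\<Union>x\<in>?F. C x) = A - B"
  proof
    show "(\<Union>x\<in>?F. C x) \<subseteq> A - B" using CAB by blast
    show "A - B \<subseteq> (\<Union>x\<in>?F. C x)"
    proof
      fix d assume d: "d \<in> A - B"
      then have "d \<in> V - S" using sep_V[OF s(1)] unfolding S_def by blast
      then obtain y s' where y: "conn_avoiding E S d y" "E y s'" "s' \<in> S" using conn_exit s by meson
      then have "y \<in> A - B" using sep_conn[OF s(1), of d y "{}"] d unfolding S_def by blast
      then show "d \<in> (\<Union>x\<in>?F. C x)" using y E_sym conn_sym[OF y(1)] unfolding C_def by blast
    qed
  qed
  moreover have "V - (A - B) = B" using sep_V[OF s(1)] by blast
  ultimately have "((A - B) \<union> nb (A - B), B) \<in> \<tau>'" using uF by auto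
  then show False using tangle_covers2[OF T(2) _ T(4)] by blast
qed

lemma eff_tight: "eff \<tau> \<tau>' A B \<Longrightarrow> tight A B"
  unfolding tight_def
  using eff_full[of \<tau> \<tau>' A B] eff_full[OF eff_swap] eff_sep eff_fin eff_nonempty by (metis Int_commute)

lemma nested_if_side:
  assumes t: "tight C D" and s: "sep A B" and sub: "A \<inter> B \<subseteq> C - D"
  shows "nested A B C D"
proof -
  have sCD: "sep C D" "sep D C" "C \<inter> D \<noteq> {}" using t sep_swap unfolding tight_def by blast+
  obtain y where y: "y \<in> D - C" "full (C \<inter> D) y" using t unfolding tight_def by blast
  have dis: "(A \<inter> B) \<inter> (D - C) = {}" using sub by blast
  have tr: "conn_avoiding E (A \<inter> B) u v" if "u \<in> D - C" "conn_avoiding E (C \<inter> D) u v" for u v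
    using sep_conn[OF sCD(2) _ that(1) dis] that(2) by (simp add: Int_commute)
  have toS: "conn_avoiding E (A \<inter> B) y s'" if s': "s' \<in> C \<inter> D" for s'
  proof -
    obtain z where "conn_avoiding E (C \<inter> D) y z" "E z s'" using y s' unfolding full_def by blast
    then show ?thesis using tr[OF y(1)] conn_step[of E "A \<inter> B" y z s'] sub s' by blast
  qed
  have all: "conn_avoiding E (A \<inter> B) y d" if d: "d \<in> D" for d
  proof (cases "d \<in> C")
    case True
    then show ?thesis using toS d by blast
  next
    case False
    then have d': "d \<in> D - C" using d by blast
    moreover have "d \<in> V - (C \<inter> D)" "C \<inter> D \<subseteq> V" using sep_V[OF sCD(1)] d' by auto
    ultimately obtain z s' where z: "conn_avoiding E (C \<inter> D) d z" "E z s'" "s' \<in> C \<inter> D"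
      using conn_exit[OF sCD(3)] by blast
    have "conn_avoiding E (A \<inter> B) d s'" using conn_step[OF tr[OF d' z(1)] z(2)] z(3) sub by blast
    then show ?thesis using toS[OF z(3)] conn_sym conn_trans by metis
  qed
  have V: "A \<union> B = V" "C \<union> D = V" using s sCD sep_V by blast+
  have "y \<in> A - B \<or> y \<in> B - A" using y V dis by blast
  then show ?thesis
  proof
    assume "y \<in> A - B"
    then have "D \<subseteq> A - B" using sep_conn[OF s all, of _ "{}"] by blast
    then show ?thesis using V unfolding nested_def by blast
  next
    assume "y \<in> B - A"
    then have "D \<subseteq> B - A"
      using sep_conn[OF sep_swap[OF s], of y _ "{}"] all by (auto simp: Int_commute)
    then show ?thesis using V unfolding nested_def by blast
  qed
qed

lemma finite_crossing:
  assumes AB: "sep A B" "finite (A \<inter> B)"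
  shows "finite {(C, D). tight C D \<and> card (C \<inter> D) = n \<and> \<not> nested A B C D}"
proof (cases "A \<inter> B = {}")
  case True
  then have "{(C, D). tight C D \<and> card (C \<inter> D) = n \<and> \<not> nested A B C D} = {}"
    using nested_if_side[OF _ AB(1)] by auto
  then show ?thesis by (simp only: finite.emptyI)
next
  case False
  then obtain a where a: "a \<in> A \<inter> B" by blast
  have "\<forall>s\<in>A \<inter> B. \<exists>P. finite P \<and> a \<in> P \<and> s \<in> P \<and> (a, s) \<in> {(u, v). E u v \<and> u \<in> P \<and> v \<in> P}\<^sup>*"
  proof
    fix s assume "s \<in> A \<inter> B"
    then have "conn_avoiding E {} a s" using a connected sep_V[OF AB(1)] by blast
    then have "(a, s) \<in> {(u, v). E u v}\<^sup>*" unfolding conn_avoiding_def by simp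
    then show "\<exists>P. finite P \<and> a \<in> P \<and> s \<in> P \<and> (a, s) \<in> {(u, v). E u v \<and> u \<in> P \<and> v \<in> P}\<^sup>*"
      by (rule rtrancl_finite_support)
  qed
  from bchoice[OF this] obtain P where "\<forall>s\<in>A \<inter> B. finite (P s) \<and> a \<in> P s \<and> s \<in> P s \<and>
      (a, s) \<in> {(u, v). E u v \<and> u \<in> P s \<and> v \<in> P s}\<^sup>*" ..
  then have P: "finite (P s) \<and> a \<in> P s \<and> s \<in> P s \<and>
      (a, s) \<in> {(u, v). E u v \<and> u \<in> P s \<and> v \<in> P s}\<^sup>*" if "s \<in> A \<inter> B" for s
    using that by (rule bspec)
  define X where "X = (\<Union>s\<in>A \<inter> B. P s)"
  have finX: "finite X" unfolding X_def using P AB by blast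
  have meet: "C \<inter> D \<inter> X \<noteq> {}" if t: "tight C D" and cr: "\<not> nested A B C D" for C D
  proof
    assume e: "C \<inter> D \<inter> X = {}"
    have sCD: "sep C D" "sep D C" using t sep_swap unfolding tight_def by blast+
    have c: "conn_avoiding E (C \<inter> D) a s" if s: "s \<in> A \<inter> B" for s
    proof -
      have sub: "P s \<subseteq> X" using s unfolding X_def by blast
      then have "a \<notin> C \<inter> D" "s \<notin> C \<inter> D" using P[OF s] e by auto
      moreover have "{(u, v). E u v \<and> u \<in> P s \<and> v \<in> P s} \<subseteq>
        {(x, y). E x y \<and> x \<notin> C \<inter> D \<and> y \<notin> C \<inter> D}" using sub e by auto
      then have "(a, s) \<in> {(x, y). E x y \<and> x \<notin> C \<inter> D \<and> y \<notin> C \<inter> D}\<^sup>*"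
        using P[OF s] rtrancl_mono by blast
      ultimately show ?thesis unfolding conn_avoiding_def by blast
    qed
    have "a \<notin> C \<inter> D" using c[OF a] conn_notin by metis
    moreover have "a \<in> V" using a sep_V[OF AB(1)] by blast
    ultimately have "a \<in> C - D \<or> a \<in> D - C" using sep_V[OF sCD(1)] by blast
    then show False
    proof
      assume "a \<in> C - D"
      then have "A \<inter> B \<subseteq> C - D" using sep_conn[OF sCD(1) c, of _ "{}"] by blast
      then show False using nested_if_side[OF t AB(1)] cr by blast
    next
      assume "a \<in> D - C"
      then have "A \<inter> B \<subseteq> D - C" using sep_conn[OF sCD(2), of a _ "{}"] c by (auto simp: Int_commute)
      then show False using nested_if_side[OF tight_swap[OF t] AB(1)] cr nested_swap2 by metis
    qed
  qed
  have "{(C, D). tight C D \<and> card (C \<inter> D) = n \<and> \<not> nested A B C D} \<subseteq>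
    (\<Union>v\<in>X. {(C, D). tight C D \<and> card (C \<inter> D) = n \<and> v \<in> C \<inter> D})"
  proof safe
    fix C D assume "tight C D" "\<not> nested A B C D" "n = card (C \<inter> D)"
    then show "(C, D) \<in> (\<Union>v\<in>X. {(C', D'). tight C' D' \<and> card (C' \<inter> D') = card (C \<inter> D) \<and> v \<in> C' \<inter> D'})"
      using meet[of C D] by blast
  qed
  moreover have "finite (\<Union>v\<in>X. {(C, D). tight C D \<and> card (C \<inter> D) = n \<and> v \<in> C \<inter> D})"
    using finX finite_tight_through by (rule finite_UN_I)
  ultimately show ?thesis by (rule finite_subset)
qed

end

section \<open>A canonical nested set of separations\<close>

definition lexless :: "nat \<Rightarrow> (nat \<Rightarrow> nat) \<Rightarrow> (nat \<Rightarrow> nat) \<Rightarrow> bool" where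
  "lexless n f g \<longleftrightarrow> (\<exists>m\<le>n. f m < g m \<and> (\<forall>l<m. f l = g l))"

lemma lexless_mono: "lexless n f g \<Longrightarrow> n \<le> k \<Longrightarrow> lexless k f g"
  unfolding lexless_def by (meson le_trans)

lemma lexless_linear:
  assumes "\<not> lexless n f g" "\<not> lexless n g f" "m \<le> n"
  shows "f m = g m"
  using assms(3)
proof (induction m rule: less_induct)
  case (less m)
  then have "\<forall>l<m. f l = g l" by simp
  then show ?case using assms(1,2) less.prems unfolding lexless_def by (metis linorder_neqE_nat)
qed

lemma lexless_cong: "(\<And>m. m \<le> n \<Longrightarrow> g m = h m) \<Longrightarrow> lexless n f g \<longleftrightarrow> lexless n f h"
  unfolding lexless_def by (metis le_trans less_imp_le_nat)

lemma ex_lex_minimal: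
  assumes "s0 \<in> P"
  shows "\<exists>s\<in>P. \<forall>t\<in>P. \<not> lexless n (f t) (f s)"
proof (induction n)
  case 0
  obtain s where "s \<in> P" "\<And>t. t \<in> P \<Longrightarrow> f s 0 \<le> f t 0"
    using ex_has_least_nat[of "\<lambda>s. s \<in> P" s0 "\<lambda>s. f s 0"] assms by blast
  then show ?case unfolding lexless_def by (intro bexI[of _ s]) (auto simp: not_less)
next
  case (Suc n)
  then obtain s where s: "s \<in> P" "\<And>t. t \<in> P \<Longrightarrow> \<not> lexless n (f t) (f s)" by blast
  let ?Q = "\<lambda>t. t \<in> P \<and> (\<forall>m\<le>n. f t m = f s m)"
  obtain u where u: "?Q u" "\<And>t. ?Q t \<Longrightarrow> f u (Suc n) \<le> f t (Suc n)"
    using ex_has_least_nat[of ?Q s "\<lambda>s. f s (Suc n)"] s by blast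
  have "\<not> lexless (Suc n) (f t) (f u)" if t: "t \<in> P" for t
  proof
    assume "lexless (Suc n) (f t) (f u)"
    then obtain m where m: "m \<le> Suc n" "f t m < f u m" "\<forall>l<m. f t l = f u l"
      unfolding lexless_def by blast
    show False
    proof (cases "m = Suc n")
      case True
      then have "?Q t" using m(3) u(1) t by auto
      then show False using u(2) m(2) True by (meson not_less)
    next
      case False
      then have mn: "m \<le> n" using m(1) by simp
      then have "f t m < f s m" "\<forall>l<m. f t l = f s l" using m(2,3) u(1) by auto
      then have "lexless n (f t) (f s)" unfolding lexless_def using mn by blast
      then show False using s(2) t by blast
    qed
  qed
  then show ?case using u(1) by blast
qed

lemma lexless_of_sum_less:
  fixes c c' s s' :: "nat \<Rightarrow> nat"
  assumes le: "\<And>m. c m + c' m \<le> s m + s' m" and less: "c n + c' n < s n + s' n"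
  shows "lexless n c s \<or> lexless n c' s'"
proof -
  let ?P = "\<lambda>m. \<not> (c m = s m \<and> c' m = s' m)"
  have "?P n" using less by auto
  define m where "m = (LEAST m. ?P m)"
  have m: "?P m" unfolding m_def by (rule LeastI[of ?P n]) fact
  have mn: "m \<le> n" unfolding m_def by (rule Least_le) fact
  have eq: "\<forall>l<m. c l = s l \<and> c' l = s' l" unfolding m_def using not_less_Least by blast
  have "c m < s m \<or> c' m < s' m" using m le[of m] by linarith
  then show ?thesis unfolding lexless_def using mn eq by blast
qed

context cgraph
begin

definition effs :: "nat \<Rightarrow> ('a set \<times> 'a set) set" where
  "effs m = {(A, B). (\<exists>\<tau> \<tau>'. eff \<tau> \<tau>' A B) \<and> card (A \<inter> B) = m}"

definition crossing :: "'a set \<Rightarrow> 'a set \<Rightarrow> nat \<Rightarrow> ('a set \<times> 'a set) set" where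
  "crossing A B m = {(C, D) \<in> effs m. \<not> nested A B C D}"

abbreviation ncross :: "'a set \<Rightarrow> 'a set \<Rightarrow> nat \<Rightarrow> nat" where
  "ncross A B m \<equiv> card (crossing A B m)"

definition lmin :: "('a set \<times> 'a set) set \<Rightarrow> ('a set \<times> 'a set) set \<Rightarrow> 'a set \<Rightarrow> 'a set \<Rightarrow> bool" where
  "lmin \<tau> \<tau>' A B \<longleftrightarrow> eff \<tau> \<tau>' A B \<and>
     (\<forall>C D. eff \<tau> \<tau>' C D \<longrightarrow> \<not> lexless (card (A \<inter> B)) (ncross C D) (ncross A B))"

definition canon :: "'a set \<Rightarrow> 'a set \<Rightarrow> bool" where
  "canon A B \<longleftrightarrow> (\<exists>\<tau> \<tau>'. lmin \<tau> \<tau>' A B)"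

lemma lmin_eff: "lmin \<tau> \<tau>' A B \<Longrightarrow> eff \<tau> \<tau>' A B"
  unfolding lmin_def by blast

lemma crossing_swap: "crossing B A = crossing A B"
  unfolding crossing_def using nested_swap1 by blast

lemma lmin_swap: "lmin \<tau> \<tau>' A B \<Longrightarrow> lmin \<tau>' \<tau> B A"
  unfolding lmin_def by (metis eff_swap crossing_swap Int_commute)

lemma eff_card_eq: "eff \<tau> \<tau>' A B \<Longrightarrow> eff \<tau> \<tau>' C D \<Longrightarrow> card (A \<inter> B) = card (C \<inter> D)"
  by (meson eff_le eff_mem le_antisym)

lemma ex_lmin:
  assumes "eff \<tau> \<tau>' A B"
  shows "\<exists>C D. lmin \<tau> \<tau>' C D"
proof -
  have "(A, B) \<in> {(C, D). eff \<tau> \<tau>' C D}" using assms by simp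
  from ex_lex_minimal[OF this, of "card (A \<inter> B)" "\<lambda>s. ncross (fst s) (snd s)"]
  obtain C D where CD: "eff \<tau> \<tau>' C D"
    "\<And>X Y. eff \<tau> \<tau>' X Y \<Longrightarrow> \<not> lexless (card (A \<inter> B)) (ncross X Y) (ncross C D)" by auto
  then show ?thesis unfolding lmin_def using eff_card_eq[OF assms CD(1)] by metis
qed

lemma finite_crossing_eff: "eff \<tau> \<tau>' A B \<Longrightarrow> finite (crossing A B m)"
  by (rule finite_subset[OF _ finite_crossing[of A B m]])
    (auto simp: crossing_def effs_def dest: eff_tight eff_sep eff_fin)

lemma crossing_corners:
  assumes AB: "eff \<tau> \<tau>' A B" and CD: "eff \<sigma> \<sigma>' C D" and cr: "\<not> nested A B C D"
    and X: "eff \<rho> \<rho>' (A \<inter> C) (B \<union> D)" and Y: "eff \<upsilon> \<upsilon>' (A \<union> C) (B \<inter> D)"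
  shows "ncross (A \<inter> C) (B \<union> D) m + ncross (A \<union> C) (B \<inter> D) m \<le> ncross A B m + ncross C D m"
    and "m = card (A \<inter> B) \<Longrightarrow>
      ncross (A \<inter> C) (B \<union> D) m + ncross (A \<union> C) (B \<inter> D) m < ncross A B m + ncross C D m"
proof -
  let ?c = "crossing (A \<inter> C) (B \<union> D) m" and ?c' = "crossing (A \<union> C) (B \<inter> D) m"
    and ?s = "crossing A B m" and ?s' = "crossing C D m"
  have fin: "finite ?c" "finite ?c'" "finite ?s" "finite ?s'"
    using AB CD X Y finite_crossing_eff by blast+
  have 1: "?c \<union> ?c' \<subseteq> ?s \<union> ?s'" using nested_corners[OF cr] unfolding crossing_def by blast
  have 2: "?c \<inter> ?c' \<subseteq> ?s \<inter> ?s'" using nested_corner unfolding crossing_def by blast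
  note eqs = card_Un_Int[OF fin(1,2)] card_Un_Int[OF fin(3,4)]
  have le2: "card (?c \<inter> ?c') \<le> card (?s \<inter> ?s')" using 2 fin by (auto intro: card_mono)
  show "card ?c + card ?c' \<le> card ?s + card ?s'"
    using eqs le2 card_mono[OF _ 1] fin by simp
  assume m: "m = card (A \<inter> B)"
  have "(A, B) \<in> ?s'" using AB cr m nested_sym unfolding crossing_def effs_def by blast
  moreover have "nested (A \<inter> C) (B \<union> D) A B" "nested (A \<union> C) (B \<inter> D) A B" unfolding nested_def by blast+
  then have "(A, B) \<notin> ?c \<union> ?c'" unfolding crossing_def by blast
  ultimately have "?c \<union> ?c' \<subset> ?s \<union> ?s'" using 1 by blast
  then have "card (?c \<union> ?c') < card (?s \<union> ?s')" using fin by (intro psubset_card_mono) auto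
  then show "card ?c + card ?c' < card ?s + card ?s'" using eqs le2 by simp
qed

lemma opposite_corners:
  assumes AB: "lmin \<tau> \<tau>' A B" and CD: "lmin \<sigma> \<sigma>' C D" and le: "card (A \<inter> B) \<le> card (C \<inter> D)"
    and X: "eff \<tau> \<tau>' (A \<inter> C) (B \<union> D)" and Y: "eff \<sigma> \<sigma>' (A \<union> C) (B \<inter> D)"
  shows "nested A B C D"
proof (rule ccontr)
  assume cr: "\<not> nested A B C D"
  note c = crossing_corners[OF lmin_eff[OF AB] lmin_eff[OF CD] cr X Y]
  have "lexless (card (A \<inter> B)) (ncross (A \<inter> C) (B \<union> D)) (ncross A B) \<or>
        lexless (card (A \<inter> B)) (ncross (A \<union> C) (B \<inter> D)) (ncross C D)"
    by (rule lexless_of_sum_less) (rule c(1), rule c(2), rule refl)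
  then show False
    using AB CD X Y lexless_mono[OF _ le] unfolding lmin_def by blast
qed

lemma nested_lmin_agree:
  assumes AB: "lmin \<tau> \<tau>' A B" and CD: "lmin \<sigma> \<sigma>' C D" and le: "card (A \<inter> B) \<le> card (C \<inter> D)"
    and mem: "(A, B) \<in> \<sigma>" "(A, B) \<in> \<sigma>'"
  shows "nested A B C D"
  using eff_corners_agree[OF lmin_eff[OF AB] lmin_eff[OF CD] le mem]
proof
  assume "eff \<tau> \<tau>' (A \<inter> C) (B \<union> D) \<and> eff \<sigma> \<sigma>' (A \<union> C) (B \<inter> D)"
  then show ?thesis using opposite_corners[OF AB CD le] by blast
next
  assume "eff \<tau> \<tau>' (A \<inter> D) (B \<union> C) \<and> eff \<sigma>' \<sigma> (A \<union> D) (B \<inter> C)"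
  then have "nested A B D C"
    using opposite_corners[OF AB lmin_swap[OF CD]] le by (simp add: Int_commute[of D C])
  then show ?thesis using nested_swap2 by blast
qed

lemma lmin_transfer:
  assumes AB: "lmin \<tau> \<tau>' A B" and CD: "lmin \<sigma> \<sigma>' C D" and AB': "eff \<sigma> \<sigma>' A B" and CD': "eff \<tau> \<tau>' C D"
  shows "lmin \<tau> \<tau>' C D"
proof -
  have eq: "card (C \<inter> D) = card (A \<inter> B)" using eff_card_eq lmin_eff AB CD' by blast
  have "\<not> lexless (card (A \<inter> B)) (ncross C D) (ncross A B)" "\<not> lexless (card (A \<inter> B)) (ncross A B) (ncross C D)"
    using AB CD AB' CD' unfolding lmin_def eq by blast+
  note lin = lexless_linear[OF this]
  have "lexless (card (A \<inter> B)) f (ncross C D) = lexless (card (A \<inter> B)) f (ncross A B)" for f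
    by (rule lexless_cong) (rule lin)
  then show ?thesis using AB CD' unfolding lmin_def eq by blast
qed

lemma nested_lmin_both:
  assumes AB: "lmin \<tau> \<tau>' A B" and CD: "lmin \<sigma> \<sigma>' C D" and AB': "eff \<sigma> \<sigma>' A B" and CD': "eff \<tau> \<tau>' C D"
  shows "nested A B C D"
proof -
  have "eff \<tau> \<tau>' (A \<inter> C) (B \<union> D) \<and> eff \<tau> \<tau>' (A \<union> C) (B \<inter> D)"
    using eff_corners_both[OF lmin_eff[OF AB] CD'] .
  moreover have "card (A \<inter> B) = card (C \<inter> D)" using eff_card_eq lmin_eff AB CD' by blast
  ultimately show ?thesis using opposite_corners[OF AB lmin_transfer[OF assms]] by simp
qed

lemma nested_lmin_le:
  assumes AB: "lmin \<tau> \<tau>' A B" and CD: "lmin \<sigma> \<sigma>' C D" and le: "card (A \<inter> B) \<le> card (C \<inter> D)"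
  shows "nested A B C D"
proof -
  have split: "nested A B C D"
    if AB: "lmin \<tau> \<tau>' A B" and CD: "lmin \<sigma> \<sigma>' C D" and le: "card (A \<inter> B) \<le> card (C \<inter> D)"
      and mem: "(A, B) \<in> \<sigma>" "(B, A) \<in> \<sigma>'" for \<tau> \<tau>' A B \<sigma> \<sigma>' C D
  proof -
    note e = lmin_eff[OF AB] and e' = lmin_eff[OF CD]
    have eq: "card (C \<inter> D) = card (A \<inter> B)" and AB': "eff \<sigma> \<sigma>' A B"
      using eff_same[OF e' mem le] le by auto
    have CDn: "sep C D" "finite (C \<inter> D)" using e' eff_sep eff_fin by blast+
    have "(C, D) \<in> \<tau> \<or> (D, C) \<in> \<tau>"
      using tangle_orient[OF eff_tangle(1)[OF e] eff_mem(1)[OF e] CDn] eq by simp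
    moreover have "(C, D) \<in> \<tau>' \<or> (D, C) \<in> \<tau>'"
      using tangle_orient[OF eff_tangle(2)[OF e] eff_mem(2)[OF e] CDn] eq by (simp add: Int_commute)
    ultimately consider "(C, D) \<in> \<tau>" "(C, D) \<in> \<tau>'" | "(D, C) \<in> \<tau>" "(D, C) \<in> \<tau>'"
      | "(C, D) \<in> \<tau>" "(D, C) \<in> \<tau>'" | "(D, C) \<in> \<tau>" "(C, D) \<in> \<tau>'" by blast
    then show ?thesis
    proof cases
      case 1
      then show ?thesis using nested_lmin_agree[OF CD AB] eq nested_sym by (metis order_refl)
    next
      case 2
      then show ?thesis using nested_lmin_agree[OF lmin_swap[OF CD] AB] eq nested_sym nested_swap2
        by (metis order_refl Int_commute)
    next
      case 3
      then show ?thesis using nested_lmin_both[OF AB CD AB'] eff_same(1)[OF e] eq by simp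
    next
      case 4
      then have "eff \<tau>' \<tau> C D" using eff_same(1)[OF eff_swap[OF e], of C D] eq by (simp add: Int_commute)
      note e4 = eff_swap[OF this]
      have n: "\<not> lexless (card (A \<inter> B)) (ncross D C) (ncross A B)" using AB e4 unfolding lmin_def by blast
      have "\<not> lexless (card (A \<inter> B)) (ncross A B) (ncross D C)"
        using CD AB' unfolding lmin_def eq crossing_swap[of C D] by blast
      note lin = lexless_linear[OF n this]
      have "lexless (card (A \<inter> B)) f (ncross D C) = lexless (card (A \<inter> B)) f (ncross A B)" for f
        by (rule lexless_cong) (rule lin)
      then have l: "lmin \<tau> \<tau>' D C" using AB e4 eq unfolding lmin_def by (simp add: Int_commute[of D C])
      have "nested A B D C" by (rule nested_lmin_both[OF AB l lmin_eff[OF AB] e4])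
      then show ?thesis using nested_swap2 by blast
    qed
  qed
  note e = lmin_eff[OF AB] and e' = lmin_eff[OF CD]
  have ABn: "sep A B" "finite (A \<inter> B)" using e eff_sep eff_fin by blast+
  have "(A, B) \<in> \<sigma> \<or> (B, A) \<in> \<sigma>"
    using tangle_orient[OF eff_tangle(1)[OF e'] eff_mem(1)[OF e'] ABn] le by simp
  moreover have "(A, B) \<in> \<sigma>' \<or> (B, A) \<in> \<sigma>'"
    using tangle_orient[OF eff_tangle(2)[OF e'] eff_mem(2)[OF e'] ABn] le by (simp add: Int_commute)
  ultimately consider "(A, B) \<in> \<sigma>" "(A, B) \<in> \<sigma>'" | "(B, A) \<in> \<sigma>" "(B, A) \<in> \<sigma>'"
    | "(A, B) \<in> \<sigma>" "(B, A) \<in> \<sigma>'" | "(B, A) \<in> \<sigma>" "(A, B) \<in> \<sigma>'" by blast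
  then show ?thesis
  proof cases
    case 1
    then show ?thesis using nested_lmin_agree[OF AB CD le] by blast
  next
    case 2
    then have "nested B A C D"
      using nested_lmin_agree[OF lmin_swap[OF AB] CD] le by (simp add: Int_commute[of B A])
    then show ?thesis using nested_swap1 by blast
  next
    case 3
    then show ?thesis using split[OF AB CD le] by blast
  next
    case 4
    then have "nested B A C D"
      using split[OF lmin_swap[OF AB] CD] le by (simp add: Int_commute[of B A])
    then show ?thesis using nested_swap1 by blast
  qed
qed

lemma canon_nested: "canon A B \<Longrightarrow> canon C D \<Longrightarrow> nested A B C D"
  unfolding canon_def using nested_lmin_le nested_sym by (metis linear)

lemma ex_canon:
  assumes "tangle \<tau>" "tangle \<tau>'" "(A, B) \<in> \<tau>" "(B, A) \<in> \<tau>'"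
  shows "\<exists>C D. eff \<tau> \<tau>' C D \<and> canon C D"
  using ex_eff[OF assms] ex_lmin lmin_eff unfolding canon_def by metis

lemma separator_subset:
  assumes N: "canon A B" "canon C D" and t: "tangle \<tau>" "tangle \<tau>'"
    and AB: "(A, B) \<in> \<tau>" "(B, A) \<in> \<tau>'" and CD: "(C, D) \<in> \<tau>" "(C, D) \<in> \<tau>'"
  shows "A \<inter> B \<subseteq> D"
proof -
  have "\<not> B \<subseteq> C" using tangle_covers2[OF t(1) AB(1) CD(1)] by blast
  moreover have "\<not> A \<subseteq> C" using tangle_covers2[OF t(2) AB(2) CD(2)] by blast
  ultimately show ?thesis using canon_nested[OF N] unfolding nested_def by blast
qed

lemma canon_finite_through: "finite {(A, B). canon A B \<and> card (A \<inter> B) \<le> k \<and> v \<in> A \<inter> B}"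
proof -
  have "{(A, B). canon A B \<and> card (A \<inter> B) \<le> k \<and> v \<in> A \<inter> B} \<subseteq>
    (\<Union>n\<in>{..k}. {(A, B). tight A B \<and> card (A \<inter> B) = n \<and> v \<in> A \<inter> B})"
    using lmin_eff eff_tight unfolding canon_def by fast
  then show ?thesis using finite_tight_through by (meson finite_UN_I finite_atMost finite_subset)
qed

end

section \<open>Automorphisms, limits and rays\<close>

lemma vimage_subset_iff: "surj f \<Longrightarrow> f -` A \<subseteq> f -` B \<longleftrightarrow> A \<subseteq> B"
  by (metis image_vimage_eq inf_top_right subset_image_iff surj_def vimage_mono image_mono surj_image_vimage_eq)

lemma vimage_eq_iff: "surj f \<Longrightarrow> f -` A = f -` B \<longleftrightarrow> A = B"
  using vimage_subset_iff[of f] by (simp only: set_eq_subset)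

lemma nested_vimage:
  "surj f \<Longrightarrow> nested (f -` A) (f -` B) (f -` C) (f -` D) \<longleftrightarrow> nested A B C D"
  unfolding nested_def by (simp only: vimage_subset_iff)

lemma vimage_inv_vimage: "bij f \<Longrightarrow> inv f -` (f -` A) = A" "bij f \<Longrightarrow> f -` (inv f -` A) = A"
  by (auto simp: bij_is_surj surj_f_inv_f bij_is_inj)

lemma card_vimage_bij: "bij f \<Longrightarrow> card (f -` A) = card A"
  by (metis bij_is_inj bij_is_surj card_vimage_inj subset_UNIV)

lemma finite_vimage_bij: "bij f \<Longrightarrow> finite (f -` A) \<longleftrightarrow> finite A"
  by (simp add: finite_vimage_iff)

text \<open>For a bijection \<open>f\<close> this contains \<open>(f ` A, f ` B)\<close> iff \<open>\<tau>\<close> contains \<open>(A, B)\<close>.\<close>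
definition act :: "('a \<Rightarrow> 'a) \<Rightarrow> ('a set \<times> 'a set) set \<Rightarrow> ('a set \<times> 'a set) set" where
  "act f \<tau> = {(A, B). (f -` A, f -` B) \<in> \<tau>}"

lemma mem_act: "(A, B) \<in> act f \<tau> \<longleftrightarrow> (f -` A, f -` B) \<in> \<tau>"
  unfolding act_def by simp

lemma act_comp: "act (f \<circ> g) \<tau> = act f (act g \<tau>)"
  unfolding act_def by (simp add: vimage_comp)

lemma act_inv: "bij f \<Longrightarrow> act (inv f) (act f \<tau>) = \<tau>" "bij f \<Longrightarrow> act f (act (inv f) \<tau>) = \<tau>"
  unfolding act_def by (simp_all add: vimage_inv_vimage)

context gr
begin

definition aut :: "('a \<Rightarrow> 'a) \<Rightarrow> bool" where
  "aut f \<longleftrightarrow> bij f \<and> f -` V = V \<and> (\<forall>x y. E (f x) (f y) \<longleftrightarrow> E x y)"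

lemma aut_bij: "aut f \<Longrightarrow> bij f"
  unfolding aut_def by blast

lemma aut_inv: "aut f \<Longrightarrow> aut (inv f)"
  unfolding aut_def
  by (metis bij_imp_bij_inv bij_inv_eq_iff vimage_inv_vimage(1))

lemma aut_comp: "aut f \<Longrightarrow> aut g \<Longrightarrow> aut (f \<circ> g)"
  unfolding aut_def by (simp add: bij_comp vimage_comp[symmetric])

lemma aut_V: "aut f \<Longrightarrow> f x \<in> V \<longleftrightarrow> x \<in> V"
  unfolding aut_def by (metis vimage_eq)

lemma aut_E: "aut f \<Longrightarrow> E (f x) (f y) \<longleftrightarrow> E x y"
  unfolding aut_def by simp

lemma sep_vimage_imp: "aut f \<Longrightarrow> sep A B \<Longrightarrow> sep (f -` A) (f -` B)"
proof (rule sepI)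
  assume f: "aut f" and s: "sep A B"
  show "f -` A \<union> f -` B = V" using sep_V[OF s] aut_V[OF f] by auto
  show "x \<in> f -` A \<and> y \<in> f -` A \<or> x \<in> f -` B \<and> y \<in> f -` B" if "E x y" for x y
    using sep_edge[OF s, of "f x" "f y"] that aut_E[OF f] by simp
qed

lemma sep_vimage: "aut f \<Longrightarrow> sep (f -` A) (f -` B) \<longleftrightarrow> sep A B"
  using sep_vimage_imp[of f A B] sep_vimage_imp[OF aut_inv, of f "f -` A" "f -` B"]
  by (auto simp: vimage_inv_vimage aut_bij)

lemma card_vimage_Int: "aut f \<Longrightarrow> card (f -` A \<inter> f -` B) = card (A \<inter> B)"
  and finite_vimage_Int: "aut f \<Longrightarrow> finite (f -` A \<inter> f -` B) \<longleftrightarrow> finite (A \<inter> B)"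
  using card_vimage_bij[OF aut_bij, of f "A \<inter> B"] finite_vimage_bij[OF aut_bij, of f "A \<inter> B"]
  by (simp_all add: vimage_Int)

lemma covers3_vimage: "aut f \<Longrightarrow> covers3 V E A B C \<Longrightarrow> covers3 V E (f -` A) (f -` B) (f -` C)"
proof -
  assume f: "aut f" and c: "covers3 V E A B C"
  have "A \<union> B \<union> C = V" using c unfolding covers3_def by blast
  then have "f -` (A \<union> B \<union> C) = V" using f unfolding aut_def by simp
  then have "f -` A \<union> f -` B \<union> f -` C = V" by (simp only: vimage_Un)
  then show ?thesis using c aut_E[OF f] unfolding covers3_def by simp
qed

lemma is_k_tangle_act:
  assumes f: "aut f" and t: "is_k_tangle V E k \<tau>"
  shows "is_k_tangle V E k (act f \<tau>)"
proof (rule is_k_tangleI)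
  fix A B assume "(A, B) \<in> act f \<tau>"
  then have "(f -` A, f -` B) \<in> \<tau>" by (simp add: mem_act)
  from is_k_tangle_sep[OF t this] show "sep A B \<and> finite (A \<inter> B) \<and> enat (card (A \<inter> B)) < k"
    by (simp add: sep_vimage[OF f] card_vimage_Int[OF f] finite_vimage_Int[OF f])
next
  fix A B assume "sep A B" "finite (A \<inter> B)" "enat (card (A \<inter> B)) < k"
  then show "(A, B) \<in> act f \<tau> \<or> (B, A) \<in> act f \<tau>"
    using is_k_tangle_orient[OF t, of "f -` A" "f -` B"]
    by (simp add: mem_act sep_vimage[OF f] card_vimage_Int[OF f] finite_vimage_Int[OF f])
next
  fix A1 B1 A2 B2 A3 B3
  assume "(A1, B1) \<in> act f \<tau>" "(A2, B2) \<in> act f \<tau>" "(A3, B3) \<in> act f \<tau>"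
  then have "\<not> covers3 V E (f -` A1) (f -` A2) (f -` A3)"
    using t unfolding is_k_tangle_def mem_act by blast
  then show "\<not> covers3 V E A1 A2 A3" using covers3_vimage[OF f] by blast
qed

lemma tangle_act: "aut f \<Longrightarrow> tangle \<tau> \<Longrightarrow> tangle (act f \<tau>)"
  unfolding is_tangle_def using is_k_tangle_act by blast

lemma tangle_act_iff: "aut f \<Longrightarrow> tangle (act f \<tau>) \<longleftrightarrow> tangle \<tau>"
  using tangle_act[of f \<tau>] tangle_act[OF aut_inv, of f "act f \<tau>"] act_inv(1)[OF aut_bij] by metis

lemma eff_act:
  assumes f: "aut f"
  shows "eff (act f \<tau>) (act f \<tau>') A B \<longleftrightarrow> eff \<tau> \<tau>' (f -` A) (f -` B)"
proof -
  have "(\<forall>C D. (C, D) \<in> act f \<tau> \<longrightarrow> (D, C) \<in> act f \<tau>' \<longrightarrow> card (A \<inter> B) \<le> card (C \<inter> D)) \<longleftrightarrow>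
    (\<forall>C D. (C, D) \<in> \<tau> \<longrightarrow> (D, C) \<in> \<tau>' \<longrightarrow> card (f -` A \<inter> f -` B) \<le> card (C \<inter> D))" (is "?L \<longleftrightarrow> ?R")
  proof
    assume L: ?L
    show ?R
    proof (intro allI impI)
      fix C D assume "(C, D) \<in> \<tau>" "(D, C) \<in> \<tau>'"
      moreover have "C = f -` (inv f -` C)" "D = f -` (inv f -` D)"
        using vimage_inv_vimage aut_bij[OF f] by metis+
      ultimately have "card (A \<inter> B) \<le> card (inv f -` C \<inter> inv f -` D)" using L mem_act by metis
      then show "card (f -` A \<inter> f -` B) \<le> card (C \<inter> D)"
        using card_vimage_Int[OF f] card_vimage_Int[OF aut_inv[OF f]] by simp
    qed
  next
    assume ?R
    then show ?L using mem_act card_vimage_Int[OF f] by metis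
  qed
  then show ?thesis unfolding eff_def by (simp add: tangle_act_iff[OF f] mem_act)
qed

lemma ultra_limit_tangle:
  assumes U: "ultra U" and t: "\<And>i. tangle (\<tau> i)"
    and ori: "\<And>A B. sep A B \<Longrightarrow> finite (A \<inter> B) \<Longrightarrow> {i. (A, B) \<in> \<tau> i \<or> (B, A) \<in> \<tau> i} \<in> U"
  shows "inf_tangle {(A, B). sep A B \<and> finite (A \<inter> B) \<and> {i. (A, B) \<in> \<tau> i} \<in> U}" (is "inf_tangle ?\<omega>")
proof (rule is_k_tangleI)
  fix A B assume "(A, B) \<in> ?\<omega>"
  then show "sep A B \<and> finite (A \<inter> B) \<and> enat (card (A \<inter> B)) < \<infinity>" by simp
next
  fix A B assume s: "sep A B" "finite (A \<inter> B)"
  have "{i. (A, B) \<in> \<tau> i} \<union> {i. (B, A) \<in> \<tau> i} \<in> U" using ori[OF s] by (simp add: Collect_disj_eq)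
  then have "{i. (A, B) \<in> \<tau> i} \<in> U \<or> {i. (B, A) \<in> \<tau> i} \<in> U" using ultra_Un[OF U] by blast
  then show "(A, B) \<in> ?\<omega> \<or> (B, A) \<in> ?\<omega>" using s sep_swap[OF s(1)] by (auto simp: Int_commute)
next
  fix A1 B1 A2 B2 A3 B3
  assume a: "(A1, B1) \<in> ?\<omega>" "(A2, B2) \<in> ?\<omega>" "(A3, B3) \<in> ?\<omega>"
  then have "{i. (A1, B1) \<in> \<tau> i} \<inter> ({i. (A2, B2) \<in> \<tau> i} \<inter> {i. (A3, B3) \<in> \<tau> i}) \<in> U"
    by (intro ultra_Int[OF U]) auto
  then have "{i. (A1, B1) \<in> \<tau> i} \<inter> ({i. (A2, B2) \<in> \<tau> i} \<inter> {i. (A3, B3) \<in> \<tau> i}) \<noteq> {}"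
    using ultra_infinite[OF U] by (metis finite.emptyI)
  then obtain i where "(A1, B1) \<in> \<tau> i" "(A2, B2) \<in> \<tau> i" "(A3, B3) \<in> \<tau> i" by blast
  then show "\<not> covers3 V E A1 A2 A3" using tangle_covers[OF t] by blast
qed

lemma ultra_vertex_tangle:
  assumes U: "ultra U" "V \<in> U"
  shows "inf_tangle {(A, B). sep A B \<and> finite (A \<inter> B) \<and> B \<in> U}" (is "inf_tangle ?\<omega>")
proof (rule is_k_tangleI)
  fix A B assume "(A, B) \<in> ?\<omega>"
  then show "sep A B \<and> finite (A \<inter> B) \<and> enat (card (A \<inter> B)) < \<infinity>" by simp
next
  fix A B assume s: "sep A B" "finite (A \<inter> B)"
  have "A \<in> U \<or> B \<in> U" using U sep_V[OF s(1)] ultra_Un[OF U(1), of A B] by simp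
  then show "(A, B) \<in> ?\<omega> \<or> (B, A) \<in> ?\<omega>" using s sep_swap[OF s(1)] by (auto simp: Int_commute)
next
  fix A1 B1 A2 B2 A3 B3
  assume a: "(A1, B1) \<in> ?\<omega>" "(A2, B2) \<in> ?\<omega>" "(A3, B3) \<in> ?\<omega>"
  show "\<not> covers3 V E A1 A2 A3"
  proof
    assume "covers3 V E A1 A2 A3"
    then have "V \<inter> (B1 \<inter> (B2 \<inter> B3)) \<subseteq> A1 \<inter> B1 \<union> A2 \<inter> B2 \<union> A3 \<inter> B3" unfolding covers3_def by blast
    then have "finite (V \<inter> (B1 \<inter> (B2 \<inter> B3)))" using a by (auto intro: finite_subset)
    moreover have "V \<inter> (B1 \<inter> (B2 \<inter> B3)) \<in> U" using a U by (auto intro!: ultra_Int)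
    ultimately show False using ultra_infinite U by blast
  qed
qed

lemma inf_tangle_neq:
  assumes "inf_tangle \<omega>" "inf_tangle \<omega>'" "\<omega> \<noteq> \<omega>'"
  shows "\<exists>A B. (A, B) \<in> \<omega> \<and> (B, A) \<in> \<omega>'"
proof -
  have *: "\<exists>A B. (A, B) \<in> \<tau> \<and> (B, A) \<in> \<tau>'" if "inf_tangle \<tau>" "inf_tangle \<tau>'" "(A, B) \<in> \<tau>" "(A, B) \<notin> \<tau>'" for \<tau> \<tau>' A B
    using that is_k_tangle_sep[of \<infinity> \<tau> A B] inf_tangle_orient[of \<tau>' A B] by blast
  obtain s where "s \<in> \<omega> \<and> s \<notin> \<omega>' \<or> s \<in> \<omega>' \<and> s \<notin> \<omega>" using assms(3) by blast
  then show ?thesis using *[of \<omega> \<omega>'] *[of \<omega>' \<omega>] assms(1,2) by (cases s) blast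
qed

end

context cgraph
begin

lemma effs_vimage:
  assumes f: "aut f"
  shows "(f -` A, f -` B) \<in> effs m \<longleftrightarrow> (A, B) \<in> effs m"
proof -
  have "(\<exists>\<tau> \<tau>'. eff \<tau> \<tau>' (f -` A) (f -` B)) \<longleftrightarrow> (\<exists>\<tau> \<tau>'. eff \<tau> \<tau>' A B)"
    using eff_act[OF f] act_inv(2)[OF aut_bij[OF f]] by metis
  then show ?thesis unfolding effs_def by (simp add: card_vimage_Int[OF f])
qed

lemma ncross_vimage:
  assumes f: "aut f"
  shows "ncross (f -` A) (f -` B) = ncross A B"
proof
  fix m
  let ?h = "\<lambda>(C, D). (f -` C, f -` D)"
  have sj: "surj f" using aut_bij[OF f] bij_is_surj by blast
  have "crossing (f -` A) (f -` B) m = ?h ` crossing A B m"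
  proof
    show "?h ` crossing A B m \<subseteq> crossing (f -` A) (f -` B) m"
      unfolding crossing_def using effs_vimage[OF f] nested_vimage[OF sj] by auto
    show "crossing (f -` A) (f -` B) m \<subseteq> ?h ` crossing A B m"
    proof
      fix t assume t: "t \<in> crossing (f -` A) (f -` B) m"
      obtain C D where [simp]: "t = (f -` C, f -` D)"
        using vimage_inv_vimage(2)[OF aut_bij[OF f]] by (metis surj_pair)
      have "(C, D) \<in> crossing A B m"
        using t unfolding crossing_def by (simp add: effs_vimage[OF f] nested_vimage[OF sj])
      then show "t \<in> ?h ` crossing A B m" by force
    qed
  qed
  moreover have "inj_on ?h (crossing A B m)"
    by (rule inj_onI) (auto simp only: vimage_eq_iff[OF sj] prod.inject split: prod.splits)
  ultimately show "ncross (f -` A) (f -` B) m = ncross A B m" by (simp add: card_image)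
qed

lemma lmin_act:
  assumes f: "aut f"
  shows "lmin (act f \<tau>) (act f \<tau>') A B \<longleftrightarrow> lmin \<tau> \<tau>' (f -` A) (f -` B)"
proof -
  let ?Q = "\<lambda>C D. \<not> lexless (card (A \<inter> B)) (ncross C D) (ncross A B)"
  have "(\<forall>C D. eff (act f \<tau>) (act f \<tau>') C D \<longrightarrow> ?Q C D) \<longleftrightarrow> (\<forall>C D. eff \<tau> \<tau>' C D \<longrightarrow> ?Q C D)"
    using eff_act[OF f] ncross_vimage[OF f] vimage_inv_vimage(2)[OF aut_bij[OF f]] by metis
  then show ?thesis
    unfolding lmin_def by (simp add: eff_act[OF f] ncross_vimage[OF f] card_vimage_Int[OF f])
qed

lemma canon_vimage:
  assumes f: "aut f"
  shows "canon (f -` A) (f -` B) \<longleftrightarrow> canon A B"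
  unfolding canon_def using lmin_act[OF f] act_inv(2)[OF aut_bij[OF f]] by metis

lemma inf_tangle_ray:
  assumes w: "inf_tangle \<omega>"
  shows "\<exists>r. ray V E r \<and> (\<forall>(A, B)\<in>\<omega>. tail_in r B)"
proof -
  note tw = inf_is_tangle[OF w]
  have "V \<noteq> {}"
  proof
    assume V: "V = {}"
    then have "sep {} {}" by (intro sepI) (use E_V in auto)
    then have "({}, {}) \<in> \<omega>" using inf_tangle_orient[OF w] by fastforce
    then show False using tangle_V[OF tw] V by blast
  qed
  then obtain v0 where v0: "v0 \<in> V" by blast
  define R where "R = {(u, v). E u v}"
  define d where "d x = (LEAST n. (v0, x) \<in> R ^^ n)" for x
  define D where "D x = {y. \<exists>m. d y = d x + m \<and> (x, y) \<in> R ^^ m}" for x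
  define small where "small Y \<longleftrightarrow> (\<exists>A B. (A, B) \<in> \<omega> \<and> Y \<subseteq> A)" for Y
  have dpow: "(v0, x) \<in> R ^^ d x" if "x \<in> V" for x
  proof -
    have "(v0, x) \<in> R\<^sup>*" using connected[OF v0 that] unfolding conn_avoiding_def R_def by simp
    then obtain n where "(v0, x) \<in> R ^^ n" using rtrancl_imp_relpow by blast
    then show ?thesis unfolding d_def by (rule LeastI)
  qed
  have dle: "d y \<le> d x + m" if "x \<in> V" "(x, y) \<in> R ^^ m" for x y m
  proof -
    have "(v0, y) \<in> R ^^ (d x + m)" using dpow[OF that(1)] that(2) unfolding relpow_add by blast
    then show ?thesis unfolding d_def by (rule Least_le)
  qed
  have step: "\<exists>x'. E x x' \<and> x' \<in> V \<and> d x' = Suc (d x) \<and> (x', y) \<in> R ^^ m \<and> d y = d x' + m"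
    if xy: "x \<in> V" "(x, y) \<in> R ^^ Suc m" "d y = d x + Suc m" for x y m
  proof -
    obtain x' where x': "(x, x') \<in> R" "(x', y) \<in> R ^^ m" using xy(2) by (meson relpow_Suc_D2)
    then have xV: "E x x'" "x' \<in> V" using E_V unfolding R_def by auto
    have "d x' \<le> d x + 1" using dle[OF xy(1), of x' 1] x'(1) by simp
    moreover have "d y \<le> d x' + m" using dle[OF xV(2) x'(2)] .
    ultimately show ?thesis using xy(3) x' xV by (intro exI[of _ x']) auto
  qed
  have Dconn: "conn_avoiding E S x y"
    if "x \<in> V" "(x, y) \<in> R ^^ m" "d y = d x + m" "\<forall>s\<in>S. d s < d x" for S x y m
    using that
  proof (induction m arbitrary: x)
    case 0
    then show ?case by (auto intro: conn_refl)
  next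
    case (Suc m)
    obtain x' where x': "E x x'" "x' \<in> V" "d x' = Suc (d x)" "(x', y) \<in> R ^^ m" "d y = d x' + m"
      using step[OF Suc.prems(1-3)] by blast
    have "conn_avoiding E S x' y" using Suc.IH[OF x'(2,4,5)] Suc.prems(4) x'(3) by fastforce
    moreover have "conn_avoiding E S x x'" using x' Suc.prems(4) by (intro conn_edge) fastforce+
    ultimately show ?case using conn_trans by metis
  qed
  have smallUn: "small (Y \<union> Z)" if YZ: "small Y" "small Z" for Y Z
  proof -
    obtain A B C D where *: "(A, B) \<in> \<omega>" "Y \<subseteq> A" "(C, D) \<in> \<omega>" "Z \<subseteq> C"
      using YZ unfolding small_def by blast
    have s: "sep A B" "sep C D" "finite (A \<inter> B)" "finite (C \<inter> D)" using * tw tangle_sep tangle_fin by blast+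
    have "A \<union> B = C \<union> D" using s sep_V by blast
    then have "(A \<union> C, B \<inter> D) \<in> \<omega>"
      using tangle_Un[OF tw *(1,3)] inf_tangle_orient[OF w sep_corners(2)[OF s(1,2)] card_corners(3)] s by blast
    then show ?thesis using * unfolding small_def by blast
  qed
  have smallsing: "small {x}" if x: "x \<in> V" for x
  proof -
    have s: "sep {x} V" by (rule sepI) (use x E_V in auto)
    then have "({x}, V) \<in> \<omega>" using inf_tangle_orient[OF w s] tangle_V[OF tw] by auto
    then show ?thesis unfolding small_def by blast
  qed
  have smallUN: "small (\<Union>x\<in>F. Y x)" if "finite F" "\<And>x. x \<in> F \<Longrightarrow> small (Y x)" for F and Y :: "'a \<Rightarrow> 'a set"
    using that
  proof (induction F rule: finite_induct)
    case empty
    then show ?case using smallsing[OF v0] unfolding small_def by auto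
  next
    case (insert x F)
    then show ?case using smallUn[of "Y x" "\<Union>x\<in>F. Y x"] by simp
  qed
  have large0: "\<not> small (D v0)"
  proof
    assume "small (D v0)"
    then obtain A B where AB: "(A, B) \<in> \<omega>" "D v0 \<subseteq> A" unfolding small_def by blast
    have "(v0, v0) \<in> R ^^ 0" by simp
    then have "d v0 = 0" unfolding d_def by (metis Least_le le_zero_eq)
    then have "V \<subseteq> D v0" using dpow unfolding D_def by auto
    then have "A = V" using AB sep_V[OF tangle_sep[OF tw AB(1)]] by blast
    then show False using AB tangle_V[OF tw] by blast
  qed
  have nxt: "\<exists>x'. (x' \<in> V \<and> d x' = Suc n \<and> \<not> small (D x')) \<and> E x x'"
    if x: "x \<in> V \<and> d x = n \<and> \<not> small (D x)" for x n
  proof (rule ccontr)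
    assume no: "\<not> ?thesis"
    let ?F = "{x'. E x x' \<and> x' \<in> V \<and> d x' = Suc n}"
    have "finite ?F" by (rule finite_subset[OF _ finite_nbrs[of x]]) blast
    then have "small (\<Union>x'\<in>?F. D x')" using no by (intro smallUN) auto
    then have "small ({x} \<union> (\<Union>x'\<in>?F. D x'))" using smallUn smallsing x by blast
    moreover have "D x \<subseteq> {x} \<union> (\<Union>x'\<in>?F. D x')"
    proof
      fix y assume "y \<in> D x"
      then obtain m where m: "d y = d x + m" "(x, y) \<in> R ^^ m" unfolding D_def by blast
      show "y \<in> {x} \<union> (\<Union>x'\<in>?F. D x')"
      proof (cases m)
        case 0
        then show ?thesis using m by simp
      next
        case (Suc k)
        then obtain x' where "E x x' \<and> x' \<in> V \<and> d x' = Suc (d x) \<and> (x', y) \<in> R ^^ k \<and> d y = d x' + k"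
          using step[of x y k] x m by blast
        then show ?thesis using x unfolding D_def by blast
      qed
    qed
    ultimately show False using x unfolding small_def by (meson subset_trans)
  qed
  have dv0: "d v0 = 0" unfolding d_def by (rule Least_eq_0) simp
  have "\<exists>r. \<forall>n. (r n \<in> V \<and> d (r n) = n \<and> \<not> small (D (r n))) \<and> E (r n) (r (Suc n))"
    by (rule dependent_nat_choice) (use v0 large0 dv0 nxt in blast)+
  then obtain r where r: "\<And>n. r n \<in> V" "\<And>n. d (r n) = n" "\<And>n. \<not> small (D (r n))" "\<And>n. E (r n) (r (Suc n))"
    by blast
  have "inj r" by (rule injI) (metis r(2))
  then have "ray V E r" unfolding ray_def using r by blast
  moreover have "tail_in r B" if AB: "(A, B) \<in> \<omega>" for A B
  proof -
    have s: "sep A B" "finite (A \<inter> B)" using AB tw tangle_sep tangle_fin by blast+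
    define N where "N = Suc (\<Sum>s\<in>A \<inter> B. d s)"
    have "r n \<in> B" if n: "n \<ge> N" for n
    proof -
      have lt: "\<forall>s\<in>A \<inter> B. d s < d (r n)"
        using member_le_sum[of _ "A \<inter> B" d] s(2) n r(2) unfolding N_def by fastforce
      have "\<not> D (r n) \<subseteq> A" using r(3) AB unfolding small_def by blast
      then obtain y m where y: "y \<notin> A" "(r n, y) \<in> R ^^ m" "d y = d (r n) + m" unfolding D_def by blast
      have c: "conn_avoiding E (A \<inter> B) (r n) y" using Dconn[OF r(1) y(2,3) lt] .
      show ?thesis
      proof (rule ccontr)
        assume "r n \<notin> B"
        then have "r n \<in> A - B" using r(1) sep_V[OF s(1)] by blast
        then show False using sep_conn[OF s(1) c, of "{}"] y(1) by blast
      qed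
    qed
    then show ?thesis unfolding tail_in_def by blast
  qed
  ultimately show ?thesis by blast
qed

end

section \<open>Connected graphs\<close>

context cgraph
begin

definition link :: "('a set \<times> 'a set) set \<Rightarrow> ('a set \<times> 'a set) set \<Rightarrow> 'a set \<Rightarrow> 'a set \<Rightarrow> bool" where
  "link \<tau> \<tau>' A B \<longleftrightarrow> eff \<tau> \<tau>' A B \<and> canon A B"

lemma link_act:
  assumes f: "aut f" and l: "link \<tau> \<tau>' A B"
  shows "link (act f \<tau>) (act f \<tau>') (f ` A) (f ` B)"
proof -
  have [simp]: "f -` (f ` X) = X" for X using aut_bij[OF f] by (simp add: bij_is_inj inj_vimage_image_eq)
  have "eff (act f \<tau>) (act f \<tau>') (f ` A) (f ` B)" using l eff_act[OF f] unfolding link_def by simp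
  moreover have "canon (f ` A) (f ` B)" using l canon_vimage[OF f, of "f ` A" "f ` B"] unfolding link_def by simp
  ultimately show ?thesis unfolding link_def by blast
qed

lemma card_image_Int: "aut f \<Longrightarrow> card (f ` A \<inter> f ` B) = card (A \<inter> B)"
  by (metis aut_bij bij_is_inj card_image image_Int inj_on_subset subset_UNIV)

lemma limit_tangle:
  fixes \<tau> :: "nat \<Rightarrow> ('a set \<times> 'a set) set"
  assumes l: "\<And>i. link (\<tau> i) (\<tau>' i) (A i) (B i)" and v: "\<And>i. v \<in> A i \<inter> B i"
    and n: "\<And>i. i \<le> card (A i \<inter> B i)" and U: "ultra U"
  shows "\<exists>\<omega>. inf_tangle \<omega> \<and> (\<forall>k. {i. \<forall>C D. (C, D) \<in> \<tau> i \<longrightarrow> (D, C) \<in> \<omega> \<longrightarrow> k < card (C \<inter> D)} \<in> U)"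
proof -
  have e: "eff (\<tau> i) (\<tau>' i) (A i) (B i)" and N: "canon (A i) (B i)" for i using l unfolding link_def by blast+
  have t: "tangle (\<tau> i)" "tangle (\<tau>' i)" for i using e eff_tangle by blast+
  note mem = eff_mem[OF e]
  define \<omega> where "\<omega> = {(A, B). sep A B \<and> finite (A \<inter> B) \<and> {i. (A, B) \<in> \<tau> i} \<in> U}"
  have w: "inf_tangle \<omega>" unfolding \<omega>_def
  proof (rule ultra_limit_tangle[OF U t(1)])
    fix X Y assume s: "sep X Y" "finite (X \<inter> Y)"
    have "(X, Y) \<in> \<tau> i \<or> (Y, X) \<in> \<tau> i" if "card (X \<inter> Y) < i" for i
      using tangle_orient[OF t(1) mem(1) s, of i] n[of i] that by linarith
    then have "{i. card (X \<inter> Y) < i} \<subseteq> {i. (X, Y) \<in> \<tau> i \<or> (Y, X) \<in> \<tau> i}" by blast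
    then show "{i. (X, Y) \<in> \<tau> i \<or> (Y, X) \<in> \<tau> i} \<in> U" using ultra_mono[OF U ultra_ge[OF U]] by blast
  qed
  note tw = inf_is_tangle[OF w]
  have sub: "A i \<inter> B i \<subseteq> D" if CD: "canon C D" "(C, D) \<in> \<tau> i" "card (C \<inter> D) < i" for i C D
  proof -
    have "(C, D) \<in> \<tau>' i" using eff_agree[OF e CD(2)] CD(3) n[of i] by linarith
    then show ?thesis using separator_subset[OF N CD(1) t mem CD(2)] by blast
  qed
  have "{i. \<forall>C D. (C, D) \<in> \<tau> i \<longrightarrow> (D, C) \<in> \<omega> \<longrightarrow> k < card (C \<inter> D)} \<in> U" for k
  proof (rule ccontr)
    assume "\<not> ?thesis"
    then have "- {i. \<forall>C D. (C, D) \<in> \<tau> i \<longrightarrow> (D, C) \<in> \<omega> \<longrightarrow> k < card (C \<inter> D)} \<in> U" using ultra_Compl[OF U] by blast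
    moreover define M where "M = {i. \<exists>C D. (C, D) \<in> \<tau> i \<and> (D, C) \<in> \<omega> \<and> card (C \<inter> D) \<le> k}"
    have "- {i. \<forall>C D. (C, D) \<in> \<tau> i \<longrightarrow> (D, C) \<in> \<omega> \<longrightarrow> k < card (C \<inter> D)} = M"
      unfolding M_def by (simp only: Compl_eq mem_Collect_eq not_all not_imp not_less)
    ultimately have MU: "M \<in> U" by simp
    have "\<forall>i\<in>M. \<exists>s. canon (fst s) (snd s) \<and> s \<in> \<tau> i \<and> (snd s, fst s) \<in> \<omega> \<and> card (fst s \<inter> snd s) \<le> k"
    proof
      fix i assume "i \<in> M"
      then obtain C D where CD: "(C, D) \<in> \<tau> i" "(D, C) \<in> \<omega>" "card (C \<inter> D) \<le> k" unfolding M_def by blast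
      from ex_canon[OF t(1) tw CD(1,2)] obtain X Y where XY: "eff (\<tau> i) \<omega> X Y" "canon X Y" by blast
      then have "card (X \<inter> Y) \<le> k" using eff_le[OF XY(1) CD(1,2)] CD(3) by linarith
      then show "\<exists>s. canon (fst s) (snd s) \<and> s \<in> \<tau> i \<and> (snd s, fst s) \<in> \<omega> \<and> card (fst s \<inter> snd s) \<le> k"
        using XY eff_mem[OF XY(1)] by (intro exI[of _ "(X, Y)"]) simp
    qed
    from bchoice[OF this] obtain s where
      "\<forall>i\<in>M. canon (fst (s i)) (snd (s i)) \<and> s i \<in> \<tau> i \<and> (snd (s i), fst (s i)) \<in> \<omega> \<and> card (fst (s i) \<inter> snd (s i)) \<le> k" ..
    then have s: "canon (fst (s i)) (snd (s i))" "s i \<in> \<tau> i" "(snd (s i), fst (s i)) \<in> \<omega>"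
      "card (fst (s i) \<inter> snd (s i)) \<le> k" if "i \<in> M" for i using that by blast+
    define F where "F = {(A, B). canon A B \<and> card (A \<inter> B) \<le> k \<and> v \<in> A \<inter> B}"
    have finF: "finite F" unfolding F_def by (rule canon_finite_through)
    have "{i \<in> M. s i = x} \<notin> U" for x
    proof
      assume *: "{i \<in> M. s i = x} \<in> U"
      then have "{i \<in> M. s i = x} \<noteq> {}" using ultra_infinite[OF U] by (metis finite.emptyI)
      then obtain i where i: "i \<in> M" "s i = x" by blast
      have "{i \<in> M. s i = x} \<subseteq> {i. x \<in> \<tau> i}" using s(2) by blast
      then have "{i. x \<in> \<tau> i} \<in> U" using ultra_mono[OF U *] by blast
      moreover have "sep (fst x) (snd x)" "finite (fst x \<inter> snd x)"
        using tangle_sep[OF t(1), of "fst x" "snd x" i] tangle_fin[OF t(1), of "fst x" "snd x" i] s(2)[OF i(1)] i(2) by auto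
      ultimately have "(fst x, snd x) \<in> \<omega>" unfolding \<omega>_def by (simp add: case_prod_beta)
      then show False using s(3)[OF i(1)] i(2) tangle_anti[OF tw] by blast
    qed
    then have "(\<Union>x\<in>F. {i \<in> M. s i = x}) \<notin> U" using ultra_UNION[OF finF U] by blast
    moreover have "M \<subseteq> (\<Union>x\<in>F. {i \<in> M. s i = x}) \<union> {i \<in> M. s i \<notin> F}" by blast
    then have "(\<Union>x\<in>F. {i \<in> M. s i = x}) \<union> {i \<in> M. s i \<notin> F} \<in> U" using ultra_mono[OF U MU] by blast
    ultimately have "{i \<in> M. s i \<notin> F} \<in> U" using ultra_Un[OF U] by blast
    then have "{i \<in> M. s i \<notin> F} \<inter> {i. k < i} \<in> U" using ultra_Int[OF U _ ultra_ge[OF U]] by blast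
    then have "{i \<in> M. s i \<notin> F} \<inter> {i. k < i} \<noteq> {}" using ultra_infinite[OF U] by (metis finite.emptyI)
    then obtain i where i: "i \<in> M" "s i \<notin> F" "k < i" by blast
    obtain C D where CD: "s i = (C, D)" by fastforce
    note si = s[OF i(1), unfolded CD fst_conv snd_conv]
    have "v \<in> D" using sub[OF si(1,2)] si(4) i(3) v by fastforce
    moreover have "v \<notin> C \<inter> D" using i(2) si unfolding F_def CD by blast
    ultimately have vC: "v \<notin> C" by blast
    have "canon D C" using si(1) lmin_swap unfolding canon_def by blast
    moreover have "{j. (D, C) \<in> \<tau> j} \<in> U" using si(3) unfolding \<omega>_def by blast
    then have "{j. (D, C) \<in> \<tau> j} \<inter> {j. k < j} \<noteq> {}"
      using ultra_infinite[OF U ultra_Int[OF U _ ultra_ge[OF U]]] by (metis finite.emptyI)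
    then obtain j where "(D, C) \<in> \<tau> j" "k < j" by blast
    ultimately have "v \<in> C" using sub[of D C j] si(4) v[of j] by (auto simp: Int_commute)
    then show False using vC by blast
  qed
  then show ?thesis using w by blast
qed

end

locale qt_graph = cgraph +
  fixes W :: "'a set" and K :: nat
  assumes finite_W: "finite W"
    and reps: "v \<in> V \<Longrightarrow> \<exists>f. aut f \<and> f v \<in> W"
    and acc: "inf_tangle \<omega> \<Longrightarrow> inf_tangle \<omega>' \<Longrightarrow> \<omega> \<noteq> \<omega>' \<Longrightarrow>
      \<exists>A B. (A, B) \<in> \<omega> \<and> (B, A) \<in> \<omega>' \<and> card (A \<inter> B) \<le> K"
begin

lemma translate_subseq:
  fixes w :: "nat \<Rightarrow> 'a"
  assumes "\<And>i. w i \<in> V"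
  shows "\<exists>u g e. \<forall>n. aut (g n) \<and> n \<le> e n \<and> g n (w (e n)) = u"
proof -
  have "\<forall>i. \<exists>f. aut f \<and> f (w i) \<in> W" using reps assms by blast
  then obtain g where g: "\<And>i. aut (g i)" "\<And>i. g i (w i) \<in> W" by metis
  have "finite (range (\<lambda>i. g i (w i)))" using g(2) finite_W by (auto intro: finite_subset)
  from pigeonhole_infinite[OF infinite_UNIV_nat this] obtain i0 where "infinite {i. g i (w i) = g i0 (w i0)}" by auto
  then have "\<forall>n. \<exists>i. n \<le> i \<and> g i (w i) = g i0 (w i0)" unfolding infinite_nat_iff_unbounded_le by blast
  then obtain e where "\<And>n. n \<le> e n \<and> g (e n) (w (e n)) = g i0 (w i0)" by metis
  then show ?thesis using g(1) by (intro exI[of _ "g i0 (w i0)"] exI[of _ "\<lambda>n. g (e n)"] exI[of _ e]) blast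
qed

lemma link_V: "link \<tau> \<tau>' A B \<Longrightarrow> A \<inter> B \<subseteq> V"
  using eff_sep sep_V unfolding link_def by blast

lemma separators_escape:
  assumes w: "inf_tangle \<omega>" and AB: "(A, B) \<in> \<omega>"
  shows "\<exists>n. \<forall>C D \<tau>. link \<omega> \<tau> C D \<longrightarrow> n \<le> card (C \<inter> D) \<longrightarrow> \<not> C \<inter> D \<subseteq> A"
proof (rule ccontr)
  assume no: "\<not> ?thesis"
  define Y where "Y = {y. \<exists>C D \<tau>. link \<omega> \<tau> C D \<and> K < card (C \<inter> D) \<and> C \<inter> D \<subseteq> A \<and> y \<in> C \<inter> D}"
  note tw = inf_is_tangle[OF w]
  have s: "sep A B" "finite (A \<inter> B)" using tangle_sep tangle_fin tw AB by blast+
  have "infinite Y"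
  proof
    assume fin: "finite Y"
    obtain C D \<tau> where CD: "link \<omega> \<tau> C D" "Suc (card Y + K) \<le> card (C \<inter> D)" "C \<inter> D \<subseteq> A" using no by meson
    have "K < card (C \<inter> D)" using CD(2) by linarith
    then have "C \<inter> D \<subseteq> Y" using CD(1,3) unfolding Y_def by blast
    from card_mono[OF fin this] show False using CD(2) by linarith
  qed
  from ex_ultra[OF this] obtain U where U: "ultra U" "Y \<in> U" by blast
  have "Y \<subseteq> A" "A \<subseteq> V" using sep_V[OF s(1)] unfolding Y_def by auto
  then have AU: "A \<in> U" "V \<in> U" using ultra_mono[OF U] ultra_mono[OF U(1)] by blast+
  define \<eta> where "\<eta> = {(A, B). sep A B \<and> finite (A \<inter> B) \<and> B \<in> U}"
  have h: "inf_tangle \<eta>" unfolding \<eta>_def using ultra_vertex_tangle[OF U(1) AU(2)] .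
  have "(B, A) \<in> \<eta>" unfolding \<eta>_def using s sep_swap AU by (simp add: Int_commute)
  then have "\<omega> \<noteq> \<eta>" using AB tangle_anti[OF tw] by blast
  from acc[OF w h this] obtain P Q where PQ: "(P, Q) \<in> \<omega>" "(Q, P) \<in> \<eta>" "card (P \<inter> Q) \<le> K" by blast
  from ex_canon[OF tw inf_is_tangle[OF h] PQ(1,2)] obtain C D where CD: "eff \<omega> \<eta> C D" "canon C D" by blast
  have cK: "card (C \<inter> D) \<le> K" using eff_le[OF CD(1) PQ(1,2)] PQ(3) by linarith
  have "C \<in> U" using eff_mem(2)[OF CD(1)] unfolding \<eta>_def by blast
  then have "infinite (Y \<inter> C)" using ultra_infinite[OF U(1) ultra_Int[OF U]] by blast
  then have "infinite (Y \<inter> C - C \<inter> D)" using eff_fin[OF CD(1)] by (rule Diff_infinite_finite[rotated])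
  then have "Y \<inter> C - C \<inter> D \<noteq> {}" by (metis finite.emptyI)
  then obtain y where y: "y \<in> Y" "y \<notin> D" by blast
  obtain C' D' \<tau> where l: "link \<omega> \<tau> C' D'" "K < card (C' \<inter> D')" "y \<in> C' \<inter> D'" using y(1) unfolding Y_def by blast
  have e: "eff \<omega> \<tau> C' D'" "canon C' D'" using l unfolding link_def by blast+
  have "(C, D) \<in> \<tau>" using eff_agree[OF e(1) eff_mem(1)[OF CD(1)]] cK l(2) by linarith
  then have "C' \<inter> D' \<subseteq> D"
    using separator_subset[OF e(2) CD(2) eff_tangle[OF e(1)] eff_mem[OF e(1)] eff_mem(1)[OF CD(1)]] by blast
  then show False using l(3) y(2) by blast
qed

lemma stabiliser_returns:
  fixes w :: "nat \<Rightarrow> 'a"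
  assumes om: "inf_tangle \<omega>" and l: "\<And>i. link \<omega> (\<tau> i) (A i) (B i)"
    and n: "\<And>i. i \<le> card (A i \<inter> B i)" and w: "\<And>i. w i \<in> A i \<inter> B i"
  shows "\<exists>i0. \<forall>n. \<exists>i\<ge>n. \<exists>f. aut f \<and> act f \<omega> = \<omega> \<and> f (w i) = w i0"
proof -
  have "w i \<in> V" for i using w[of i] link_V[OF l[of i]] by blast
  from translate_subseq[of w, OF this] obtain u g e where g: "\<And>n. aut (g n)" "\<And>n. n \<le> e n" "\<And>n. g n (w (e n)) = u" by blast
  obtain U :: "nat set set" where U: "ultra U" using ex_ultra[OF infinite_UNIV_nat] by blast
  have "\<exists>\<omega>'. inf_tangle \<omega>' \<and> (\<forall>k. {n. \<forall>C D. (C, D) \<in> act (g n) \<omega> \<longrightarrow> (D, C) \<in> \<omega>' \<longrightarrow> k < card (C \<inter> D)} \<in> U)"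
  proof (rule limit_tangle[where v = u, OF _ _ _ U])
    fix i
    show "link (act (g i) \<omega>) (act (g i) (\<tau> (e i))) (g i ` A (e i)) (g i ` B (e i))" using link_act[OF g(1) l] .
    show "u \<in> g i ` A (e i) \<inter> g i ` B (e i)" unfolding g(3)[of i, symmetric] using w[of "e i"] by blast
    show "i \<le> card (g i ` A (e i) \<inter> g i ` B (e i))"
      using card_image_Int[OF g(1)] n[of "e i"] g(2)[of i] by (metis le_trans)
  qed
  then obtain \<omega>' where w': "inf_tangle \<omega>'"
    "{n. \<forall>C D. (C, D) \<in> act (g n) \<omega> \<longrightarrow> (D, C) \<in> \<omega>' \<longrightarrow> K < card (C \<inter> D)} \<in> U" by blast
  have "{n. \<forall>C D. (C, D) \<in> act (g n) \<omega> \<longrightarrow> (D, C) \<in> \<omega>' \<longrightarrow> K < card (C \<inter> D)} \<subseteq> {n. act (g n) \<omega> = \<omega>'}"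
    using acc[OF is_k_tangle_act[OF g(1) om] w'(1)] by (auto simp: not_less[symmetric])
  then have "infinite {n. act (g n) \<omega> = \<omega>'}" using ultra_infinite[OF U w'(2)] infinite_super by blast
  then have inf: "\<exists>m\<ge>n. act (g m) \<omega> = \<omega>'" for n unfolding infinite_nat_iff_unbounded_le by blast
  then obtain m0 where m0: "act (g m0) \<omega> = \<omega>'" by blast
  show ?thesis
  proof (rule exI[of _ "e m0"], rule allI)
    fix n
    obtain m where m: "m \<ge> n" "act (g m) \<omega> = \<omega>'" using inf by blast
    let ?f = "inv (g m0) \<circ> g m"
    have "aut ?f" using aut_comp[OF aut_inv] g(1) by blast
    moreover have "act ?f \<omega> = \<omega>"
      using m(2) m0 act_inv(1)[OF aut_bij[OF g(1)]] by (metis act_comp)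
    moreover have "?f (w (e m)) = w (e m0)"
      using g(3)[of m] g(3)[of m0] aut_bij[OF g(1)] by (metis bij_inv_eq_iff comp_apply)
    ultimately show "\<exists>i\<ge>n. \<exists>f. aut f \<and> act f \<omega> = \<omega> \<and> f (w i) = w (e m0)"
      using m(1) g(2)[of m] le_trans by blast
  qed
qed

definition rec :: "('a set \<times> 'a set) set \<Rightarrow> 'a set" where
  "rec \<omega> = {v. \<forall>n. \<exists>A B \<tau>. link \<omega> \<tau> A B \<and> n \<le> card (A \<inter> B) \<and> v \<in> A \<inter> B}"

lemma separators_recurrent:
  assumes om: "inf_tangle \<omega>"
  shows "\<exists>n. \<forall>A B \<tau>. link \<omega> \<tau> A B \<longrightarrow> n \<le> card (A \<inter> B) \<longrightarrow> A \<inter> B \<subseteq> rec \<omega>"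
proof (rule ccontr)
  assume "\<not> ?thesis"
  then have "\<forall>n. \<exists>A B \<tau> w. link \<omega> \<tau> A B \<and> n \<le> card (A \<inter> B) \<and> w \<in> A \<inter> B \<and> w \<notin> rec \<omega>" by blast
  then obtain A B \<tau> w where *: "\<And>n. link \<omega> (\<tau> n) (A n) (B n)" "\<And>n. n \<le> card (A n \<inter> B n)"
    "\<And>n. w n \<in> A n \<inter> B n" "\<And>n. w n \<notin> rec \<omega>" by metis
  from stabiliser_returns[OF om *(1-3)] obtain i0 where
    i0: "\<And>n. \<exists>i\<ge>n. \<exists>f. aut f \<and> act f \<omega> = \<omega> \<and> f (w i) = w i0" by blast
  have "\<exists>C D \<sigma>. link \<omega> \<sigma> C D \<and> n \<le> card (C \<inter> D) \<and> w i0 \<in> C \<inter> D" for n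
  proof -
    obtain i f where f: "i \<ge> n" "aut f" "act f \<omega> = \<omega>" "f (w i) = w i0" using i0 by blast
    have "link \<omega> (act f (\<tau> i)) (f ` A i) (f ` B i)" using link_act[OF f(2) *(1)] f(3) by metis
    moreover have "n \<le> card (f ` A i \<inter> f ` B i)"
      using card_image_Int[OF f(2)] *(2)[of i] f(1) by (metis le_trans)
    moreover have "f (w i) \<in> f ` A i \<inter> f ` B i" using *(3)[of i] by blast
    then have "w i0 \<in> f ` A i \<inter> f ` B i" unfolding f(4) .
    ultimately show ?thesis by blast
  qed
  then have "w i0 \<in> rec \<omega>" unfolding rec_def by blast
  then show False using *(4) by blast
qed

lemma interior_not_recurrent:
  assumes om: "inf_tangle \<omega>" and l: "link \<omega> \<tau> A B"
  shows "(A - B) \<inter> rec \<omega> = {}"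
proof (rule ccontr)
  assume "\<not> ?thesis"
  then obtain v where v: "v \<in> A" "v \<notin> B" "v \<in> rec \<omega>" by blast
  have e: "eff \<omega> \<tau> A B" "canon A B" using l unfolding link_def by blast+
  obtain n where n: "\<And>C D \<sigma>. link \<omega> \<sigma> C D \<Longrightarrow> n \<le> card (C \<inter> D) \<Longrightarrow> \<not> C \<inter> D \<subseteq> A"
    using separators_escape[OF om eff_mem(1)[OF e(1)]] by blast
  obtain C D \<sigma> where CD: "link \<omega> \<sigma> C D" "n \<le> card (C \<inter> D)" "v \<in> C \<inter> D" using v(3) unfolding rec_def by blast
  have e': "eff \<omega> \<sigma> C D" "canon C D" using CD(1) unfolding link_def by blast+
  have "\<not> B \<subseteq> C" using tangle_covers2[OF eff_tangle(1)[OF e(1)] eff_mem(1)[OF e(1)] eff_mem(1)[OF e'(1)]] by blast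
  moreover have "\<not> C \<subseteq> A" using n[OF CD(1,2)] by blast
  moreover have "\<not> D \<subseteq> B" "\<not> C \<subseteq> B" using v(2) CD(3) by blast+
  ultimately show False using canon_nested[OF e(2) e'(2)] unfolding nested_def by blast
qed

text \<open>A component of \<open>A - B\<close> whose neighbourhood is the whole separator \<open>A \<inter> B\<close>
  is also a component of the complement of \<open>rec \<omega>\<close>; hence it determines the separator.\<close>
lemma separator_determined:
  assumes om: "inf_tangle \<omega>" and l: "link \<omega> \<tau> A B" and S: "A \<inter> B \<subseteq> rec \<omega>"
    and z: "z \<in> A - B" "full (A \<inter> B) z"
  shows "A \<inter> B = {s \<in> rec \<omega>. \<exists>q. conn_avoiding E (rec \<omega>) z q \<and> E q s}"
proof -
  have dis: "rec \<omega> \<inter> (A - B) = {}" using interior_not_recurrent[OF om l] by blast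
  have s: "sep A B" using l eff_sep unfolding link_def by blast
  have eq: "conn_avoiding E (rec \<omega>) z q \<longleftrightarrow> conn_avoiding E (A \<inter> B) z q" for q
    using conn_mono[OF _ S] sep_conn[OF s _ z(1) dis] by blast
  show ?thesis
  proof
    show "A \<inter> B \<subseteq> {s \<in> rec \<omega>. \<exists>q. conn_avoiding E (rec \<omega>) z q \<and> E q s}"
      using S z(2) unfolding full_def eq by blast
    show "{s \<in> rec \<omega>. \<exists>q. conn_avoiding E (rec \<omega>) z q \<and> E q s} \<subseteq> A \<inter> B"
    proof safe
      fix x q assume x: "x \<in> rec \<omega>" "conn_avoiding E (rec \<omega>) z q" "E q x"
      then have "q \<in> A - B" using sep_conn[OF s _ z(1), of q "{}"] eq by blast
      then have "x \<in> A" using sep_edge[OF s x(3)] by blast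
      then show "x \<in> A" "x \<in> B" using x(1) dis by blast+
    qed
  qed
qed

lemma links_bounded:
  assumes om: "inf_tangle \<omega>"
  shows "\<exists>k. \<forall>\<tau> A B. link \<omega> \<tau> A B \<longrightarrow> card (A \<inter> B) \<le> k"
proof (rule ccontr)
  assume no: "\<not> ?thesis"
  obtain n0 where n0: "\<And>A B \<tau>. link \<omega> \<tau> A B \<Longrightarrow> n0 \<le> card (A \<inter> B) \<Longrightarrow> A \<inter> B \<subseteq> rec \<omega>"
    using separators_recurrent[OF om] by blast
  have "\<forall>n. \<exists>\<tau> A B w y. link \<omega> \<tau> A B \<and> n + n0 \<le> card (A \<inter> B) \<and> w \<in> A \<inter> B \<and>
    E w y \<and> y \<in> A - B \<and> full (A \<inter> B) y"
  proof
    fix n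
    obtain \<tau> A B where AB: "link \<omega> \<tau> A B" "n + n0 < card (A \<inter> B)" using no by (meson not_le)
    have e: "eff \<omega> \<tau> A B" using AB(1) unfolding link_def by blast
    obtain x where x: "x \<in> A - B" "full (A \<inter> B) x" using eff_full[OF e] by blast
    obtain w where w: "w \<in> A \<inter> B" using eff_nonempty[OF e] by blast
    obtain y where y: "conn_avoiding E (A \<inter> B) x y" "E y w" using x(2) w unfolding full_def by blast
    have "y \<in> A - B" using sep_conn[OF eff_sep[OF e] y(1) x(1), of "{}"] by blast
    moreover have "full (A \<inter> B) y" using x(2) conn_trans[OF conn_sym[OF y(1)]] unfolding full_def by blast
    ultimately show "\<exists>\<tau> A B w y. link \<omega> \<tau> A B \<and> n + n0 \<le> card (A \<inter> B) \<and> w \<in> A \<inter> B \<and>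
      E w y \<and> y \<in> A - B \<and> full (A \<inter> B) y" using AB w E_sym[OF y(2)] by (metis less_imp_le)
  qed
  then obtain \<tau> A B w y where seq: "\<And>n. link \<omega> (\<tau> n) (A n) (B n)" "\<And>n. n + n0 \<le> card (A n \<inter> B n)"
    "\<And>n. w n \<in> A n \<inter> B n" "\<And>n. E (w n) (y n)" "\<And>n. y n \<in> A n - B n" "\<And>n. full (A n \<inter> B n) (y n)" by metis
  have le: "n \<le> card (A n \<inter> B n)" for n using seq(2)[of n] by linarith
  from stabiliser_returns[OF om seq(1) le seq(3)] obtain i0 where
    "\<And>n. \<exists>i\<ge>n. \<exists>f. aut f \<and> act f \<omega> = \<omega> \<and> f (w i) = w i0" by blast
  then obtain e f where ef: "\<And>n. n \<le> e n" "\<And>n. aut (f n)" "\<And>n. act (f n) \<omega> = \<omega>" "\<And>n. f n (w (e n)) = w i0"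
    by metis
  define z where "z n = f n (y (e n))" for n
  have "range z \<subseteq> {u. E (w i0) u}"
  proof safe
    fix n
    have "E (f n (w (e n))) (f n (y (e n)))" using seq(4) aut_E[OF ef(2)] by blast
    then show "E (w i0) (z n)" unfolding z_def ef(4) .
  qed
  then have "finite (range z)" using finite_nbrs finite_subset by blast
  from pigeonhole_infinite[OF infinite_UNIV_nat this] obtain m0 where "infinite {n. z n = z m0}" by auto
  then have many: "\<exists>n\<ge>m. z n = z m0" for m unfolding infinite_nat_iff_unbounded_le by blast
  let ?S = "{s \<in> rec \<omega>. \<exists>q. conn_avoiding E (rec \<omega>) (z m0) q \<and> E q s}"
  obtain n where n: "n \<ge> Suc (card ?S)" "z n = z m0" using many by blast
  let ?A = "f n ` A (e n)" and ?B = "f n ` B (e n)"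
  have l: "link \<omega> (act (f n) (\<tau> (e n))) ?A ?B" using link_act[OF ef(2) seq(1)] ef(3) by metis
  have c: "card (?A \<inter> ?B) = card (A (e n) \<inter> B (e n))" using card_image_Int[OF ef(2)] .
  have inj: "inj (f n)" using aut_bij[OF ef(2)] bij_is_inj by blast
  have S: "?A \<inter> ?B \<subseteq> rec \<omega>" using n0[OF l] c seq(2)[of "e n"] by linarith
  have zin: "z m0 \<in> ?A - ?B"
    using seq(5)[of "e n"] n(2) inj unfolding z_def by (metis Diff_iff image_iff image_set_diff)
  have cn: "conn_avoiding E (?A \<inter> ?B) (f n u) (f n v)" if "conn_avoiding E (A (e n) \<inter> B (e n)) u v" for u v
    using that
  proof (induction rule: conn_induct)
    case refl
    then show ?case using inj by (intro conn_refl) (auto simp: inj_eq)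
  next
    case (step v w)
    show ?case
      by (rule conn_step[where v = "f n v"]) (use step inj aut_E[OF ef(2)] in \<open>auto simp: inj_eq\<close>)
  qed
  have "full (?A \<inter> ?B) (z m0)"
    unfolding full_def
  proof
    fix s assume "s \<in> ?A \<inter> ?B"
    then have "s \<in> f n ` (A (e n) \<inter> B (e n))" using image_Int[OF inj] by blast
    then obtain t where t: "t \<in> A (e n) \<inter> B (e n)" "s = f n t" by blast
    then obtain q where "conn_avoiding E (A (e n) \<inter> B (e n)) (y (e n)) q" "E q t"
      using seq(6) unfolding full_def by blast
    then have "conn_avoiding E (?A \<inter> ?B) (z n) (f n q)" "E (f n q) s"
      using cn t(2) aut_E[OF ef(2)] unfolding z_def by auto
    then show "\<exists>q. conn_avoiding E (?A \<inter> ?B) (z m0) q \<and> E q s" using n(2) by metis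
  qed
  then have "?A \<inter> ?B = ?S" using separator_determined[OF om l S zin] by blast
  then have "card ?S \<ge> e n" using c le[of "e n"] by simp
  then show False using n(1) ef(1)[of n] by linarith
qed

lemma tangle_order_bounded:
  "\<exists>k. \<forall>\<tau> \<tau>' A B. tangle \<tau> \<longrightarrow> tangle \<tau>' \<longrightarrow> (A, B) \<in> \<tau> \<longrightarrow> (B, A) \<in> \<tau>' \<longrightarrow>
     (\<exists>C D. (C, D) \<in> \<tau> \<and> (D, C) \<in> \<tau>' \<and> card (C \<inter> D) \<le> k)"
proof (rule ccontr)
  assume no: "\<not> ?thesis"
  have "\<forall>k. \<exists>\<tau> \<tau>' A B w. link \<tau> \<tau>' A B \<and> k \<le> card (A \<inter> B) \<and> w \<in> A \<inter> B"
  proof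
    fix k
    obtain \<tau> \<tau>' A B where *: "tangle \<tau>" "tangle \<tau>'" "(A, B) \<in> \<tau>" "(B, A) \<in> \<tau>'"
      "\<not> (\<exists>C D. (C, D) \<in> \<tau> \<and> (D, C) \<in> \<tau>' \<and> card (C \<inter> D) \<le> k)" using no by blast
    from ex_canon[OF *(1-4)] obtain C D where CD: "eff \<tau> \<tau>' C D" "canon C D" by blast
    then have "k \<le> card (C \<inter> D)" using *(5) eff_mem[OF CD(1)] by (meson linear)
    then show "\<exists>\<tau> \<tau>' A B w. link \<tau> \<tau>' A B \<and> k \<le> card (A \<inter> B) \<and> w \<in> A \<inter> B"
      using CD eff_nonempty[OF CD(1)] unfolding link_def by blast
  qed
  then obtain \<tau> \<tau>' A B w where seq: "\<And>i. link (\<tau> i) (\<tau>' i) (A i) (B i)" "\<And>i. i \<le> card (A i \<inter> B i)"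
    "\<And>i. w i \<in> A i \<inter> B i" by metis
  have "w i \<in> V" for i using seq(3)[of i] link_V[OF seq(1)[of i]] by blast
  from translate_subseq[of w, OF this] obtain u g e where g: "\<And>n. aut (g n)" "\<And>n. n \<le> e n" "\<And>n. g n (w (e n)) = u" by blast
  obtain U :: "nat set set" where U: "ultra U" using ex_ultra[OF infinite_UNIV_nat] by blast
  define \<sigma> where "\<sigma> n = act (g n) (\<tau> (e n))" for n
  define \<sigma>' where "\<sigma>' n = act (g n) (\<tau>' (e n))" for n
  define C where "C n = g n ` A (e n)" for n
  define D where "D n = g n ` B (e n)" for n
  have l: "link (\<sigma> n) (\<sigma>' n) (C n) (D n)" for n
    unfolding \<sigma>_def \<sigma>'_def C_def D_def using link_act[OF g(1) seq(1)] .
  have u: "u \<in> C n \<inter> D n" for n unfolding C_def D_def g(3)[of n, symmetric] using seq(3)[of "e n"] by blast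
  have le: "n \<le> card (C n \<inter> D n)" for n
    unfolding C_def D_def using card_image_Int[OF g(1)] seq(2)[of "e n"] g(2)[of n] by (metis le_trans)
  from limit_tangle[OF l u le U] obtain \<omega> where om: "inf_tangle \<omega>"
    and near: "\<And>k. {i. \<forall>C D. (C, D) \<in> \<sigma> i \<longrightarrow> (D, C) \<in> \<omega> \<longrightarrow> k < card (C \<inter> D)} \<in> U" by blast
  note tw = inf_is_tangle[OF om]
  obtain k where k: "\<And>\<tau> A B. link \<omega> \<tau> A B \<Longrightarrow> card (A \<inter> B) \<le> k" using links_bounded[OF om] by blast
  have "{i. \<forall>C D. (C, D) \<in> \<sigma> i \<longrightarrow> (D, C) \<in> \<omega> \<longrightarrow> k < card (C \<inter> D)} \<inter> {i. k < i} \<in> U"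
    using ultra_Int[OF U near ultra_ge[OF U]] .
  then have "{i. \<forall>C D. (C, D) \<in> \<sigma> i \<longrightarrow> (D, C) \<in> \<omega> \<longrightarrow> k < card (C \<inter> D)} \<inter> {i. k < i} \<noteq> {}"
    using ultra_infinite[OF U] by (metis finite.emptyI)
  then obtain i where i: "\<And>C D. (C, D) \<in> \<sigma> i \<Longrightarrow> (D, C) \<in> \<omega> \<Longrightarrow> k < card (C \<inter> D)" "k < i" by blast
  have e: "eff (\<sigma> i) (\<sigma>' i) (C i) (D i)" using l unfolding link_def by blast
  have "(C i, D i) \<in> \<omega> \<or> (D i, C i) \<in> \<omega>" using inf_tangle_orient[OF om eff_sep[OF e] eff_fin[OF e]] .
  then show False
  proof
    assume "(D i, C i) \<in> \<omega>"
    from ex_canon[OF tw eff_tangle(1)[OF e] this eff_mem(1)[OF e]] obtain P Q where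
      PQ: "eff \<omega> (\<sigma> i) P Q" "canon P Q" by blast
    then have "card (P \<inter> Q) \<le> k" using k unfolding link_def by blast
    moreover have "k < card (Q \<inter> P)" using i(1) eff_mem[OF PQ(1)] by blast
    ultimately show False by (simp add: Int_commute)
  next
    assume "(C i, D i) \<in> \<omega>"
    from ex_canon[OF tw eff_tangle(2)[OF e] this eff_mem(2)[OF e]] obtain P Q where
      PQ: "eff \<omega> (\<sigma>' i) P Q" "canon P Q" by blast
    then have le_k: "card (P \<inter> Q) \<le> k" using k unfolding link_def by blast
    then have "card (Q \<inter> P) < card (D i \<inter> C i)" using i(2) le[of i] by (simp add: Int_commute)
    then have "(Q, P) \<in> \<sigma> i" using eff_agree[OF eff_swap[OF e]] eff_mem[OF PQ(1)] by blast
    then have "k < card (Q \<inter> P)" using i(1) eff_mem[OF PQ(1)] by blast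
    then show False using le_k by (simp add: Int_commute)
  qed
qed

end

section \<open>Reduction to components\<close>

lemma inj_not_tail_in_finite: "inj r \<Longrightarrow> finite S \<Longrightarrow> \<not> tail_in r S"
proof
  assume r: "inj r" "finite S" "tail_in r S"
  then obtain N where N: "\<forall>n\<ge>N. r n \<in> S" unfolding tail_in_def by blast
  then have "r ` {N..} \<subseteq> S" by auto
  then have "finite (r ` {N..})" using r(2) finite_subset by blast
  then have "finite {N..}" using finite_imageD inj_on_subset[OF r(1)] by blast
  then show False using infinite_Ici by blast
qed

lemma tail_in_Int: "tail_in r A \<Longrightarrow> tail_in r B \<Longrightarrow> tail_in r (A \<inter> B)"
  unfolding tail_in_def by (metis IntI max.bounded_iff)

lemma tail_in_mono: "tail_in r A \<Longrightarrow> A \<subseteq> B \<Longrightarrow> tail_in r B"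
  unfolding tail_in_def by blast

context gr
begin

definition comp :: "'a \<Rightarrow> 'a set" where
  "comp v = {y. conn_avoiding E {} v y}"

definition Eon :: "'a set \<Rightarrow> 'a \<Rightarrow> 'a \<Rightarrow> bool" where
  "Eon X x y \<longleftrightarrow> E x y \<and> x \<in> X"

definition closed :: "'a set \<Rightarrow> bool" where
  "closed X \<longleftrightarrow> X \<subseteq> V \<and> (\<forall>x y. E x y \<longrightarrow> x \<in> X \<longrightarrow> y \<in> X)"

lemma closedD: "closed X \<Longrightarrow> E x y \<Longrightarrow> x \<in> X \<longleftrightarrow> y \<in> X"
  unfolding closed_def using E_sym by blast

lemma comp_self: "v \<in> comp v"
  unfolding comp_def by (simp add: conn_refl)

lemma closed_comp: "v \<in> V \<Longrightarrow> closed (comp v)"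
proof -
  assume v: "v \<in> V"
  have "y \<in> V" if "conn_avoiding E {} v y" for y
    using that by (induction rule: conn_induct) (use v E_V in auto)
  then show ?thesis unfolding closed_def comp_def using conn_step by fastforce
qed

lemma gr_Eon: "closed X \<Longrightarrow> gr X (Eon X)"
  unfolding gr_def graph_def Eon_def closed_def using E_sym graph unfolding graph_def by blast

lemma cgraph_comp:
  assumes lf: "locally_finite V E" and v: "v \<in> V"
  shows "cgraph (comp v) (Eon (comp v))"
proof -
  let ?X = "comp v"
  note cl = closed_comp[OF v]
  interpret H: gr ?X "Eon ?X" by (rule gr_Eon[OF cl])
  show ?thesis
  proof
    have "finite {u. Eon ?X x u}" if "x \<in> ?X" for x
    proof -
      have "x \<in> V" using cl that unfolding closed_def by blast
      then have "finite {u. E x u}" using lf unfolding locally_finite_def by blast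
      then show ?thesis by (rule rev_finite_subset) (auto simp: Eon_def)
    qed
    then show "locally_finite ?X (Eon ?X)" unfolding locally_finite_def by blast
    have c: "conn_avoiding (Eon ?X) {} v y" if "y \<in> ?X" for y
    proof -
      have "conn_avoiding E {} v y" using that unfolding comp_def by simp
      then show ?thesis
      proof (induction rule: conn_induct)
        case refl
        then show ?case by (simp add: conn_refl)
      next
        case (step u w)
        then have "Eon ?X u w" unfolding Eon_def comp_def by simp
        then show ?case using conn_step[OF step.IH] by simp
      qed
    qed
    show "conn_avoiding (Eon ?X) {} x y" if "x \<in> ?X" "y \<in> ?X" for x y
      using conn_trans[OF H.conn_sym[OF c[OF that(1)]] c[OF that(2)]] .
  qed
qed

lemma sep_extend:
  assumes X: "closed X" and s: "is_sep X (Eon X) A B"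
  shows "sep (A \<union> (V - X)) B" "(A \<union> (V - X)) \<inter> B = A \<inter> B"
proof -
  interpret H: gr X "Eon X" by (rule gr_Eon[OF X])
  have AB: "A \<union> B = X" "X \<subseteq> V" using H.sep_V[OF s] X unfolding closed_def by blast+
  show "sep (A \<union> (V - X)) B"
  proof (rule sepI)
    show "A \<union> (V - X) \<union> B = V" using AB by blast
    fix x y assume e: "E x y"
    show "x \<in> A \<union> (V - X) \<and> y \<in> A \<union> (V - X) \<or> x \<in> B \<and> y \<in> B"
    proof (cases "x \<in> X")
      case True
      then show ?thesis using H.sep_edge[OF s, of x y] e unfolding Eon_def by blast
    next
      case False
      then show ?thesis using closedD[OF X e] E_V[OF e] by blast
    qed
  qed
  show "(A \<union> (V - X)) \<inter> B = A \<inter> B" using AB by blast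
qed

lemma sep_restrict:
  assumes X: "closed X" and s: "sep A B"
  shows "is_sep X (Eon X) (A \<inter> X) (B \<inter> X)"
proof -
  interpret H: gr X "Eon X" by (rule gr_Eon[OF X])
  show ?thesis
  proof (rule H.sepI)
    show "A \<inter> X \<union> B \<inter> X = X" using sep_V[OF s] X unfolding closed_def by blast
    fix x y assume "Eon X x y"
    then have "E x y" "x \<in> X" "y \<in> X" using closedD[OF X] unfolding Eon_def by blast+
    then show "x \<in> A \<inter> X \<and> y \<in> A \<inter> X \<or> x \<in> B \<inter> X \<and> y \<in> B \<inter> X" using sep_edge[OF s, of x y] by blast
  qed
qed

definition restr :: "'a set \<Rightarrow> ('a set \<times> 'a set) set \<Rightarrow> ('a set \<times> 'a set) set" where
  "restr X \<tau> = {(A, B). is_sep X (Eon X) A B \<and> (A \<union> (V - X), B) \<in> \<tau>}"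

lemma is_k_tangle_restr:
  assumes X: "closed X" and t: "is_k_tangle V E k \<tau>" and mem: "(V - X, X) \<in> \<tau>"
  shows "is_k_tangle X (Eon X) k (restr X \<tau>)"
proof -
  interpret H: gr X "Eon X" by (rule gr_Eon[OF X])
  have tt: "tangle \<tau>" using t unfolding is_tangle_def by blast
  show ?thesis
  proof (rule H.is_k_tangleI)
    fix A B assume "(A, B) \<in> restr X \<tau>"
    then have AB: "H.sep A B" "(A \<union> (V - X), B) \<in> \<tau>" unfolding restr_def by blast+
    then show "H.sep A B \<and> finite (A \<inter> B) \<and> enat (card (A \<inter> B)) < k"
      using is_k_tangle_sep[OF t AB(2)] unfolding sep_extend(2)[OF X AB(1)] by blast
  next
    fix A B assume s: "H.sep A B" "finite (A \<inter> B)" "enat (card (A \<inter> B)) < k"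
    note s' = H.sep_swap[OF s(1)]
    note ex = sep_extend[OF X s(1)] and ex' = sep_extend[OF X s']
    have AB: "A \<union> B = X" using H.sep_V[OF s(1)] .
    have o: "(A \<union> (V - X), B) \<in> \<tau> \<or> (B, A \<union> (V - X)) \<in> \<tau>"
      using is_k_tangle_orient[OF t ex(1)] s unfolding ex(2) by blast
    have o': "(B \<union> (V - X), A) \<in> \<tau> \<or> (A, B \<union> (V - X)) \<in> \<tau>"
      using is_k_tangle_orient[OF t ex'(1)] s unfolding ex'(2) by (simp add: Int_commute)
    have "covers3 V E B (V - X) A"
      unfolding covers3_def
    proof (intro conjI allI impI)
      show "B \<union> (V - X) \<union> A = V" using AB X unfolding closed_def by blast
      fix x y assume e: "E x y"
      then show "x \<in> B \<and> y \<in> B \<or> x \<in> V - X \<and> y \<in> V - X \<or> x \<in> A \<and> y \<in> A"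
        using H.sep_edge[OF s(1), of x y] closedD[OF X e] E_V[OF e] unfolding Eon_def by blast
    qed
    then have "(B \<union> (V - X), A) \<in> \<tau>" if "(B, A \<union> (V - X)) \<in> \<tau>"
      using tangle_join[OF tt that mem o'] by blast
    then show "(A, B) \<in> restr X \<tau> \<or> (B, A) \<in> restr X \<tau>" using o s(1) s' unfolding restr_def by blast
  next
    fix A1 B1 A2 B2 A3 B3
    assume "(A1, B1) \<in> restr X \<tau>" "(A2, B2) \<in> restr X \<tau>" "(A3, B3) \<in> restr X \<tau>"
    then have nc: "\<not> covers3 V E (A1 \<union> (V - X)) (A2 \<union> (V - X)) (A3 \<union> (V - X))"
      using tangle_covers[OF tt] unfolding restr_def by blast
    show "\<not> covers3 X (Eon X) A1 A2 A3"
    proof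
      assume c: "covers3 X (Eon X) A1 A2 A3"
      have "covers3 V E (A1 \<union> (V - X)) (A2 \<union> (V - X)) (A3 \<union> (V - X))"
        unfolding covers3_def
      proof (intro conjI allI impI)
        have "A1 \<union> A2 \<union> A3 = X" "X \<subseteq> V" using c X unfolding covers3_def closed_def by blast+
        then show "A1 \<union> (V - X) \<union> (A2 \<union> (V - X)) \<union> (A3 \<union> (V - X)) = V" by blast
        fix x y assume e: "E x y"
        show "x \<in> A1 \<union> (V - X) \<and> y \<in> A1 \<union> (V - X) \<or> x \<in> A2 \<union> (V - X) \<and> y \<in> A2 \<union> (V - X) \<or>
          x \<in> A3 \<union> (V - X) \<and> y \<in> A3 \<union> (V - X)"
        proof (cases "x \<in> X")
          case True
          then have "Eon X x y" using e unfolding Eon_def by blast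
          then show ?thesis using c unfolding covers3_def by blast
        next
          case False
          then show ?thesis using closedD[OF X e] E_V[OF e] by blast
        qed
      qed
      then show False using nc by blast
    qed
  qed
qed

lemma mem_restr:
  assumes X: "closed X" and t: "tangle \<tau>" and mem: "(V - X, X) \<in> \<tau>" and AB: "(A, B) \<in> \<tau>"
  shows "(A \<inter> X, B \<inter> X) \<in> restr X \<tau>"
proof -
  have s: "sep A B" "finite (A \<inter> B)" using t AB tangle_sep tangle_fin by blast+
  note r = sep_restrict[OF X s(1)]
  note ex = sep_extend[OF X r]
  have "card (A \<inter> X \<inter> (B \<inter> X)) \<le> card (A \<inter> B)" "finite (A \<inter> X \<inter> (B \<inter> X))"
    using card_mono[OF s(2), of "A \<inter> X \<inter> (B \<inter> X)"] finite_subset[OF _ s(2), of "A \<inter> X \<inter> (B \<inter> X)"] by blast+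
  then have o: "(A \<inter> X \<union> (V - X), B \<inter> X) \<in> \<tau> \<or> (B \<inter> X, A \<inter> X \<union> (V - X)) \<in> \<tau>"
    using tangle_orient[OF t AB ex(1)] unfolding ex(2) by blast
  have "covers3 V E A (V - X) (B \<inter> X)"
    unfolding covers3_def
  proof (intro conjI allI impI)
    show "A \<union> (V - X) \<union> B \<inter> X = V" using sep_V[OF s(1)] by blast
    fix x y assume e: "E x y"
    then show "x \<in> A \<and> y \<in> A \<or> x \<in> V - X \<and> y \<in> V - X \<or> x \<in> B \<inter> X \<and> y \<in> B \<inter> X"
      using sep_edge[OF s(1), of x y] closedD[OF X e] E_V[OF e] by blast
  qed
  then have "(A \<inter> X \<union> (V - X), B \<inter> X) \<in> \<tau>" using tangle_join[OF t AB mem o] by blast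
  then show ?thesis unfolding restr_def using r by blast
qed

lemma sep_closed: "closed Y \<Longrightarrow> sep Y (V - Y)"
proof (rule sepI)
  assume Y: "closed Y"
  then show "Y \<union> (V - Y) = V" unfolding closed_def by blast
  show "x \<in> Y \<and> y \<in> Y \<or> x \<in> V - Y \<and> y \<in> V - Y" if "E x y" for x y
    using closedD[OF Y that] E_V[OF that] by blast
qed

lemma common_component:
  assumes t: "tangle \<tau>" "tangle \<tau>'" and AB: "(A, B) \<in> \<tau>" "(B, A) \<in> \<tau>'"
    and agree: "\<And>C D. (C, D) \<in> \<tau> \<Longrightarrow> (D, C) \<in> \<tau>' \<Longrightarrow> C \<inter> D \<noteq> {}"
  shows "\<exists>v\<in>V. (V - comp v, comp v) \<in> \<tau> \<and> (V - comp v, comp v) \<in> \<tau>'"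
proof (rule ccontr)
  assume no: "\<not> ?thesis"
  have s: "sep A B" "finite (A \<inter> B)" using t AB tangle_sep tangle_fin by blast+
  have SV: "A \<inter> B \<subseteq> V" using sep_V[OF s(1)] by blast
  have o: "(C, D) \<in> \<tau> \<or> (D, C) \<in> \<tau>" "(C, D) \<in> \<tau>' \<or> (D, C) \<in> \<tau>'"
    if "sep C D" "C \<inter> D = {}" for C D
    using tangle_orient[OF t(1) AB(1) that(1)] tangle_orient[OF t(2) AB(2) that(1)] that(2) by auto
  have one: "(comp v, V - comp v) \<in> \<tau>" if v: "v \<in> V" for v
  proof (rule ccontr)
    assume n: "(comp v, V - comp v) \<notin> \<tau>"
    note cs = sep_closed[OF closed_comp[OF v]]
    have 1: "(V - comp v, comp v) \<in> \<tau>" using o(1)[OF cs] n by blast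
    then have "(V - comp v, comp v) \<in> \<tau>'" using o(2)[OF cs] agree[OF 1] by blast
    then show False using no 1 v by blast
  qed
  have cl: "closed (\<Union>s\<in>F. comp s)" if "F \<subseteq> V" for F
    using closed_comp that unfolding closed_def by blast
  have un: "((\<Union>s\<in>F. comp s), V - (\<Union>s\<in>F. comp s)) \<in> \<tau>" if "finite F" "F \<subseteq> V" for F
    using that
  proof (induction F rule: finite_induct)
    case empty
    have "sep {} V" using sep_closed[of "{}"] unfolding closed_def by simp
    then have "({}, V) \<in> \<tau>"
      using tangle_mono[OF t(1) AB(1), of "{}" V] o(1)[of "{}" V] sep_V[OF s(1)] by blast
    then show ?case by simp
  next
    case (insert x F)
    let ?Y = "\<Union>s\<in>F. comp s"
    have eq: "?Y \<union> comp x = (\<Union>s\<in>insert x F. comp s)"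
      "(V - ?Y) \<inter> (V - comp x) = V - (\<Union>s\<in>insert x F. comp s)" by auto
    have IH: "(?Y, V - ?Y) \<in> \<tau>" and x: "x \<in> V" using insert by blast+
    have "(?Y \<union> comp x, (V - ?Y) \<inter> (V - comp x)) \<in> \<tau>"
      by (rule tangle_Un[OF t(1) IH one[OF x]]) (unfold eq, rule o(1)[OF sep_closed[OF cl[OF insert.prems]]], blast)
    then show ?case unfolding eq .
  qed
  define Y where "Y = (\<Union>s\<in>A \<inter> B. comp s)"
  have Yt: "(Y, V - Y) \<in> \<tau>" unfolding Y_def using un[OF s(2) SV] .
  have Yc: "closed Y" unfolding Y_def using cl[OF SV] .
  have sY: "A \<inter> B \<subseteq> Y" unfolding Y_def using comp_self by blast
  have e: "x \<in> A \<and> y \<in> A \<or> x \<in> Y \<and> y \<in> Y \<or> x \<in> B - Y \<and> y \<in> B - Y" if "E x y" for x y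
    using sep_edge[OF s(1) that] closedD[OF Yc that] by blast
  have YV: "Y \<subseteq> V" using Yc unfolding closed_def by blast
  have un: "A \<union> Y \<union> (B - Y) = V" using sep_V[OF s(1)] YV by blast
  have sp: "sep (A \<union> Y) (B - Y)" using un by (rule sepI) (use e in blast)
  have em: "(A \<union> Y) \<inter> (B - Y) = {}" using sY by blast
  have "covers3 V E A Y (B - Y)" unfolding covers3_def using un e by blast
  then have 1: "(A \<union> Y, B - Y) \<in> \<tau>" using tangle_join[OF t(1) AB(1) Yt o(1)[OF sp em]] by blast
  have "(A \<union> Y, B - Y) \<notin> \<tau>'" using tangle_covers2[OF t(2) AB(2)] by blast
  then have "(B - Y, A \<union> Y) \<in> \<tau>'" using o(2)[OF sp em] by blast
  then show False using agree[OF 1] em by blast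
qed

lemma conn_aut: "aut f \<Longrightarrow> conn_avoiding E {} x y \<Longrightarrow> conn_avoiding E {} (f x) (f y)"
proof -
  assume f: "aut f"
  assume "conn_avoiding E {} x y"
  then show ?thesis
  proof (induction rule: conn_induct)
    case refl
    then show ?case by (simp add: conn_refl)
  next
    case (step v w)
    then show ?case using conn_step[OF step.IH] aut_E[OF f] by blast
  qed
qed

lemma conn_aut_iff: "aut f \<Longrightarrow> conn_avoiding E {} (f x) (f y) \<longleftrightarrow> conn_avoiding E {} x y"
  using conn_aut[of f x y] conn_aut[OF aut_inv, of f "f x" "f y"] aut_bij
  by (auto simp: bij_is_inj)

lemma vimage_comp_eq: "aut f \<Longrightarrow> f -` comp (f v) = comp v"
  unfolding comp_def using conn_aut_iff by auto

lemma comp_eq: "x \<in> comp v \<Longrightarrow> comp x = comp v"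
  unfolding comp_def using conn_trans conn_sym by fast

lemma quasi_transitive_reps:
  assumes "quasi_transitive V E"
  shows "\<exists>W. finite W \<and> (\<forall>v\<in>V. \<exists>f. aut f \<and> f v \<in> W)"
proof (intro exI[of _ "(\<lambda>X. SOME w. w \<in> X) ` (orbit V E ` V)"] conjI ballI)
  show "finite ((\<lambda>X. SOME w. w \<in> X) ` (orbit V E ` V))"
    using assms unfolding quasi_transitive_def by blast
  fix v assume v: "v \<in> V"
  have "automorphism V E id" unfolding automorphism_def by simp
  then have "id v \<in> orbit V E v" unfolding orbit_def by blast
  then have "v \<in> orbit V E v" by simp
  then have "(SOME w. w \<in> orbit V E v) \<in> orbit V E v" by (rule someI)
  then obtain f where f: "automorphism V E f" "(SOME w. w \<in> orbit V E v) = f v" unfolding orbit_def by blast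
  define g where "g x = (if x \<in> V then f x else x)" for x
  have b: "bij_betw f V V" using f unfolding automorphism_def by blast
  have "bij_betw g V V" using b by (rule bij_betw_cong[THEN iffD1, rotated]) (simp add: g_def)
  moreover have "bij_betw g (- V) (- V)"
    by (rule bij_betw_cong[THEN iffD1, of _ id]) (simp_all add: g_def)
  ultimately have "bij_betw g (V \<union> - V) (V \<union> - V)" by (rule bij_betw_combine) simp
  then have "bij g" by simp
  moreover have gV: "g x \<in> V \<longleftrightarrow> x \<in> V" for x using bij_betwE[OF b] unfolding g_def by auto
  then have "g -` V = V" by blast
  moreover have "E (g x) (g y) \<longleftrightarrow> E x y" for x y
  proof (cases "x \<in> V \<and> y \<in> V")
    case True
    then show ?thesis using f(1) unfolding automorphism_def g_def by auto
  next
    case False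
    then show ?thesis using E_V[of x y] E_V[of "g x" "g y"] gV by blast
  qed
  ultimately have "aut g" unfolding aut_def by blast
  moreover have "g v \<in> (\<lambda>X. SOME w. w \<in> X) ` (orbit V E ` V)"
  proof -
    have "(SOME w. w \<in> orbit V E v) \<in> (\<lambda>X. SOME w. w \<in> X) ` (orbit V E ` V)" using v by blast
    then show ?thesis unfolding f(2) g_def using v by simp
  qed
  ultimately show "\<exists>f. aut f \<and> f v \<in> (\<lambda>X. SOME w. w \<in> X) ` (orbit V E ` V)" by blast
qed

lemma component_reps:
  assumes v: "v \<in> V" and W: "finite W" "\<And>x. x \<in> V \<Longrightarrow> \<exists>f. aut f \<and> f x \<in> W"
  shows "\<exists>W'. finite W' \<and> (\<forall>x\<in>comp v. \<exists>f. gr.aut (comp v) (Eon (comp v)) f \<and> f x \<in> W')"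
proof -
  let ?X = "comp v"
  note cl = closed_comp[OF v]
  interpret H: gr ?X "Eon ?X" by (rule gr_Eon[OF cl])
  let ?P = "\<lambda>w x f. x \<in> ?X \<and> aut f \<and> f x = w"
  have "\<forall>w\<in>{w \<in> W. \<exists>x f. ?P w x f}. \<exists>x. \<exists>f. ?P w x f" by blast
  from bchoice[OF this] obtain r where r: "\<forall>w\<in>{w \<in> W. \<exists>x f. ?P w x f}. \<exists>f. ?P w (r w) f" ..
  have "\<exists>f. H.aut f \<and> f x \<in> r ` {w \<in> W. \<exists>x f. ?P w x f}" if x: "x \<in> ?X" for x
  proof -
    have "x \<in> V" using x cl unfolding closed_def by blast
    then obtain f where f: "aut f" "f x \<in> W" using W(2) by blast
    then have w: "f x \<in> {w \<in> W. \<exists>x f. ?P w x f}" using x by blast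
    then obtain h where h: "r (f x) \<in> ?X" "aut h" "h (r (f x)) = f x" using r by blast
    let ?g = "inv h \<circ> f"
    have g: "aut ?g" using aut_comp[OF aut_inv[OF h(2)] f(1)] .
    have gx: "?g x = r (f x)" using h(3) aut_bij[OF h(2)] by (metis bij_inv_eq_iff comp_apply)
    have X: "?X = comp x" "?X = comp (?g x)" using comp_eq[OF x] comp_eq[OF h(1)] gx by simp_all
    have gX: "?g -` ?X = ?X" using vimage_comp_eq[OF g, of x] X by simp
    have "Eon ?X (?g y) (?g z) \<longleftrightarrow> Eon ?X y z" for y z
    proof -
      have "?g y \<in> ?X \<longleftrightarrow> y \<in> ?X" using gX by (metis vimage_eq)
      then show ?thesis unfolding Eon_def using aut_E[OF g] by blast
    qed
    then have "H.aut ?g" unfolding H.aut_def using gX aut_bij[OF g] by blast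
    then show ?thesis using gx w by (intro exI[of _ ?g]) simp
  qed
  then show ?thesis using W(1) by (intro exI[of _ "r ` {w \<in> W. \<exists>x f. ?P w x f}"]) simp
qed

lemma ray_self: "ray V E r \<Longrightarrow> equiv_rays V E r r"
  unfolding equiv_rays_def
proof (intro allI impI)
  fix S :: "'a set" assume r: "ray V E r" and S: "finite S"
  have "finite (r -` S)" using S r finite_vimageI unfolding ray_def by blast
  then obtain N where N: "\<forall>n\<in>r -` S. n < N" using finite_nat_set_iff_bounded by blast
  have c: "conn_avoiding E S (r N) (r n)" if "n \<ge> N" for n
    using that
  proof (induction n rule: dec_induct)
    case base
    then show ?case using N by (intro conn_refl) blast
  next
    case (step n)
    have "\<not> Suc n < N" using step.hyps by simp
    then have "r (Suc n) \<notin> S" using N by blast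
    then show ?case using conn_step[OF step.IH] r unfolding ray_def by blast
  qed
  show "\<exists>N. \<forall>n\<ge>N. \<forall>m\<ge>N. conn_avoiding E S (r n) (r m)"
    using conn_trans[OF conn_sym[OF c] c] by blast
qed

lemma component_acc:
  assumes lf: "locally_finite V E" and v: "v \<in> V"
    and K: "\<And>\<omega>1 \<omega>2. is_end V E \<omega>1 \<Longrightarrow> is_end V E \<omega>2 \<Longrightarrow> \<omega>1 \<noteq> \<omega>2 \<Longrightarrow>
      \<exists>A B. sep A B \<and> sep_order A B \<le> enat K \<and> sep_distinguishes_ends A B \<omega>1 \<omega>2"
    and w: "is_k_tangle (comp v) (Eon (comp v)) \<infinity> \<omega>" "is_k_tangle (comp v) (Eon (comp v)) \<infinity> \<omega>'" "\<omega> \<noteq> \<omega>'"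
  shows "\<exists>A B. (A, B) \<in> \<omega> \<and> (B, A) \<in> \<omega>' \<and> card (A \<inter> B) \<le> K"
proof -
  let ?X = "comp v"
  note X = closed_comp[OF v]
  interpret H: cgraph ?X "Eon ?X" by (rule cgraph_comp[OF lf v])
  have lift: "ray V E r" if "ray ?X (Eon ?X) r" for r
    using that X unfolding ray_def Eon_def closed_def by blast
  obtain r where r: "ray ?X (Eon ?X) r" "\<And>A B. (A, B) \<in> \<omega> \<Longrightarrow> tail_in r B"
    using H.inf_tangle_ray[OF w(1)] by blast
  obtain r' where r': "ray ?X (Eon ?X) r'" "\<And>A B. (A, B) \<in> \<omega>' \<Longrightarrow> tail_in r' B"
    using H.inf_tangle_ray[OF w(2)] by blast
  have inj: "inj r" "inj r'" and inX: "\<And>n. r n \<in> ?X" "\<And>n. r' n \<in> ?X"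
    using r(1) r'(1) unfolding ray_def by blast+
  define \<epsilon> where "\<epsilon> = {s. ray V E s \<and> equiv_rays V E r s}"
  define \<epsilon>' where "\<epsilon>' = {s. ray V E s \<and> equiv_rays V E r' s}"
  have ends: "is_end V E \<epsilon>" "is_end V E \<epsilon>'"
    unfolding is_end_def \<epsilon>_def \<epsilon>'_def using lift r(1) r'(1) by blast+
  have self: "r \<in> \<epsilon>" "r' \<in> \<epsilon>'"
    unfolding \<epsilon>_def \<epsilon>'_def using lift r(1) r'(1) ray_self by blast+
  have "\<epsilon> \<noteq> \<epsilon>'"
  proof
    assume "\<epsilon> = \<epsilon>'"
    then have eq: "equiv_rays V E r r'" using self unfolding \<epsilon>_def by blast
    obtain A B where AB: "(A, B) \<in> \<omega>" "(B, A) \<in> \<omega>'" using H.inf_tangle_neq[OF w] by blast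
    have s: "H.sep A B" "finite (A \<inter> B)" using AB w(1) H.is_k_tangle_sep by blast+
    note ex = sep_extend[OF X s(1)]
    obtain N where N: "\<And>n m. n \<ge> N \<Longrightarrow> m \<ge> N \<Longrightarrow> conn_avoiding E (A \<inter> B) (r n) (r' m)"
      using eq s(2) unfolding equiv_rays_def by meson
    obtain N1 where N1: "\<And>n. n \<ge> N1 \<Longrightarrow> r n \<in> B" using r(2)[OF AB(1)] unfolding tail_in_def by blast
    obtain N2 where N2: "\<And>n. n \<ge> N2 \<Longrightarrow> r' n \<in> A" using r'(2)[OF AB(2)] unfolding tail_in_def by blast
    define n where "n = max N (max N1 N2)"
    have n: "n \<ge> N" "n \<ge> N1" "n \<ge> N2" unfolding n_def by auto
    have c: "conn_avoiding E (A \<inter> B) (r n) (r' n)" using N n by blast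
    have "r n \<notin> A \<inter> B" using conn_notin[OF c] by blast
    then have "r n \<in> B - (A \<union> (V - ?X))" using N1[OF n(2)] inX by blast
    moreover have "B \<inter> (A \<union> (V - ?X)) = A \<inter> B" using ex(2) by blast
    ultimately have "r' n \<in> B - (A \<union> (V - ?X))"
      using sep_conn[OF sep_swap[OF ex(1)], of "r n" "r' n" "{}"] c by simp
    then show False using N2[OF n(3)] by blast
  qed
  from K[OF ends this] obtain C D where CD: "sep C D" "sep_order C D \<le> enat K"
    "sep_distinguishes_ends C D \<epsilon> \<epsilon>'" by blast
  have *: "\<exists>A B. (A, B) \<in> \<omega> \<and> (B, A) \<in> \<omega>' \<and> card (A \<inter> B) \<le> K"
    if CD: "sep C D" "sep_order C D \<le> enat K" "tail_in r C" "tail_in r' D" for C D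
  proof -
    have f: "finite (C \<inter> D)" "card (C \<inter> D) \<le> K"
      using CD(2) unfolding sep_order_def by (auto split: if_splits)
    have s: "H.sep (C \<inter> ?X) (D \<inter> ?X)" using sep_restrict[OF X CD(1)] .
    have fX: "finite ((C \<inter> ?X) \<inter> (D \<inter> ?X))" "card ((D \<inter> ?X) \<inter> (C \<inter> ?X)) \<le> card (C \<inter> D)"
      using card_mono[OF f(1), of "(D \<inter> ?X) \<inter> (C \<inter> ?X)"]
        finite_subset[OF _ f(1), of "(C \<inter> ?X) \<inter> (D \<inter> ?X)"] by blast+
    have "(C \<inter> ?X, D \<inter> ?X) \<notin> \<omega>"
    proof
      assume "(C \<inter> ?X, D \<inter> ?X) \<in> \<omega>"
      then have "tail_in r D" using r(2) tail_in_mono by blast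
      then show False using tail_in_Int[OF CD(3)] inj_not_tail_in_finite[OF inj(1) f(1)] by blast
    qed
    then have 1: "(D \<inter> ?X, C \<inter> ?X) \<in> \<omega>" using H.inf_tangle_orient[OF w(1) s fX(1)] by blast
    have "(D \<inter> ?X, C \<inter> ?X) \<notin> \<omega>'"
    proof
      assume "(D \<inter> ?X, C \<inter> ?X) \<in> \<omega>'"
      then have "tail_in r' C" using r'(2) tail_in_mono by blast
      then show False using tail_in_Int[OF _ CD(4)] inj_not_tail_in_finite[OF inj(2) f(1)] by blast
    qed
    then have 2: "(C \<inter> ?X, D \<inter> ?X) \<in> \<omega>'" using H.inf_tangle_orient[OF w(2) s fX(1)] by blast
    show ?thesis using 1 2 fX(2) f(2) le_trans by blast
  qed
  from CD(3) self have "tail_in r C \<and> tail_in r' D \<or> tail_in r D \<and> tail_in r' C"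
    unfolding sep_distinguishes_ends_def by blast
  then show ?thesis
  proof
    assume "tail_in r C \<and> tail_in r' D"
    then show ?thesis using *[OF CD(1,2)] by blast
  next
    assume "tail_in r D \<and> tail_in r' C"
    moreover have "sep_order D C \<le> enat K" using CD(2) unfolding sep_order_def by (simp only: Int_commute)
    ultimately show ?thesis using *[OF sep_swap[OF CD(1)]] by blast
  qed
qed

lemma component_bound:
  assumes lf: "locally_finite V E" and qt: "quasi_transitive V E" and ac: "accessible V E" and v: "v \<in> V"
  shows "\<exists>k. \<forall>\<tau> \<tau>' A B. tangle \<tau> \<longrightarrow> tangle \<tau>' \<longrightarrow> (V - comp v, comp v) \<in> \<tau> \<longrightarrow>
    (V - comp v, comp v) \<in> \<tau>' \<longrightarrow> (A, B) \<in> \<tau> \<longrightarrow> (B, A) \<in> \<tau>' \<longrightarrow>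
    (\<exists>C D. (C, D) \<in> \<tau> \<and> (D, C) \<in> \<tau>' \<and> card (C \<inter> D) \<le> k)"
proof -
  let ?X = "comp v"
  note X = closed_comp[OF v]
  obtain K where K: "\<And>\<omega>1 \<omega>2. is_end V E \<omega>1 \<Longrightarrow> is_end V E \<omega>2 \<Longrightarrow> \<omega>1 \<noteq> \<omega>2 \<Longrightarrow>
      \<exists>A B. sep A B \<and> sep_order A B \<le> enat K \<and> sep_distinguishes_ends A B \<omega>1 \<omega>2"
    using ac unfolding accessible_def by blast
  obtain W where W: "finite W" "\<And>x. x \<in> V \<Longrightarrow> \<exists>f. aut f \<and> f x \<in> W"
    using quasi_transitive_reps[OF qt] by blast
  obtain W' where W': "finite W'" "\<And>x. x \<in> ?X \<Longrightarrow> \<exists>f. gr.aut ?X (Eon ?X) f \<and> f x \<in> W'"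
    using component_reps[OF v W] by blast
  interpret H: qt_graph ?X "Eon ?X" W' K
    by (rule qt_graph.intro[OF cgraph_comp[OF lf v]], rule qt_graph_axioms.intro)
      (use W' component_acc[OF lf v K] in blast)+
  obtain k where k: "\<And>\<tau> \<tau>' A B. H.tangle \<tau> \<Longrightarrow> H.tangle \<tau>' \<Longrightarrow> (A, B) \<in> \<tau> \<Longrightarrow> (B, A) \<in> \<tau>' \<Longrightarrow>
     \<exists>C D. (C, D) \<in> \<tau> \<and> (D, C) \<in> \<tau>' \<and> card (C \<inter> D) \<le> k"
    using H.tangle_order_bounded by blast
  show ?thesis
  proof (intro exI[of _ k] allI impI)
    fix \<tau> \<tau>' A B
    assume t: "tangle \<tau>" "tangle \<tau>'" and m: "(V - ?X, ?X) \<in> \<tau>" "(V - ?X, ?X) \<in> \<tau>'"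
      and AB: "(A, B) \<in> \<tau>" "(B, A) \<in> \<tau>'"
    have "H.tangle (restr ?X \<tau>)" "H.tangle (restr ?X \<tau>')"
      using t m is_k_tangle_restr[OF X] unfolding is_tangle_def by blast+
    from k[OF this mem_restr[OF X t(1) m(1) AB(1)] mem_restr[OF X t(2) m(2) AB(2)]]
    obtain C D where CD: "(C, D) \<in> restr ?X \<tau>" "(D, C) \<in> restr ?X \<tau>'" "card (C \<inter> D) \<le> k" by blast
    have s: "H.sep C D" "H.sep D C" and 1: "(C \<union> (V - ?X), D) \<in> \<tau>" and 2: "(D \<union> (V - ?X), C) \<in> \<tau>'"
      using CD unfolding restr_def by blast+
    note ex = sep_extend[OF X s(1)] and ex' = sep_extend[OF X s(2)]
    have "(D, C \<union> (V - ?X)) \<in> \<tau>' \<or> (C \<union> (V - ?X), D) \<in> \<tau>'"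
      using tangle_orient[OF t(2) 2 ex(1)] tangle_fin[OF t(1) 1] unfolding ex(2) ex'(2)
      by (auto simp: Int_commute)
    then have "(D, C \<union> (V - ?X)) \<in> \<tau>'" using tangle_mono[OF t(2) 2] by blast
    then show "\<exists>C D. (C, D) \<in> \<tau> \<and> (D, C) \<in> \<tau>' \<and> card (C \<inter> D) \<le> k"
      using 1 CD(3) ex(2) by metis
  qed
qed

lemma tangle_distinction_bounded:
  assumes lf: "locally_finite V E" and qt: "quasi_transitive V E" and ac: "accessible V E"
  shows "\<exists>k. \<forall>\<tau> \<tau>' A B. tangle \<tau> \<longrightarrow> tangle \<tau>' \<longrightarrow> (A, B) \<in> \<tau> \<longrightarrow> (B, A) \<in> \<tau>' \<longrightarrow>
    (\<exists>C D. (C, D) \<in> \<tau> \<and> (D, C) \<in> \<tau>' \<and> card (C \<inter> D) \<le> k)"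
proof -
  obtain W where W: "finite W" "\<And>x. x \<in> V \<Longrightarrow> \<exists>f. aut f \<and> f x \<in> W"
    using quasi_transitive_reps[OF qt] by blast
  have "\<forall>v\<in>V. \<exists>k. \<forall>\<tau> \<tau>' A B. tangle \<tau> \<longrightarrow> tangle \<tau>' \<longrightarrow> (V - comp v, comp v) \<in> \<tau> \<longrightarrow>
    (V - comp v, comp v) \<in> \<tau>' \<longrightarrow> (A, B) \<in> \<tau> \<longrightarrow> (B, A) \<in> \<tau>' \<longrightarrow>
    (\<exists>C D. (C, D) \<in> \<tau> \<and> (D, C) \<in> \<tau>' \<and> card (C \<inter> D) \<le> k)"
    using component_bound[OF lf qt ac] by blast
  from bchoice[OF this] obtain k where "\<forall>v\<in>V. \<forall>\<tau> \<tau>' A B. tangle \<tau> \<longrightarrow> tangle \<tau>' \<longrightarrow> (V - comp v, comp v) \<in> \<tau> \<longrightarrow>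
    (V - comp v, comp v) \<in> \<tau>' \<longrightarrow> (A, B) \<in> \<tau> \<longrightarrow> (B, A) \<in> \<tau>' \<longrightarrow>
    (\<exists>C D. (C, D) \<in> \<tau> \<and> (D, C) \<in> \<tau>' \<and> card (C \<inter> D) \<le> k v)" ..
  then have k: "\<exists>C D. (C, D) \<in> \<tau> \<and> (D, C) \<in> \<tau>' \<and> card (C \<inter> D) \<le> k v"
    if "v \<in> V" "tangle \<tau>" "tangle \<tau>'" "(V - comp v, comp v) \<in> \<tau>" "(V - comp v, comp v) \<in> \<tau>'"
      "(A, B) \<in> \<tau>" "(B, A) \<in> \<tau>'" for v \<tau> \<tau>' A B
    using that by simp
  show ?thesis
  proof (intro exI[of _ "\<Sum>w\<in>W. k w"] allI impI)
    fix \<tau> \<tau>' A B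
    assume t: "tangle \<tau>" "tangle \<tau>'" and AB: "(A, B) \<in> \<tau>" "(B, A) \<in> \<tau>'"
    show "\<exists>C D. (C, D) \<in> \<tau> \<and> (D, C) \<in> \<tau>' \<and> card (C \<inter> D) \<le> (\<Sum>w\<in>W. k w)"
    proof (cases "\<exists>C D. (C, D) \<in> \<tau> \<and> (D, C) \<in> \<tau>' \<and> C \<inter> D = {}")
      case True
      then show ?thesis by fastforce
    next
      case False
      then obtain v where v: "v \<in> V" "(V - comp v, comp v) \<in> \<tau>" "(V - comp v, comp v) \<in> \<tau>'"
        using common_component[OF t AB] by blast
      obtain f where f: "aut f" "f v \<in> W" using W(2)[OF v(1)] by blast
      have [simp]: "f -` (f ` Z) = Z" for Z using aut_bij[OF f(1)] by (simp add: bij_is_inj inj_vimage_image_eq)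
      have vi: "f -` (V - comp (f v)) = V - comp v" "f -` comp (f v) = comp v"
        using vimage_comp_eq[OF f(1), of v] f(1) unfolding aut_def by (simp_all only: vimage_Diff)
      have "\<exists>C D. (C, D) \<in> act f \<tau> \<and> (D, C) \<in> act f \<tau>' \<and> card (C \<inter> D) \<le> k (f v)"
      proof (rule k[OF _ tangle_act[OF f(1) t(1)] tangle_act[OF f(1) t(2)]])
        show "f v \<in> V" using aut_V[OF f(1)] v(1) by blast
        show "(V - comp (f v), comp (f v)) \<in> act f \<tau>" "(V - comp (f v), comp (f v)) \<in> act f \<tau>'"
          using v(2,3) unfolding mem_act vi by blast+
        show "(f ` A, f ` B) \<in> act f \<tau>" "(f ` B, f ` A) \<in> act f \<tau>'" using AB unfolding mem_act by simp_all
      qed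
      then obtain C D where CD: "(f -` C, f -` D) \<in> \<tau>" "(f -` D, f -` C) \<in> \<tau>'" "card (C \<inter> D) \<le> k (f v)"
        unfolding mem_act by blast
      moreover have "k (f v) \<le> (\<Sum>w\<in>W. k w)" using member_le_sum[OF f(2), of k] W(1) by simp
      ultimately show ?thesis using card_vimage_Int[OF f(1)] by (metis le_trans)
    qed
  qed
qed

end

theorem theorem3:
  fixes V :: "'a set" and E :: "'a \<Rightarrow> 'a \<Rightarrow> bool"
  assumes "graph V E"
    and "accessible V E"
    and "locally_finite V E"
    and "quasi_transitive V E"
  shows "tangle_accessible V E"
proof -
  interpret gr V E using assms(1) by unfold_locales
  obtain k where k: "\<And>\<tau> \<tau>' A B. tangle \<tau> \<Longrightarrow> tangle \<tau>' \<Longrightarrow> (A, B) \<in> \<tau> \<Longrightarrow> (B, A) \<in> \<tau>' \<Longrightarrow>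
    \<exists>C D. (C, D) \<in> \<tau> \<and> (D, C) \<in> \<tau>' \<and> card (C \<inter> D) \<le> k"
    using tangle_distinction_bounded[OF assms(3,4,2)] by blast
  show ?thesis
    unfolding tangle_accessible_def
  proof (intro exI[of _ k] allI impI)
    fix \<tau> \<tau>' assume t: "tangle \<tau>" "tangle \<tau>'" and "\<exists>A B. sep_distinguishes_tangles V E A B \<tau> \<tau>'"
    then obtain A B where "(A, B) \<in> \<tau>" "(B, A) \<in> \<tau>'" unfolding sep_distinguishes_tangles_def by blast
    then obtain C D where CD: "(C, D) \<in> \<tau>" "(D, C) \<in> \<tau>'" "card (C \<inter> D) \<le> k" using k[OF t] by blast
    have "sep C D" "finite (C \<inter> D)" using tangle_sep[OF t(1) CD(1)] tangle_fin[OF t(1) CD(1)] .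
    moreover have "C \<noteq> D" using tangle_anti[OF t(1) CD(1)] CD(1) by blast
    ultimately show "\<exists>A B. sep_distinguishes_tangles V E A B \<tau> \<tau>' \<and> sep_order A B \<le> enat k"
      using CD unfolding sep_distinguishes_tangles_def sep_order_def by (intro exI[of _ C] exI[of _ D]) simp
  qed
qed

end
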